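(* Let $q>0$ be real, $q\ne1$. Let $\mathbf{H}$ be the Hilbert space completion of $\mathbb{C}[SU_q(2)]\otimes\Sigma$, $\Sigma=V_{1/2}$, with respect to the Haar state, let $\eta$ be the $*$-representation of $\mathbb{C}[SU_q(2)]$ on $\mathbf{H}$ given by the GNS representation, and let $D$ be the self-adjoint operator on $\mathbf{H}$ acting as $[2j]$ on $W_j^{\uparrow}$ ($j\in\frac12\mathbb{N}_0$) and as $-[2j+2]$ on $W_j^{\downarrow}$ ($j\in\frac12\mathbb{N}$). Let $F=D(1+D^2)^{-1/2}$. Then the triple $(\mathbb{C}[SU_q(2)],F,\mathbf{H})$ is a $1$-summable Fredholm module.
   Context: **$q$-integers:** $[n]=(q^n-q^{-n})/(q-q^{-1})$. **$U_q(\mathfrak{su}_2)$:** generated by $k^{\pm1},e,f$ with $kek^{-1}=qe$, $kfk^{-1}=q^{-1}f$, $[e,f]=(k^2-k^{-2})/(q-q^{-1})$, coproduct $\triangle(k)=k\otimes k$, $\triangle(e)=e\otimes k+k^{-1}\otimes e$, $\triangle(f)=f\otimes k+k^{-1}\otimes f$ (Sweedler notation $\triangle(x)=x'\otimes x''$), and $*$-structure $k^*=k$, $e^*=f$. For $l\in\frac12\mathbb{N}_0$, $V_l$ has orthonormal basis $|l,m\rangle$, $m=-l,-l+1,\dots,l$, and representation $\pi_{l,q}$: $k|l,m\rangle=q^m|l,m\rangle$, $e|l,m\rangle=\sqrt{[l-m][l+m+1]}\,|l,m+1\rangle$, $f|l,m\rangle=\sqrt{[l-m+1][l+m]}\,|l,m-1\rangle$.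 **$\mathbb{C}[SU_q(2)]$:** the Hopf $*$-algebra spanned by the matrix elements $t^l_{nm}(x)=\langle l,n|\pi_{l,q}(x)|l,m\rangle$ of the representations $V_l$ (product dual to $\triangle$). As a vector space it is $\bigoplus_{l}V_l\otimes V_l$, where $|l,m\rangle\otimes|l,n\rangle$ corresponds to $t^l_{nm}$ normalized to norm one with respect to the inner product $\langle a,b\rangle=\mathbf{h}(a^*b)$, $\mathbf{h}$ being the Haar state. $\mathbf{H}$ is the completion of $\mathbb{C}[SU_q(2)]\otimes\Sigma$ for this inner product tensored with the standard one on $\Sigma=V_{1/2}\cong\mathbb{C}^2$. The representation $\eta$ is by left multiplication on the first factor: $\eta(a)(b\otimes s)=ab\otimes s$. **Decomposition:** $U_q(\mathfrak{su}_2)$ acts on $\mathbf{H}$ by $x.(|l,m\rangle\otimes|l,n\rangle\otimes|\tfrac12,s\rangle)=\pi_{l,q}(x')|l,m\rangle\otimes|l,n\rangle\otimes\pi_{1/2,q}(x'')|\tfrac12,s\rangle$. For each $j\in\frac12\mathbb{N}_0$ the subspace $V_j\otimes V_j\otimes\Sigma$ (the $l=j$ part) decomposes orthogonally under this action as $W_j^{\uparrow}\oplus W_j^{\downarrow}$, where $W_j^{\uparrow}\simeq V_{j+1/2}\otimes V_j$ and $W_j^{\downarrow}\simeq V_{j-1/2}\otimes V_j$ are the isotypic components of spin $j+\frac12$ and $j-\frac12$ (the action being on the first factor), and $W_0^{\downarrow}=0$. In particular $D=0$ on $W_0^{\uparrow}$. **$1$-summable Fredholm module** (odd, over the $*$-algebra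 $\mathcal{A}=\mathbb{C}[SU_q(2)]$ with bounded $*$-representation $\eta$): $F$ is a bounded self-adjoint operator with $F^2-1\in L^1(\mathbf{H})$ and $[F,\eta(a)]\in L^1(\mathbf{H})$ for all $a\in\mathcal{A}$, where $L^1(\mathbf{H})$ denotes the trace class operators. *)

theory Defs
  imports "HOL-Analysis.Analysis"
begin

section \<open>Complex Hilbert spaces\<close>

text \<open>The inner product is conjugate-linear in its first argument.\<close>

class complex_hilbert_space = banach +
  fixes scaleC :: "complex \<Rightarrow> 'a \<Rightarrow> 'a" (infixr \<open>*\<^sub>C\<close> 75)
    and cinner :: "'a \<Rightarrow> 'a \<Rightarrow> complex"
  assumes scaleC_add_right: "c *\<^sub>C (x + y) = c *\<^sub>C x + c *\<^sub>C y"
    and scaleC_add_left: "(c + d) *\<^sub>C x = c *\<^sub>C x + d *\<^sub>C x"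
    and scaleC_scaleC: "c *\<^sub>C (d *\<^sub>C x) = (c * d) *\<^sub>C x"
    and scaleR_scaleC: "r *\<^sub>R x = complex_of_real r *\<^sub>C x"
    and cinner_commute: "cinner x y = cnj (cinner y x)"
    and cinner_add_right: "cinner x (y + z) = cinner x y + cinner x z"
    and cinner_scaleC_right: "cinner x (c *\<^sub>C y) = c * cinner x y"
    and cinner_norm: "cinner x x = complex_of_real ((norm x)\<^sup>2)"

lemma scaleC_one: "(1::complex) *\<^sub>C x = (x::'a::complex_hilbert_space)"
  by (metis of_real_1 scaleR_one scaleR_scaleC)

global_interpretation complex_vector:
  vector_space "scaleC :: complex \<Rightarrow> 'a \<Rightarrow> 'a::complex_hilbert_space"
  defines cspan = complex_vector.span
  by unfold_locales (simp_all add: scaleC_add_right scaleC_add_left scaleC_scaleC scaleC_one)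

definition bounded_clinear ::
    "('a::complex_hilbert_space \<Rightarrow> 'b::complex_hilbert_space) \<Rightarrow> bool" where
  "bounded_clinear T \<longleftrightarrow> bounded_linear T \<and> (\<forall>c x. T (c *\<^sub>C x) = c *\<^sub>C T x)"

definition is_adjoint ::
    "('a::complex_hilbert_space \<Rightarrow> 'a) \<Rightarrow> ('a \<Rightarrow> 'a) \<Rightarrow> bool" where
  "is_adjoint T S \<longleftrightarrow> (\<forall>x y. cinner (T x) y = cinner x (S y))"

definition positive_operator :: "('a::complex_hilbert_space \<Rightarrow> 'a) \<Rightarrow> bool" where
  "positive_operator T \<longleftrightarrow>
     bounded_clinear T \<and> (\<forall>x. Im (cinner x (T x)) = 0 \<and> 0 \<le> Re (cinner x (T x)))"

definition is_absolute_value ::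
    "('a::complex_hilbert_space \<Rightarrow> 'a) \<Rightarrow> ('a \<Rightarrow> 'a) \<Rightarrow> bool" where
  "is_absolute_value T S \<longleftrightarrow>
     positive_operator S \<and> (\<exists>T'. bounded_clinear T' \<and> is_adjoint T T' \<and> S \<circ> S = T' \<circ> T)"

definition is_onb :: "'a::complex_hilbert_space set \<Rightarrow> bool" where
  "is_onb B \<longleftrightarrow>
     (\<forall>e\<in>B. norm e = 1) \<and> (\<forall>e\<in>B. \<forall>f\<in>B. e \<noteq> f \<longrightarrow> cinner e f = 0) \<and>
     closure (cspan B) = UNIV"

definition trace_class :: "('a::complex_hilbert_space \<Rightarrow> 'a) \<Rightarrow> bool" where
  "trace_class T \<longleftrightarrow> bounded_clinear T \<and>
     (\<exists>S B. is_absolute_value T S \<and> is_onb B \<and> (\<lambda>e. Re (cinner e (S e))) summable_on B)"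


subsection \<open>Unbounded operators, given by their graphs\<close>

definition densely_defined_operator :: "('a::complex_hilbert_space \<times> 'a) set \<Rightarrow> bool" where
  "densely_defined_operator G \<longleftrightarrow>
     (0, 0) \<in> G \<and>
     (\<forall>x y x' y'. (x, y) \<in> G \<and> (x', y') \<in> G \<longrightarrow> (x + x', y + y') \<in> G) \<and>
     (\<forall>c x y. (x, y) \<in> G \<longrightarrow> (c *\<^sub>C x, c *\<^sub>C y) \<in> G) \<and>
     single_valued G \<and> closure (Domain G) = UNIV"

definition adjoint_graph :: "('a::complex_hilbert_space \<times> 'a) set \<Rightarrow> ('a \<times> 'a) set" where
  "adjoint_graph G = {(y, z). \<forall>(x, w)\<in>G. cinner w y = cinner x z}"

definition selfadjoint_operator :: "('a::complex_hilbert_space \<times> 'a) set \<Rightarrow> bool" where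
  "selfadjoint_operator G \<longleftrightarrow> densely_defined_operator G \<and> adjoint_graph G = G"

definition one_plus_square :: "('a::complex_hilbert_space \<times> 'a) set \<Rightarrow> ('a \<times> 'a) set" where
  "one_plus_square D = {(x, x + z) |x y z. (x, y) \<in> D \<and> (y, z) \<in> D}"

text \<open>\<open>(1 + D\<^sup>2)\<^sup>-\<^sup>1\<^sup>/\<^sup>2\<close> is the positive bounded operator whose square is the (everywhere
  defined) inverse of \<open>1 + D\<^sup>2\<close>.\<close>

definition inverse_sqrt_one_plus_square ::
    "('a::complex_hilbert_space \<times> 'a) set \<Rightarrow> 'a \<Rightarrow> 'a" where
  "inverse_sqrt_one_plus_square D =
     (THE R. positive_operator R \<and> (\<forall>v w. R (R v) = w \<longleftrightarrow> (w, v) \<in> one_plus_square D))"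

definition bounded_transform :: "('a::complex_hilbert_space \<times> 'a) set \<Rightarrow> 'a \<Rightarrow> 'a" where
  "bounded_transform D v = (THE y. (inverse_sqrt_one_plus_square D v, y) \<in> D)"


section \<open>The algebra $U_q(\mathfrak{su}_2)$ and its dual\<close>

text \<open>A linear functional on $U_q(\mathfrak{su}_2)$ is the same as a linear functional on the free
  algebra in the four generators which vanishes on the ideal of relations.  A functional on the
  free algebra is in turn given by its arbitrary values on the words.  So functionals on
  $U_q(\mathfrak{su}_2)$ are functions on words; \<open>respects_relations\<close> says that
  such a function descends to the quotient.\<close>

datatype uq_gen = Uk | Uki | Ue | Uf

type_synonym uq_word = "uq_gen list"
type_synonym uq_functional = "uq_word \<Rightarrow> complex"

definition respects_relations :: "real \<Rightarrow> uq_functional \<Rightarrow> bool" where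
  "respects_relations q a \<longleftrightarrow> (\<forall>u v.
     a (u @ [Uk, Uki] @ v) = a (u @ v) \<and>
     a (u @ [Uki, Uk] @ v) = a (u @ v) \<and>
     a (u @ [Uk, Ue, Uki] @ v) = of_real q * a (u @ [Ue] @ v) \<and>
     a (u @ [Uk, Uf, Uki] @ v) = of_real (inverse q) * a (u @ [Uf] @ v) \<and>
     a (u @ [Ue, Uf] @ v) - a (u @ [Uf, Ue] @ v) =
       (a (u @ [Uk, Uk] @ v) - a (u @ [Uki, Uki] @ v)) / of_real (q - inverse q))"

text \<open>\<open>coproduct x\<close> lists the summands \<open>(x', x'')\<close> of the coproduct of the word \<open>x\<close>
  (all coefficients are 1).\<close>

fun coproduct_gen :: "uq_gen \<Rightarrow> (uq_word \<times> uq_word) list" where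
  "coproduct_gen Uk = [([Uk], [Uk])]"
| "coproduct_gen Uki = [([Uki], [Uki])]"
| "coproduct_gen Ue = [([Ue], [Uk]), ([Uki], [Ue])]"
| "coproduct_gen Uf = [([Uf], [Uk]), ([Uki], [Uf])]"

fun coproduct :: "uq_word \<Rightarrow> (uq_word \<times> uq_word) list" where
  "coproduct [] = [([], [])]"
| "coproduct (g # x) = [(u @ u', v @ v'). (u, v) \<leftarrow> coproduct_gen g, (u', v') \<leftarrow> coproduct x]"

fun counit_gen :: "uq_gen \<Rightarrow> complex" where
  "counit_gen Uk = 1"
| "counit_gen Uki = 1"
| "counit_gen Ue = 0"
| "counit_gen Uf = 0"

definition counit :: uq_functional where
  "counit x = prod_list (map counit_gen x)"

text \<open>The antipode is the anti-homomorphism with \<open>S(k) = k\<^sup>-\<^sup>1\<close>, \<open>S(e) = -q e\<close>,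
  \<open>S(f) = -q\<^sup>-\<^sup>1 f\<close>, as forced by \<open>S(x') x'' = \<epsilon>(x)\<close>.  It maps the word \<open>x\<close> to
  \<open>antipode_coeff q x\<close> times \<open>antipode_word x\<close>.\<close>

fun antipode_coeff_gen :: "real \<Rightarrow> uq_gen \<Rightarrow> real" where
  "antipode_coeff_gen q Uk = 1"
| "antipode_coeff_gen q Uki = 1"
| "antipode_coeff_gen q Ue = - q"
| "antipode_coeff_gen q Uf = - inverse q"

definition antipode_coeff :: "real \<Rightarrow> uq_word \<Rightarrow> complex" where
  "antipode_coeff q x = of_real (prod_list (map (antipode_coeff_gen q) x))"

fun antipode_gen :: "uq_gen \<Rightarrow> uq_gen" where
  "antipode_gen Uk = Uki"
| "antipode_gen Uki = Uk"
| "antipode_gen Ue = Ue"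
| "antipode_gen Uf = Uf"

definition antipode_word :: "uq_word \<Rightarrow> uq_word" where
  "antipode_word x = rev (map antipode_gen x)"

fun star_gen :: "uq_gen \<Rightarrow> uq_gen" where
  "star_gen Uk = Uk"
| "star_gen Uki = Uki"
| "star_gen Ue = Uf"
| "star_gen Uf = Ue"

definition star_word :: "uq_word \<Rightarrow> uq_word" where
  "star_word x = rev (map star_gen x)"

text \<open>The operations dual to the Hopf *-structure: \<open>(a b)(x) = a(x') b(x'')\<close> and
  \<open>a\<^sup>*(x) = cnj (a (S(x)\<^sup>*))\<close>.\<close>

definition dual_add :: "uq_functional \<Rightarrow> uq_functional \<Rightarrow> uq_functional" where
  "dual_add a b = (\<lambda>x. a x + b x)"

definition dual_scale :: "complex \<Rightarrow> uq_functional \<Rightarrow> uq_functional" where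
  "dual_scale c a = (\<lambda>x. c * a x)"

definition dual_mult :: "uq_functional \<Rightarrow> uq_functional \<Rightarrow> uq_functional" where
  "dual_mult a b = (\<lambda>x. \<Sum>(u, v)\<leftarrow>coproduct x. a u * b v)"

definition dual_star :: "real \<Rightarrow> uq_functional \<Rightarrow> uq_functional" where
  "dual_star q a = (\<lambda>x. cnj (antipode_coeff q x * a (star_word (antipode_word x))))"


section \<open>The representations $V_l$ and the coordinate algebra $\mathbb{C}[SU_q(2)]$\<close>

definition half_nats :: "real set" where
  "half_nats = range (\<lambda>n::nat. real n / 2)"

definition weights :: "real \<Rightarrow> real set" where
  "weights l = {real k - l |k::nat. real k \<le> 2 * l}"

definition qint :: "real \<Rightarrow> real \<Rightarrow> real" where
  "qint q x = (q powr x - q powr (- x)) / (q - inverse q)"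

text \<open>\<open>rep_gen q l g n m\<close> and \<open>rep q l x n m\<close> are the matrix elements
  \<open>\<langle>l,n|\<pi>(g)|l,m\<rangle>\<close> and \<open>\<langle>l,n|\<pi>(x)|l,m\<rangle>\<close> for generators and words;
  they are meaningful for \<open>n, m \<in> weights l\<close>.\<close>

fun rep_gen :: "real \<Rightarrow> real \<Rightarrow> uq_gen \<Rightarrow> real \<Rightarrow> real \<Rightarrow> complex" where
  "rep_gen q l Uk n m = (if n = m then of_real (q powr m) else 0)"
| "rep_gen q l Uki n m = (if n = m then of_real (q powr (- m)) else 0)"
| "rep_gen q l Ue n m =
     (if n = m + 1 then of_real (sqrt (qint q (l - m) * qint q (l + m + 1))) else 0)"
| "rep_gen q l Uf n m =
     (if n = m - 1 then of_real (sqrt (qint q (l - m + 1) * qint q (l + m))) else 0)"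

fun rep :: "real \<Rightarrow> real \<Rightarrow> uq_word \<Rightarrow> real \<Rightarrow> real \<Rightarrow> complex" where
  "rep q l [] n m = (if n = m then 1 else 0)"
| "rep q l (g # x) n m = (\<Sum>p\<in>weights l. rep_gen q l g n p * rep q l x p m)"

definition matrix_element :: "real \<Rightarrow> real \<Rightarrow> real \<Rightarrow> real \<Rightarrow> uq_functional" where
  "matrix_element q l n m = (\<lambda>x. rep q l x n m)"

definition coordinate_algebra :: "real \<Rightarrow> uq_functional set" where
  "coordinate_algebra q =
     {(\<lambda>x. \<Sum>(l, n, m)\<in>I. c (l, n, m) * matrix_element q l n m x) |I c.
        finite I \<and> I \<subseteq> {(l, n, m). l \<in> half_nats \<and> n \<in> weights l \<and> m \<in> weights l}}"


subsection \<open>The matrix elements descend to $U_q(\mathfrak{su}_2)$\<close>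

lemma finite_weights [simp]: "finite (weights l)"
proof -
  have "weights l \<subseteq> (\<lambda>k. real k - l) ` {..nat \<lfloor>2 * l\<rfloor>}"
    by (auto simp: weights_def le_nat_floor)
  then show ?thesis
    by (rule finite_subset) simp
qed

lemma rep_append:
  assumes "n \<in> weights l"
  shows "rep q l (x @ y) n m = (\<Sum>p\<in>weights l. rep q l x n p * rep q l y p m)"
  using assms
proof (induction x arbitrary: n)
  case Nil
  then show ?case
    by (simp add: if_distrib[of "\<lambda>c. c * _"] cong: if_cong)
next
  case (Cons g x)
  have "rep q l ((g # x) @ y) n m =
      (\<Sum>r\<in>weights l. \<Sum>p\<in>weights l. rep_gen q l g n r * (rep q l x r p * rep q l y p m))"
    using Cons.IH by (simp add: sum_distrib_left)
  also have "\<dots> = (\<Sum>p\<in>weights l. \<Sum>r\<in>weights l. rep_gen q l g n r * (rep q l x r p * rep q l y p m))"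
    by (rule sum.swap)
  finally show ?case
    by (simp add: sum_distrib_right mult.assoc)
qed

lemma qint_nonneg: 
  assumes "q > 0" "x \<ge> 0"
  shows "qint q x \<ge> 0"
proof (cases "q \<ge> 1")
  case True
  then have "q powr (- x) \<le> q powr x" "inverse q \<le> q"
    using assms by (auto intro!: powr_mono simp: inverse_le_1_iff intro: order_trans[of _ 1])
  then show ?thesis by (simp add: qint_def)
next
  case False
  then have "q powr x \<le> q powr (- x)" "q \<le> inverse q"
    using assms by (auto intro!: powr_mono' simp: one_le_inverse intro: order_trans[of _ 1])
  then show ?thesis by (simp add: qint_def divide_nonpos_nonpos)
qed

lemma qint_commutator:
  assumes "q > 0" "q \<noteq> 1"
  shows "qint q (l - m + 1) * qint q (l + m) - qint q (l - m) * qint q (l + m + 1) = qint q (2 * m)"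
proof -
  define X Y where "X = q powr (l - m)" and "Y = q powr (l + m)"
  have pos: "X > 0" "Y > 0"
    using assms by (auto simp: X_def Y_def)
  have "q * q \<noteq> 1"
    using assms by (metis abs_of_pos abs_square_eq_1 power2_eq_square)
  then have d: "q - inverse q \<noteq> 0"
    using assms by (simp add: field_simps)
  have inv: "q powr (- (l - m)) = inverse X" "q powr (- (l + m)) = inverse Y"
    by (simp_all only: X_def Y_def powr_minus)
  have "q powr (l - m + 1) = X * q" "q powr (l + m + 1) = Y * q"
    using assms by (simp_all only: X_def Y_def powr_add powr_one)
  moreover from this
  have "q powr (- (l - m + 1)) = inverse X * inverse q" "q powr (- (l + m + 1)) = inverse Y * inverse q"
    by (simp_all only: powr_minus inverse_mult_distrib)
  moreover have "q powr (2 * m) = Y * inverse X"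
    by (simp only: X_def Y_def powr_minus[symmetric] powr_add[symmetric]) simp
  moreover from this have "q powr (- (2 * m)) = inverse Y * X"
    by (simp only: powr_minus inverse_mult_distrib inverse_inverse_eq)
  ultimately have "qint q (l - m + 1) = (X * q - inverse X * inverse q) / (q - inverse q)"
    "qint q (l + m + 1) = (Y * q - inverse Y * inverse q) / (q - inverse q)"
    "qint q (2 * m) = (Y * inverse X - inverse Y * X) / (q - inverse q)"
    by (simp_all only: qint_def)
  moreover have "qint q (l - m) = (X - inverse X) / (q - inverse q)"
    "qint q (l + m) = (Y - inverse Y) / (q - inverse q)"
    by (simp_all only: qint_def inv X_def[symmetric] Y_def[symmetric])
  moreover have "(X * q - inverse X * inverse q) * (Y - inverse Y) -
      (X - inverse X) * (Y * q - inverse Y * inverse q) =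
      (Y * inverse X - inverse Y * X) * (q - inverse q)"
    using pos assms by (simp add: field_simps)
  ultimately show ?thesis
    using d by (simp add: diff_divide_distrib[symmetric])
qed

lemma weights_bounds: "m \<in> weights l \<Longrightarrow> l - m \<ge> 0 \<and> l + m \<ge> 0"
  by (auto simp: weights_def)

lemma rep_sandwich:
  assumes "n \<in> weights l"
  shows "rep q l (u @ x @ v) n m =
    (\<Sum>p\<in>weights l. \<Sum>r\<in>weights l. rep q l u n p * rep q l x p r * rep q l v r m)"
  using assms by (simp add: rep_append sum_distrib_left mult.assoc)

lemma rep_EF:
  assumes q: "q > 0" and p: "p \<in> weights l" and r: "r \<in> weights l"
  shows "rep q l [Ue, Uf] p r = (if p = r then of_real (qint q (l - r + 1) * qint q (l + r)) else 0)"
proof -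
  have "rep q l [Ue, Uf] p r = (\<Sum>s\<in>weights l. rep_gen q l Ue p s * rep_gen q l Uf s r)"
    using r by (simp add: if_distrib[of "\<lambda>c. _ * c"] cong: if_cong)
  also have "\<dots> = (\<Sum>s\<in>weights l. if s = r - 1 then rep_gen q l Ue p s * rep_gen q l Uf s r else 0)"
    by (intro sum.cong) auto
  also have "\<dots> = (if r - 1 \<in> weights l then rep_gen q l Ue p (r - 1) * rep_gen q l Uf (r - 1) r else 0)"
    by simp
  also have "\<dots> = (if p = r then of_real (qint q (l - r + 1) * qint q (l + r)) else 0)"
  proof (cases "r - 1 \<in> weights l")
    case True
    have "l - r + 1 \<ge> 0" "l + r \<ge> 0"
      using weights_bounds[OF r] by auto
    then have "qint q (l - r + 1) * qint q (l + r) \<ge> 0"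
      using q by (simp add: qint_nonneg)
    then show ?thesis
      using True by (simp add: algebra_simps flip: of_real_mult)
  next
    case False
    from r obtain k :: nat where k: "r = real k - l" "real k \<le> 2 * l"
      by (auto simp: weights_def)
    have "k = 0"
    proof (rule ccontr)
      assume "k \<noteq> 0"
      then have "r - 1 = real (k - 1) - l" "real (k - 1) \<le> 2 * l"
        using k by auto
      then show False
        using False by (auto simp: weights_def)
    qed
    then show ?thesis
      using False k by (simp add: qint_def)
  qed
  finally show ?thesis .
qed

lemma rep_FE:
  assumes q: "q > 0" and l: "l \<in> half_nats" and p: "p \<in> weights l" and r: "r \<in> weights l"
  shows "rep q l [Uf, Ue] p r = (if p = r then of_real (qint q (l - r) * qint q (l + r + 1)) else 0)"
proof -
  have "rep q l [Uf, Ue] p r = (\<Sum>s\<in>weights l. rep_gen q l Uf p s * rep_gen q l Ue s r)"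
    using r by (simp add: if_distrib[of "\<lambda>c. _ * c"] cong: if_cong)
  also have "\<dots> = (\<Sum>s\<in>weights l. if s = r + 1 then rep_gen q l Uf p s * rep_gen q l Ue s r else 0)"
    by (intro sum.cong) auto
  also have "\<dots> = (if r + 1 \<in> weights l then rep_gen q l Uf p (r + 1) * rep_gen q l Ue (r + 1) r else 0)"
    by simp
  also have "\<dots> = (if p = r then of_real (qint q (l - r) * qint q (l + r + 1)) else 0)"
  proof (cases "r + 1 \<in> weights l")
    case True
    have "l - r \<ge> 0" "l + r + 1 \<ge> 0"
      using weights_bounds[OF r] by auto
    then have "qint q (l - r) * qint q (l + r + 1) \<ge> 0"
      using q by (simp add: qint_nonneg)
    then show ?thesis
      using True by (simp add: algebra_simps flip: of_real_mult)
  next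
    case False
    from r obtain k :: nat where k: "r = real k - l" "real k \<le> 2 * l"
      by (auto simp: weights_def)
    from l obtain n :: nat where n: "2 * l = real n"
      by (auto simp: half_nats_def)
    have "k = n"
    proof (rule ccontr)
      assume "k \<noteq> n"
      then have "r + 1 = real (k + 1) - l" "real (k + 1) \<le> 2 * l"
        using k n by auto
      then show False
        using False unfolding weights_def by blast
    qed
    then have "l - r = 0"
      using k n by simp
    then show ?thesis
      using False by (simp add: qint_def)
  qed
  finally show ?thesis .
qed

lemma respects_relations_matrix_element:
  assumes q: "q > 0" "q \<noteq> 1" and l: "l \<in> half_nats" and n: "n \<in> weights l"
  shows "respects_relations q (matrix_element q l n m)"
proof -
  have weights_mult: "(\<Sum>s\<in>weights l. (if p = s then c s else 0) * d s) = c p * d p"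
    if "p \<in> weights l" for p and c d :: "real \<Rightarrow> complex"
    using that by (simp add: if_distrib[of "\<lambda>c. c * _"] cong: if_cong)
  have KK: "rep q l (Uk # x) p r = of_real (q powr p) * rep q l x p r"
       "rep q l (Uki # x) p r = of_real (q powr (- p)) * rep q l x p r"
    if "p \<in> weights l" for p r x
    using that by (simp_all add: if_distrib[of "\<lambda>c. c * _"] cong: if_cong)
  have Kr: "rep q l [g, Uki] p r = rep_gen q l g p r * of_real (q powr (- r))"
       "rep q l [g] p r = rep_gen q l g p r" if "r \<in> weights l" for g p r
    using that by (simp_all add: if_distrib[of "\<lambda>c. _ * c"] cong: if_cong)
  have inv: "rep q l [Uk, Uki] p r = rep q l [] p r" "rep q l [Uki, Uk] p r = rep q l [] p r"
    if "p \<in> weights l" for p r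
    using that q by (simp_all add: KK powr_minus del: rep.simps(2))
  have Emat: "rep q l [Uk, Ue, Uki] p r = of_real q * rep q l [Ue] p r"
    if "p \<in> weights l" "r \<in> weights l" for p r
    unfolding KK[OF that(1)] Kr[OF that(2)] using q
    by (auto simp: powr_add powr_minus field_simps)
  have Fmat: "rep q l [Uk, Uf, Uki] p r = of_real (inverse q) * rep q l [Uf] p r"
    if "p \<in> weights l" "r \<in> weights l" for p r
  proof -
    have "complex_of_real (q powr (1 + p)) = of_real q * of_real (q powr p)"
      using q by (simp add: powr_add)
    then show ?thesis
      unfolding KK[OF that(1)] Kr[OF that(2)] using q by (auto simp: powr_minus field_simps)
  qed
  have EFmat: "rep q l [Ue, Uf] p r - rep q l [Uf, Ue] p r =
      (rep q l [Uk, Uk] p r - rep q l [Uki, Uki] p r) / of_real (q - inverse q)"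
    if "p \<in> weights l" "r \<in> weights l" for p r
  proof -
    have sq: "q powr p * q powr p = q powr (2 * p)"
      "q powr (- p) * q powr (- p) = q powr (- (2 * p))" for p
      by (simp_all only: powr_add[symmetric]) (simp_all add: algebra_simps)
    have "rep q l [Ue, Uf] p r - rep q l [Uf, Ue] p r = (if p = r then of_real (qint q (2 * r)) else 0)"
      unfolding rep_EF[OF q(1) that] rep_FE[OF q(1) l that] qint_commutator[OF q, of l r, symmetric]
      by simp
    moreover have "rep q l [Uk, Uk] p r = (if p = r then of_real (q powr (2 * r)) else 0)"
      "rep q l [Uki, Uki] p r = (if p = r then of_real (q powr (- (2 * r))) else 0)"
      unfolding KK[OF that(1)] sq[of r, symmetric] by simp_all
    ultimately show ?thesis
      by (simp add: qint_def)
  qed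
  note sandwich = rep_sandwich[OF n]
  have cong: "(\<Sum>p\<in>weights l. \<Sum>r\<in>weights l. rep q l u n p * f p r * rep q l v r m) =
      (\<Sum>p\<in>weights l. \<Sum>r\<in>weights l. rep q l u n p * g p r * rep q l v r m)"
    if "\<And>p r. p \<in> weights l \<Longrightarrow> r \<in> weights l \<Longrightarrow> f p r = g p r" for u v f g
    using that by (intro sum.cong refl) auto
  have scale: "(\<Sum>p\<in>weights l. \<Sum>r\<in>weights l. rep q l u n p * (c * f p r) * rep q l v r m) =
      c * (\<Sum>p\<in>weights l. \<Sum>r\<in>weights l. rep q l u n p * f p r * rep q l v r m)" for u v c f
    by (simp add: sum_distrib_left mult_ac)
  have diff: "(\<Sum>p\<in>weights l. \<Sum>r\<in>weights l. rep q l u n p * f p r * rep q l v r m) -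
      (\<Sum>p\<in>weights l. \<Sum>r\<in>weights l. rep q l u n p * g p r * rep q l v r m) =
      (\<Sum>p\<in>weights l. \<Sum>r\<in>weights l. rep q l u n p * (f p r - g p r) * rep q l v r m)" for u v f g
    by (simp add: sum_subtractf algebra_simps)
  have div: "(\<Sum>p\<in>weights l. \<Sum>r\<in>weights l. rep q l u n p * f p r * rep q l v r m) / c =
      (\<Sum>p\<in>weights l. \<Sum>r\<in>weights l. rep q l u n p * (f p r / c) * rep q l v r m)" for u v f c
    by (simp add: sum_divide_distrib)
  show ?thesis
    unfolding respects_relations_def matrix_element_def
  proof (intro allI conjI)
    fix u v
    have nil: "rep q l (u @ v) n m =
        (\<Sum>p\<in>weights l. \<Sum>r\<in>weights l. rep q l u n p * rep q l [] p r * rep q l v r m)"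
      using sandwich[of q u "[]" v m] by simp
    show "rep q l (u @ [Uk, Uki] @ v) n m = rep q l (u @ v) n m"
      unfolding nil sandwich by (rule cong) (rule inv)
    show "rep q l (u @ [Uki, Uk] @ v) n m = rep q l (u @ v) n m"
      unfolding nil sandwich by (rule cong) (rule inv)
    show "rep q l (u @ [Uk, Ue, Uki] @ v) n m = of_real q * rep q l (u @ [Ue] @ v) n m"
      unfolding sandwich scale[symmetric] by (rule cong) (rule Emat)
    show "rep q l (u @ [Uk, Uf, Uki] @ v) n m = of_real (inverse q) * rep q l (u @ [Uf] @ v) n m"
      unfolding sandwich scale[symmetric] by (rule cong) (rule Fmat)
    show "rep q l (u @ [Ue, Uf] @ v) n m - rep q l (u @ [Uf, Ue] @ v) n m =
        (rep q l (u @ [Uk, Uk] @ v) n m - rep q l (u @ [Uki, Uki] @ v) n m) / of_real (q - inverse q)"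
      unfolding sandwich diff div by (rule cong) (rule EFmat)
  qed
qed


section \<open>The Haar state and the Hilbert space $\mathbf{H}$\<close>

text \<open>For fixed \<open>u\<close>, the functionals \<open>v \<mapsto> a (u v)\<close> and \<open>v \<mapsto> a (v u)\<close> are the
  coproduct of \<open>a\<close> evaluated at \<open>u\<close> in one tensor factor.\<close>

definition is_haar_state :: "real \<Rightarrow> (uq_functional \<Rightarrow> complex) \<Rightarrow> bool" where
  "is_haar_state q h \<longleftrightarrow>
     (\<forall>a\<in>coordinate_algebra q. \<forall>b\<in>coordinate_algebra q. h (dual_add a b) = h a + h b) \<and>
     (\<forall>c. \<forall>a\<in>coordinate_algebra q. h (dual_scale c a) = c * h a) \<and>
     h counit = 1 \<and>
     (\<forall>a\<in>coordinate_algebra q.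
        Im (h (dual_mult (dual_star q a) a)) = 0 \<and> 0 \<le> Re (h (dual_mult (dual_star q a) a))) \<and>
     (\<forall>a\<in>coordinate_algebra q. \<forall>u.
        h (\<lambda>v. a (u @ v)) = counit u * h a \<and> h (\<lambda>v. a (v @ u)) = counit u * h a)"

text \<open>\<open>\<iota> a s\<close> stands for \<open>a \<otimes> |1/2,s\<rangle>\<close>, where \<open>s \<in> weights (1/2)\<close>; the space
  \<open>'h\<close> is the completion of the linear span of these vectors.\<close>

definition is_gns_completion ::
    "real \<Rightarrow> (uq_functional \<Rightarrow> complex) \<Rightarrow> (uq_functional \<Rightarrow> real \<Rightarrow> 'h::complex_hilbert_space) \<Rightarrow> bool"
  where
  "is_gns_completion q h \<iota> \<longleftrightarrow>
     (\<forall>a\<in>coordinate_algebra q. \<forall>b\<in>coordinate_algebra q. \<forall>s\<in>weights (1/2).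
        \<iota> (dual_add a b) s = \<iota> a s + \<iota> b s) \<and>
     (\<forall>c. \<forall>a\<in>coordinate_algebra q. \<forall>s\<in>weights (1/2). \<iota> (dual_scale c a) s = c *\<^sub>C \<iota> a s) \<and>
     (\<forall>a\<in>coordinate_algebra q. \<forall>b\<in>coordinate_algebra q. \<forall>s\<in>weights (1/2). \<forall>s'\<in>weights (1/2).
        cinner (\<iota> a s) (\<iota> b s') = (if s = s' then h (dual_mult (dual_star q a) b) else 0)) \<and>
     closure (cspan {\<iota> a s |a s. a \<in> coordinate_algebra q \<and> s \<in> weights (1/2)}) = UNIV"

definition gns_representation ::
    "real \<Rightarrow> (uq_functional \<Rightarrow> real \<Rightarrow> 'h::complex_hilbert_space) \<Rightarrow> uq_functional \<Rightarrow> 'h \<Rightarrow> 'h" where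
  "gns_representation q \<iota> a =
     (THE T. bounded_clinear T \<and>
        (\<forall>b\<in>coordinate_algebra q. \<forall>s\<in>weights (1/2). T (\<iota> b s) = \<iota> (dual_mult a b) s))"


section \<open>The $U_q(\mathfrak{su}_2)$-action and the operator $D$\<close>

text \<open>\<open>basis_vector q h \<iota> l m n s\<close> is \<open>|l,m\<rangle> \<otimes> |l,n\<rangle> \<otimes> |1/2,s\<rangle>\<close>, where
  \<open>|l,m\<rangle> \<otimes> |l,n\<rangle>\<close> is the normalisation of the matrix element with row \<open>n\<close> and column \<open>m\<close>.\<close>

definition basis_vector ::
    "real \<Rightarrow> (uq_functional \<Rightarrow> complex) \<Rightarrow> (uq_functional \<Rightarrow> real \<Rightarrow> 'h::complex_hilbert_space) \<Rightarrow>
      real \<Rightarrow> real \<Rightarrow> real \<Rightarrow> real \<Rightarrow> 'h" where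
  "basis_vector q h \<iota> l m n s =
     (let t = matrix_element q l n m
      in \<iota> (dual_scale (of_real (1 / sqrt (Re (h (dual_mult (dual_star q t) t))))) t) s)"

definition spin_component ::
    "real \<Rightarrow> (uq_functional \<Rightarrow> complex) \<Rightarrow> (uq_functional \<Rightarrow> real \<Rightarrow> 'h::complex_hilbert_space) \<Rightarrow>
      real \<Rightarrow> 'h set" where
  "spin_component q h \<iota> l =
     cspan {basis_vector q h \<iota> l m n s |m n s. m \<in> weights l \<and> n \<in> weights l \<and> s \<in> weights (1/2)}"

text \<open>The action of the word \<open>x\<close> on \<open>spin_component q h \<iota> l\<close>.  The basis vectors are
  orthonormal, so the coordinates of \<open>v\<close> are its inner products with them.\<close>

definition uq_action ::
    "real \<Rightarrow> (uq_functional \<Rightarrow> complex) \<Rightarrow> (uq_functional \<Rightarrow> real \<Rightarrow> 'h::complex_hilbert_space) \<Rightarrow>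
      real \<Rightarrow> uq_word \<Rightarrow> 'h \<Rightarrow> 'h" where
  "uq_action q h \<iota> l x v =
     (\<Sum>m\<in>weights l. \<Sum>n\<in>weights l. \<Sum>s\<in>weights (1/2).
        cinner (basis_vector q h \<iota> l m n s) v *\<^sub>C
        (\<Sum>(x', x'')\<leftarrow>coproduct x. \<Sum>m'\<in>weights l. \<Sum>s'\<in>weights (1/2).
           (rep q l x' m' m * rep q (1/2) x'' s' s) *\<^sub>C basis_vector q h \<iota> l m' n s'))"

text \<open>The isotypic component of spin \<open>k\<close> is spanned by the images of all intertwiners \<open>T\<close> from
  $V_k$, given by the images \<open>T M\<close> of the basis vectors \<open>|k,M\<rangle>\<close>.\<close>

definition isotypic_component ::
    "real \<Rightarrow> (uq_functional \<Rightarrow> complex) \<Rightarrow> (uq_functional \<Rightarrow> real \<Rightarrow> 'h::complex_hilbert_space) \<Rightarrow>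
      real \<Rightarrow> real \<Rightarrow> 'h set" where
  "isotypic_component q h \<iota> l k =
     cspan (\<Union>{T ` weights k |T.
       (\<forall>M\<in>weights k. T M \<in> spin_component q h \<iota> l) \<and>
       (\<forall>x. \<forall>M\<in>weights k.
          uq_action q h \<iota> l x (T M) = (\<Sum>M'\<in>weights k. rep q k x M' M *\<^sub>C T M'))})"

definition W_up ::
    "real \<Rightarrow> (uq_functional \<Rightarrow> complex) \<Rightarrow> (uq_functional \<Rightarrow> real \<Rightarrow> 'h::complex_hilbert_space) \<Rightarrow>
      real \<Rightarrow> 'h set" where
  "W_up q h \<iota> j = isotypic_component q h \<iota> j (j + 1/2)"

definition W_down ::
    "real \<Rightarrow> (uq_functional \<Rightarrow> complex) \<Rightarrow> (uq_functional \<Rightarrow> real \<Rightarrow> 'h::complex_hilbert_space) \<Rightarrow>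
      real \<Rightarrow> 'h set" where
  "W_down q h \<iota> j = isotypic_component q h \<iota> j (j - 1/2)"

definition is_dirac_operator ::
    "real \<Rightarrow> (uq_functional \<Rightarrow> complex) \<Rightarrow> (uq_functional \<Rightarrow> real \<Rightarrow> 'h::complex_hilbert_space) \<Rightarrow>
      ('h \<times> 'h) set \<Rightarrow> bool" where
  "is_dirac_operator q h \<iota> D \<longleftrightarrow>
     selfadjoint_operator D \<and>
     (\<forall>j\<in>half_nats. \<forall>w\<in>W_up q h \<iota> j. (w, qint q (2 * j) *\<^sub>R w) \<in> D) \<and>
     (\<forall>j\<in>half_nats - {0}. \<forall>w\<in>W_down q h \<iota> j. (w, (- qint q (2 * j + 2)) *\<^sub>R w) \<in> D)"


section \<open>Fredholm modules\<close>

text \<open>The *-algebras are sets of functionals with the operations dual to the Hopf *-structure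
  of $U_q(\mathfrak{su}_2)$.\<close>

definition is_star_algebra :: "real \<Rightarrow> uq_functional set \<Rightarrow> bool" where
  "is_star_algebra q A \<longleftrightarrow>
     counit \<in> A \<and>
     (\<forall>a\<in>A. \<forall>b\<in>A. dual_add a b \<in> A \<and> dual_mult a b \<in> A) \<and>
     (\<forall>c. \<forall>a\<in>A. dual_scale c a \<in> A) \<and>
     (\<forall>a\<in>A. dual_star q a \<in> A)"

definition is_star_representation ::
    "real \<Rightarrow> uq_functional set \<Rightarrow> (uq_functional \<Rightarrow> 'h::complex_hilbert_space \<Rightarrow> 'h) \<Rightarrow> bool" where
  "is_star_representation q A \<eta> \<longleftrightarrow>
     (\<forall>a\<in>A. bounded_clinear (\<eta> a) \<and> is_adjoint (\<eta> a) (\<eta> (dual_star q a))) \<and>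
     (\<forall>a\<in>A. \<forall>b\<in>A. \<forall>v. \<eta> (dual_add a b) v = \<eta> a v + \<eta> b v \<and> \<eta> (dual_mult a b) v = \<eta> a (\<eta> b v)) \<and>
     (\<forall>c. \<forall>a\<in>A. \<forall>v. \<eta> (dual_scale c a) v = c *\<^sub>C \<eta> a v) \<and>
     \<eta> counit = id"

definition one_summable_fredholm_module ::
    "real \<Rightarrow> uq_functional set \<Rightarrow> (uq_functional \<Rightarrow> 'h::complex_hilbert_space \<Rightarrow> 'h) \<Rightarrow>
      ('h \<Rightarrow> 'h) \<Rightarrow> bool" where
  "one_summable_fredholm_module q A \<eta> F \<longleftrightarrow>
     is_star_algebra q A \<and> is_star_representation q A \<eta> \<and>
     bounded_clinear F \<and> is_adjoint F F \<and>
     trace_class (\<lambda>v. F (F v) - v) \<and>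
     (\<forall>a\<in>A. trace_class (\<lambda>v. F (\<eta> a v) - \<eta> a (F v)))"

end

(*
  Clebsch-Gordan coefficients turn the orthonormal basis |l,m> (x) |l,n> (x) |1/2,s> into an
  orthonormal eigenbasis of D, labelled by l = N/2, the sign of the eigenvalue and two weights.  Left
  multiplication by a matrix element of V_{1/2} changes N by one and has at most four nonzero
  entries per basis vector.  Entries between eigenvectors of the same sign are bounded, and there the
  eigenvalues of F are exponentially close to the common limit 1 or -1.  Entries between different
  signs decay like 1/[2l+1] by an explicit computation with Clebsch-Gordan coefficients.  So
  [F, t] maps the eigenvectors with label N to vectors of norm O(r^N) with r < 1, the multiplicities
  grow only quadratically in N, and the norms are summable, which gives trace class.  The
  Leibniz rule extends this from the generators to the whole algebra.
*)
theory Submission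
  imports Defs
begin

section \<open>Inner product algebra and the Cauchy-Schwarz inequality\<close>

section \<open>Hilbert space preliminaries\<close>

text \<open>Trace class is tested through an absolute value, so one must be produced for each
  operator in question: after scaling, |T| is the binomial series of sqrt(1 - X) at X = 1 - T'T,
  with T' the adjoint, and this series converges absolutely up to norm one. Self-adjointness of D
  pins down its bounded transform: the graph consists of all pairs whose coefficients in the
  eigenbasis match, although D is prescribed only on the W_j.

  The Leibniz rule multiplies commutators by algebra elements on both sides. Column decay O(r^N)
  survives right multiplication because a generator moves N by one and so costs only a constant
  factor.

  Among the mixed entries that raise N, those from the lower to the upper sign vanish exactly, and
  those from upper to lower are at most 1/[2l+1]. Entries lowering N reduce to them, since the star
  of a generator is a multiple of a generator. The norms given by the Haar state are never computed:
  the isometry relation for the columns of (t_nm) makes each t_nm act as a contraction, and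
  contractivity on a highest weight vector bounds the normalisation factor that occurs.\<close>

lemma mult_cnj_cmod: "z * cnj z = (complex_of_real (cmod z))\<^sup>2" "cnj z * z = (complex_of_real (cmod z))\<^sup>2"
  using complex_norm_square[of z] by (simp_all add: mult.commute)

lemma cinner_add_left: "cinner (x + y) z = cinner x z + cinner y (z::'a::complex_hilbert_space)"
  by (metis cinner_add_right cinner_commute complex_cnj_add)

lemma cinner_scaleC_left: "cinner (c *\<^sub>C x) y = cnj c * cinner x (y::'a::complex_hilbert_space)"
  by (metis cinner_commute cinner_scaleC_right complex_cnj_mult)

lemma cinner_scaleR_left: "cinner (r *\<^sub>R x) y = of_real r * cinner x (y::'a::complex_hilbert_space)"
  by (simp add: scaleR_scaleC cinner_scaleC_left)

lemma cinner_scaleR_right: "cinner x (r *\<^sub>R y) = of_real r * cinner x (y::'a::complex_hilbert_space)"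
  by (simp add: scaleR_scaleC cinner_scaleC_right)

lemma cinner_minus_right [simp]: "cinner x (- y) = - cinner x (y::'a::complex_hilbert_space)"
  using cinner_scaleR_right[of x "-1" y] by simp

lemma cinner_minus_left [simp]: "cinner (- x) y = - cinner x (y::'a::complex_hilbert_space)"
  using cinner_scaleR_left[of "-1" x y] by simp

lemma cinner_diff_right: "cinner x (y - z) = cinner x y - cinner x (z::'a::complex_hilbert_space)"
  using cinner_add_right[of x y "- z"] by simp

lemma cinner_diff_left: "cinner (x - y) z = cinner x z - cinner y (z::'a::complex_hilbert_space)"
  using cinner_add_left[of x "- y" z] by simp

lemma cinner_zero_right [simp]: "cinner x (0::'a::complex_hilbert_space) = 0"
  using cinner_diff_right[of x 0 0] by simp

lemma cinner_zero_left [simp]: "cinner (0::'a::complex_hilbert_space) x = 0"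
  using cinner_diff_left[of 0 0 x] by simp

lemma cinner_sum_right: "cinner x (sum f A) = (\<Sum>i\<in>A. cinner x (f i :: 'a::complex_hilbert_space))"
  by (induction A rule: infinite_finite_induct) (auto simp: cinner_add_right)

lemma cinner_sum_left: "cinner (sum f A) x = (\<Sum>i\<in>A. cinner (f i :: 'a::complex_hilbert_space) x)"
  by (induction A rule: infinite_finite_induct) (auto simp: cinner_add_left)

lemma power2_norm_eq_cinner: "(norm x)\<^sup>2 = Re (cinner x (x::'a::complex_hilbert_space))"
  by (simp add: cinner_norm)

lemma cinner_eq_zero_iff [simp]: "cinner x x = 0 \<longleftrightarrow> x = (0::'a::complex_hilbert_space)"
  by (simp add: cinner_norm)

lemma scaleC_diff_left: "(c - d) *\<^sub>C x = c *\<^sub>C x - d *\<^sub>C (x::'a::complex_hilbert_space)"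
  by (rule complex_vector.scale_left_diff_distrib)

lemma scaleC_diff_right: "c *\<^sub>C (x - y) = c *\<^sub>C x - c *\<^sub>C (y::'a::complex_hilbert_space)"
  by (rule complex_vector.scale_right_diff_distrib)

lemma scaleC_sum_right: "c *\<^sub>C sum f A = (\<Sum>i\<in>A. c *\<^sub>C (f i::'a::complex_hilbert_space))"
  by (rule complex_vector.scale_sum_right)

lemma norm_scaleC [simp]: "norm (c *\<^sub>C x) = cmod c * norm (x::'a::complex_hilbert_space)"
proof -
  have "complex_of_real ((norm (c *\<^sub>C x))\<^sup>2) = (c * cnj c) * complex_of_real ((norm x)\<^sup>2)"
    by (simp only: cinner_norm[symmetric] cinner_scaleC_left cinner_scaleC_right) (simp add: mult_ac)
  also have "\<dots> = of_real ((cmod c * norm x)\<^sup>2)"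
    by (simp only: complex_norm_square[symmetric] power_mult_distrib of_real_mult of_real_power)
  finally have "(norm (c *\<^sub>C x))\<^sup>2 = (cmod c * norm x)\<^sup>2"
    using of_real_eq_iff by blast
  then show ?thesis
    by (simp add: power2_eq_iff_nonneg)
qed

text \<open>Subtracting from y its projection on x leaves a vector of squared norm |y|^2 - |<x,y>|^2
  / |x|^2, which cannot be negative.\<close>

lemma norm_cinner_le: "cmod (cinner x y) \<le> norm x * norm (y::'a::complex_hilbert_space)"
proof (cases "x = 0")
  case False
  define d where "d = cinner x y"
  define c where "c = d / of_real ((norm x)\<^sup>2)"
  have nx: "norm x > 0" using False by simp
  have yx: "cinner y x = cnj d"
    unfolding d_def by (rule cinner_commute)
  have "cinner x (y - c *\<^sub>C x) = d - c * of_real ((norm x)\<^sup>2)"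
    by (simp only: cinner_diff_right cinner_scaleC_right cinner_norm d_def)
  also have "\<dots> = 0"
    using nx by (simp add: c_def)
  finally have "cinner (c *\<^sub>C x) (y - c *\<^sub>C x) = 0"
    by (simp only: cinner_scaleC_left mult_zero_right)
  then have "cinner y (y - c *\<^sub>C x) = of_real ((norm (y - c *\<^sub>C x))\<^sup>2)"
    by (simp only: cinner_norm[symmetric] cinner_diff_left[of y] diff_zero)
  then have "0 \<le> Re (cinner y (y - c *\<^sub>C x))"
    by (simp only: Re_complex_of_real zero_le_power2)
  also have "cinner y (y - c *\<^sub>C x) = of_real ((norm y)\<^sup>2) - d * cnj d / of_real ((norm x)\<^sup>2)"
    by (simp only: cinner_diff_right cinner_scaleC_right cinner_norm yx c_def times_divide_eq_left)
  also have "\<dots> = of_real ((norm y)\<^sup>2 - (cmod d)\<^sup>2 / (norm x)\<^sup>2)"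
    by (simp add: mult_cnj_cmod)
  finally have "(cmod (cinner x y))\<^sup>2 / (norm x)\<^sup>2 \<le> (norm y)\<^sup>2"
    by (simp add: d_def)
  then have "(cmod (cinner x y))\<^sup>2 \<le> (norm x * norm y)\<^sup>2"
    using nx by (simp add: pos_divide_le_eq power_mult_distrib mult.commute)
  then show ?thesis
    by (rule power2_le_imp_le) simp
qed simp

lemma bounded_linear_cinner_right: "bounded_linear (\<lambda>y. cinner x (y::'a::complex_hilbert_space))"
proof (rule bounded_linear_intro)
  show "norm (cinner x y) \<le> norm y * norm x" for y
    using norm_cinner_le[of x y] by (simp add: mult.commute)
qed (simp_all add: cinner_add_right cinner_scaleR_right scaleR_conv_of_real)

lemma bounded_linear_cinner_left: "bounded_linear (\<lambda>x. cinner x (y::'a::complex_hilbert_space))"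
proof (rule bounded_linear_intro)
  show "norm (cinner x y) \<le> norm x * norm y" for x
    by (rule norm_cinner_le)
qed (simp_all add: cinner_add_left cinner_scaleR_left scaleR_conv_of_real)

lemma cinner_extensionality:
  assumes "\<And>z. cinner z x = cinner z y"
  shows "x = (y::'a::complex_hilbert_space)"
proof -
  have "cinner (x - y) (x - y) = 0"
    using assms[of "x - y"] by (simp only: cinner_diff_right diff_self)
  then show ?thesis
    by (simp only: cinner_eq_zero_iff right_minus_eq)
qed

subsection \<open>Bounded operators\<close>

lemma bounded_clinearI:
  assumes "\<And>x y. T (x + y) = T x + T y" "\<And>c x. T (c *\<^sub>C x) = c *\<^sub>C T x"
    "\<And>x. norm (T x) \<le> C * norm x"
  shows "bounded_clinear T"
proof -
  have "norm (T x) \<le> norm x * C" for x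
    using assms(3)[of x] by (simp add: mult.commute)
  then have "bounded_linear T"
    by (rule bounded_linear_intro[rotated 2]) (simp_all only: assms(1,2) scaleR_scaleC)
  then show ?thesis
    by (simp add: bounded_clinear_def assms(2))
qed

lemma bounded_clinear_bounded_linear: "bounded_clinear T \<Longrightarrow> bounded_linear T"
  by (simp add: bounded_clinear_def)

lemma bounded_clinear_scaleC: "bounded_clinear T \<Longrightarrow> T (c *\<^sub>C x) = c *\<^sub>C T x"
  by (simp add: bounded_clinear_def)

lemma bounded_clinear_add: "bounded_clinear T \<Longrightarrow> T (x + y) = T x + T y"
  by (simp add: bounded_clinear_def linear_simps)

lemma bounded_clinear_diff: "bounded_clinear T \<Longrightarrow> T (x - y) = T x - T y"
  by (simp add: bounded_clinear_def linear_simps)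

lemma bounded_clinear_0: "bounded_clinear T \<Longrightarrow> T 0 = 0"
  by (simp add: bounded_clinear_def linear_simps)

lemma bounded_clinear_sum: "bounded_clinear T \<Longrightarrow> T (sum f A) = (\<Sum>i\<in>A. T (f i))"
  by (simp add: bounded_clinear_def linear_sum bounded_linear.linear)

lemma bounded_clinear_norm_bound:
  assumes "bounded_clinear T"
  obtains K where "K \<ge> 0" "\<And>x. norm (T x) \<le> K * norm x"
  using bounded_linear.nonneg_bounded[of T] assms by (auto simp: bounded_clinear_def mult.commute)

lemma bounded_clinear_id: "bounded_clinear (\<lambda>x. x)"
  by (rule bounded_clinearI[where C=1]) auto

lemma bounded_clinear_compose:
  "bounded_clinear S \<Longrightarrow> bounded_clinear T \<Longrightarrow> bounded_clinear (\<lambda>x. S (T x))"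
  by (auto simp: bounded_clinear_def intro: bounded_linear_compose)

lemma bounded_clinear_diff_op:
  "bounded_clinear S \<Longrightarrow> bounded_clinear T \<Longrightarrow> bounded_clinear (\<lambda>x. S x - T x)"
  by (auto simp: bounded_clinear_def scaleC_diff_right intro: bounded_linear_sub)

lemma bounded_clinear_add_op:
  "bounded_clinear S \<Longrightarrow> bounded_clinear T \<Longrightarrow> bounded_clinear (\<lambda>x. S x + T x)"
  by (auto simp: bounded_clinear_def scaleC_add_right intro: bounded_linear_add)

lemma bounded_clinear_scaleC_op:
  assumes "bounded_clinear T" shows "bounded_clinear (\<lambda>x. c *\<^sub>C T x)"
proof -
  obtain K where K: "\<And>x. norm (T x) \<le> K * norm x"
    using bounded_clinear_norm_bound[OF assms] by metis
  have "norm (c *\<^sub>C T x) \<le> cmod c * K * norm x" for x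
    using mult_left_mono[OF K, of "cmod c"] by (simp add: mult.assoc)
  then show ?thesis
    by (rule bounded_clinearI[rotated 2])
       (simp_all add: bounded_clinear_add[OF assms] bounded_clinear_scaleC[OF assms] scaleC_add_right
        scaleC_scaleC mult.commute)
qed

lemma subspace_eq_on:
  "bounded_clinear S \<Longrightarrow> bounded_clinear T \<Longrightarrow> complex_vector.subspace {x. S x = T x}"
  unfolding complex_vector.subspace_def
  by (simp add: bounded_clinear_0 bounded_clinear_add bounded_clinear_scaleC)

lemma bounded_clinear_eq_on_dense:
  assumes "bounded_clinear S" "bounded_clinear T" "\<And>x. x \<in> X \<Longrightarrow> S x = T x"
    and "closure (cspan X) = UNIV"
  shows "S = T"
proof -
  have "cspan X \<subseteq> {x. S x = T x}"
    using assms(3) by (intro complex_vector.span_minimal subspace_eq_on assms) auto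
  moreover have "closed {x. S x = T x}"
    using assms(1,2) by (intro closed_Collect_eq linear_continuous_on bounded_clinear_bounded_linear)
  ultimately have "closure (cspan X) \<subseteq> {x. S x = T x}"
    by (rule closure_minimal)
  then show ?thesis using assms(4) by auto
qed

section \<open>Orthonormal expansions and operators prescribed on a basis\<close>

subsection \<open>Orthonormal bases\<close>

locale onb_family =
  fixes e :: "'i \<Rightarrow> 'a::complex_hilbert_space" and I :: "'i set"
  assumes ortho: "i \<in> I \<Longrightarrow> j \<in> I \<Longrightarrow> cinner (e i) (e j) = (if i = j then 1 else 0)"
    and dense: "closure (cspan (e ` I)) = UNIV"
begin

lemma norm_e: "i \<in> I \<Longrightarrow> norm (e i) = 1"
  using ortho[of i i] power2_norm_eq_cinner[of "e i"] norm_ge_zero[of "e i"]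
  by (auto simp: power2_eq_1_iff simp del: norm_ge_zero)

lemma inj_e: "inj_on e I"
  by (rule inj_onI) (metis ortho zero_neq_one)

lemma is_onb: "is_onb (e ` I)"
  using dense by (auto simp: is_onb_def norm_e ortho)

lemma cinner_e_sum:
  assumes "finite F" "F \<subseteq> I" "i \<in> I"
  shows "cinner (e i) (\<Sum>k\<in>F. c k *\<^sub>C e k) = (if i \<in> F then c i else 0)"
proof -
  have "cinner (e i) (\<Sum>k\<in>F. c k *\<^sub>C e k) = (\<Sum>k\<in>F. if i = k then c k else 0)"
    unfolding cinner_sum_right cinner_scaleC_right using assms by (intro sum.cong) (auto simp: ortho)
  then show ?thesis using assms by simp
qed

lemma norm_sum_e:
  assumes "finite F" "F \<subseteq> I"
  shows "(norm (\<Sum>k\<in>F. c k *\<^sub>C e k))\<^sup>2 = (\<Sum>k\<in>F. (cmod (c k))\<^sup>2)"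
proof -
  have "cinner (\<Sum>k\<in>F. c k *\<^sub>C e k) (\<Sum>k\<in>F. c k *\<^sub>C e k) =
      (\<Sum>i\<in>F. cnj (c i) * cinner (e i) (\<Sum>k\<in>F. c k *\<^sub>C e k))"
    by (simp only: cinner_sum_left cinner_scaleC_left)
  also have "\<dots> = (\<Sum>i\<in>F. cnj (c i) * c i)"
    using assms by (intro sum.cong refl) (subst cinner_e_sum, auto)
  also have "\<dots> = of_real (\<Sum>i\<in>F. (cmod (c i))\<^sup>2)"
    by (simp add: mult_cnj_cmod)
  finally show ?thesis
    by (simp add: power2_norm_eq_cinner)
qed

text \<open>The projection p satisfies <p,v> = <p,p>, so v - p is orthogonal to p and Pythagoras
  applies.\<close>

lemma norm_diff_projection:
  assumes "finite F" "F \<subseteq> I"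
  shows "norm (v - (\<Sum>k\<in>F. cinner (e k) v *\<^sub>C e k)) \<le> norm v"
proof -
  define p where "p = (\<Sum>k\<in>F. cinner (e k) v *\<^sub>C e k)"
  have "cinner p v = (\<Sum>k\<in>F. cnj (cinner (e k) v) * cinner (e k) v)"
    by (simp add: p_def cinner_sum_left cinner_scaleC_left)
  also have "\<dots> = cinner p p"
    unfolding p_def cinner_sum_left cinner_scaleC_left using assms
    by (intro sum.cong refl) (subst cinner_e_sum, auto)
  finally have "cinner p (v - p) = 0"
    by (simp add: cinner_diff_right)
  moreover from this have "cinner (v - p) p = 0"
    by (metis cinner_commute complex_cnj_zero)
  ultimately have "cinner v v = cinner (v - p) (v - p) + cinner p p"
    by (simp add: cinner_diff_right cinner_diff_left)
  then have "(norm v)\<^sup>2 = (norm (v - p))\<^sup>2 + (norm p)\<^sup>2"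
    by (simp add: power2_norm_eq_cinner)
  then have "(norm (v - p))\<^sup>2 \<le> (norm v)\<^sup>2" by simp
  then show ?thesis
    unfolding p_def by (rule power2_le_imp_le) simp
qed

lemma expansion_finite:
  assumes "finite F" "F \<subseteq> I" "v \<in> cspan (e ` F)"
  shows "(\<Sum>k\<in>F. cinner (e k) v *\<^sub>C e k) = v"
  using assms(3)
proof (induction rule: complex_vector.span_induct_alt)
  case base
  then show ?case by (simp add: complex_vector.scale_zero_left)
next
  case (step c x y)
  then obtain i where i: "i \<in> F" "x = e i" by auto
  have "(\<Sum>k\<in>F. cinner (e k) x *\<^sub>C e k) = (\<Sum>k\<in>F. if k = i then e k else 0)"
    unfolding i(2)
    by (intro sum.cong refl, subst ortho) (use i assms in \<open>auto simp: scaleC_one complex_vector.scale_zero_left\<close>)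
  also have "\<dots> = x" using i assms by simp
  finally have x: "(\<Sum>k\<in>F. cinner (e k) x *\<^sub>C e k) = x" .
  have "(\<Sum>k\<in>F. cinner (e k) (c *\<^sub>C x + y) *\<^sub>C e k) =
      c *\<^sub>C (\<Sum>k\<in>F. cinner (e k) x *\<^sub>C e k) + (\<Sum>k\<in>F. cinner (e k) y *\<^sub>C e k)"
    by (simp only: cinner_add_right cinner_scaleC_right scaleC_add_left scaleC_scaleC sum.distrib
        scaleC_sum_right)
  then show ?case unfolding x step.IH .
qed

lemma expansion: "((\<lambda>k. cinner (e k) v *\<^sub>C e k) has_sum v) I"
  unfolding has_sum_def tendsto_iff eventually_finite_subsets_at_top
proof (intro allI impI)
  fix \<epsilon> :: real assume "\<epsilon> > 0"
  have "v \<in> closure (cspan (e ` I))" using dense by simp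
  then obtain w where w: "w \<in> cspan (e ` I)" "dist w v < \<epsilon>"
    using \<open>\<epsilon> > 0\<close> closure_approachable by blast
  obtain X r where X: "finite X" "X \<subseteq> e ` I" "w = (\<Sum>a\<in>X. r a *\<^sub>C a)"
    using w(1) unfolding complex_vector.span_explicit mem_Collect_eq by blast
  then obtain F0 where F0: "F0 \<subseteq> I" "finite F0" "X = e ` F0"
    using finite_subset_image[OF X(1,2)] by blast
  have "dist (sum (\<lambda>k. cinner (e k) v *\<^sub>C e k) F) v < \<epsilon>" if F: "finite F" "F0 \<subseteq> F" "F \<subseteq> I" for F
  proof -
    have "w \<in> cspan (e ` F)"
      unfolding X(3) using F F0
      by (intro complex_vector.span_sum complex_vector.span_scale complex_vector.span_base) auto
    then have "(\<Sum>k\<in>F. cinner (e k) w *\<^sub>C e k) = w"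
      by (rule expansion_finite[OF F(1,3)])
    then have "v - (\<Sum>k\<in>F. cinner (e k) v *\<^sub>C e k) = (v - w) - (\<Sum>k\<in>F. cinner (e k) (v - w) *\<^sub>C e k)"
      by (simp add: cinner_diff_right scaleC_diff_left sum_subtractf)
    then have "norm (v - (\<Sum>k\<in>F. cinner (e k) v *\<^sub>C e k)) \<le> norm (v - w)"
      using norm_diff_projection[OF F(1,3), of "v - w"] by metis
    then show ?thesis
      using w(2) by (simp add: dist_norm norm_minus_commute)
  qed
  then show "\<exists>F0. finite F0 \<and> F0 \<subseteq> I \<and> (\<forall>F. finite F \<and> F0 \<subseteq> F \<and> F \<subseteq> I \<longrightarrow>
      dist (sum (\<lambda>k. cinner (e k) v *\<^sub>C e k) F) v < \<epsilon>)"
    using F0 by blast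
qed

lemma parseval: "((\<lambda>k. cinner x (e k) * cinner (e k) y) has_sum cinner x y) I"
  using has_sum_bounded_linear[OF bounded_linear_cinner_right expansion, of x y]
  by (simp add: cinner_scaleC_right mult.commute)

lemma eq_zero_if_orthogonal:
  assumes "\<And>k. k \<in> I \<Longrightarrow> cinner (e k) v = 0"
  shows "v = 0"
proof -
  have "((\<lambda>k. cinner (e k) v *\<^sub>C e k) has_sum 0) I"
    using assms by (intro has_sum_0) (simp add: complex_vector.scale_zero_left)
  then show ?thesis
    using expansion[of v] has_sum_unique by blast
qed

lemma eq_if_same_coefficients:
  "(\<And>k. k \<in> I \<Longrightarrow> cinner (e k) v = cinner (e k) w) \<Longrightarrow> v = w"
  using eq_zero_if_orthogonal[of "v - w"] by (simp add: cinner_diff_right)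

text \<open>A norm bound on finite combinations suffices to extend prescribed values on a basis to a
  bounded operator: it turns the Cauchy property of the expansion of v into that of the transformed
  partial sums. Diagonal operators and left multiplications both arise in this way.\<close>

lemma operator_extension:
  assumes "C \<ge> 0" and bound: "\<And>F c. finite F \<Longrightarrow> F \<subseteq> I \<Longrightarrow>
    norm (\<Sum>k\<in>F. c k *\<^sub>C (w k :: 'b::complex_hilbert_space)) \<le> C * norm (\<Sum>k\<in>F. c k *\<^sub>C e k)"
  obtains T where "bounded_clinear T" "\<And>k. k \<in> I \<Longrightarrow> T (e k) = w k" "\<And>v. norm (T v) \<le> C * norm v"
proof -
  define P where "P v F = (\<Sum>k\<in>F. cinner (e k) v *\<^sub>C e k)" for v F
  define Q where "Q v F = (\<Sum>k\<in>F. cinner (e k) v *\<^sub>C w k)" for v F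
  define T where "T v = infsum (\<lambda>k. cinner (e k) v *\<^sub>C w k) I" for v
  have lim_P: "(P v \<longlongrightarrow> v) (finite_subsets_at_top I)" for v
    using expansion[of v] unfolding has_sum_def P_def .
  have *: "\<exists>L. ((\<lambda>k. cinner (e k) v *\<^sub>C w k) has_sum L) I" for v
  proof -
    have "cauchy_filter (filtermap (Q v) (finite_subsets_at_top I))"
      unfolding cauchy_filter_metric_filtermap
    proof (intro allI impI)
      fix \<epsilon> :: real assume "\<epsilon> > 0"
      define \<delta> where "\<delta> = \<epsilon> / (2 * (C + 1))"
      have \<delta>: "\<delta> > 0" using \<open>\<epsilon> > 0\<close> \<open>C \<ge> 0\<close> by (simp add: \<delta>_def)
      define R where "R F \<longleftrightarrow> finite F \<and> F \<subseteq> I \<and> dist (P v F) v < \<delta>" for F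
      have "eventually R (finite_subsets_at_top I)"
        unfolding R_def
        using eventually_conj[OF eventually_finite_subsets_at_top_weakI[of I "\<lambda>F. finite F \<and> F \<subseteq> I"]
            tendstoD[OF lim_P \<delta>, of v]]
        by (simp add: conj_assoc)
      moreover have "dist (Q v F) (Q v G) < \<epsilon>" if "R F" "R G" for F G
      proof -
        define H where "H = F \<union> G"
        \<comment> \<open>\<open>F\<close> and \<open>G\<close> need not be nested, so the
          difference of the two partial sums is written as one combination over their union before
          \<open>bound\<close> is used.\<close>
        define c where "c k = (if k \<in> F then cinner (e k) v else 0) - (if k \<in> G then cinner (e k) v else 0)" for k
        have fin: "finite F" "finite G" "finite H" "H \<subseteq> I" using that by (auto simp: R_def H_def)
        have split: "(\<Sum>k\<in>H. c k *\<^sub>C u k) = (\<Sum>k\<in>F. cinner (e k) v *\<^sub>C u k) - (\<Sum>k\<in>G. cinner (e k) v *\<^sub>C u k)"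
          for u :: "'i \<Rightarrow> 'c::complex_hilbert_space"
        proof -
          have "(\<Sum>k\<in>H. (if k \<in> X then cinner (e k) v else 0) *\<^sub>C u k) = (\<Sum>k\<in>X. cinner (e k) v *\<^sub>C u k)"
            if "X \<subseteq> H" for X
            using that fin by (intro sum.mono_neutral_cong_right) (auto simp: complex_vector.scale_zero_left)
          from this[of F] this[of G] show ?thesis
            by (simp add: c_def scaleC_diff_left sum_subtractf H_def)
        qed
        have "dist (Q v F) (Q v G) = norm (\<Sum>k\<in>H. c k *\<^sub>C w k)"
          unfolding Q_def split by (simp add: dist_norm)
        also have "\<dots> \<le> C * norm (\<Sum>k\<in>H. c k *\<^sub>C e k)"
          using fin by (intro bound)
        also have "\<dots> = C * dist (P v F) (P v G)"
          unfolding P_def split by (simp add: dist_norm)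
        also have "\<dots> \<le> C * (2 * \<delta>)"
          using that \<open>C \<ge> 0\<close> dist_triangle2[of "P v F" "P v G" v]
          by (intro mult_left_mono) (auto simp: R_def)
        also have "\<dots> < \<epsilon>"
          using \<open>\<epsilon> > 0\<close> \<open>C \<ge> 0\<close> by (simp add: \<delta>_def field_simps)
        finally show ?thesis .
      qed
      ultimately show "\<exists>R. eventually R (finite_subsets_at_top I) \<and> (\<forall>F G. R F \<and> R G \<longrightarrow> dist (Q v F) (Q v G) < \<epsilon>)"
        by blast
    qed
    moreover have "complete (UNIV::'b set)"
      by (rule complete_UNIV)
    ultimately obtain L where "(Q v \<longlongrightarrow> L) (finite_subsets_at_top I)"
      using complete_uniform[where S=UNIV] by (force simp add: filterlim_def)
    then show ?thesis
      unfolding has_sum_def Q_def by blast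
  qed
  then have sum_T: "((\<lambda>k. cinner (e k) v *\<^sub>C w k) has_sum T v) I" for v
    unfolding T_def by (metis infsumI)
  have lim_Q: "(Q v \<longlongrightarrow> T v) (finite_subsets_at_top I)" for v
    using sum_T[of v] unfolding has_sum_def Q_def .
  have norm_T: "norm (T v) \<le> C * norm v" for v
  proof (rule tendsto_le[OF _ tendsto_mult_left[OF tendsto_norm[OF lim_P]] tendsto_norm[OF lim_Q]])
    show "\<forall>\<^sub>F F in finite_subsets_at_top I. norm (Q v F) \<le> C * norm (P v F)"
      unfolding P_def Q_def by (rule eventually_finite_subsets_at_top_weakI) (rule bound)
  qed simp
  show ?thesis
  proof
    show "bounded_clinear T"
    proof (rule bounded_clinearI[OF _ _ norm_T])
      show "T (x + y) = T x + T y" for x y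
        using has_sum_add[OF sum_T[of x] sum_T[of y]] sum_T[of "x + y"]
        by (simp add: cinner_add_right scaleC_add_left has_sum_unique)
      have "bounded_clinear (\<lambda>x::'b. c *\<^sub>C x)" for c
        by (intro bounded_clinear_scaleC_op bounded_clinear_id)
      from has_sum_bounded_linear[OF bounded_clinear_bounded_linear[OF this] sum_T]
      show "T (c *\<^sub>C x) = c *\<^sub>C T x" for c x
        using sum_T[of "c *\<^sub>C x"]
        by (simp add: cinner_scaleC_right scaleC_scaleC has_sum_unique)
    qed
    show "T (e k) = w k" if "k \<in> I" for k
    proof -
      have "((\<lambda>j. cinner (e j) (e k) *\<^sub>C w j) has_sum w k) I"
        using that by (intro has_sum_finite_neutralI[of "{k}"]) (auto simp: ortho scaleC_one complex_vector.scale_zero_left)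
      then show ?thesis using sum_T has_sum_unique by blast
    qed
  qed (rule norm_T)
qed

lemma diagonal_operator:
  fixes f :: "'i \<Rightarrow> real"
  assumes "\<And>k. k \<in> I \<Longrightarrow> \<bar>f k\<bar> \<le> C"
  obtains T where "bounded_clinear T" "\<And>k. k \<in> I \<Longrightarrow> T (e k) = f k *\<^sub>R e k"
proof (rule operator_extension[of "\<bar>C\<bar>" "\<lambda>k. f k *\<^sub>R e k"])
  fix F and c :: "'i \<Rightarrow> complex" assume F: "finite F" "F \<subseteq> I"
  have "(norm (\<Sum>k\<in>F. c k *\<^sub>C f k *\<^sub>R e k))\<^sup>2 = (norm (\<Sum>k\<in>F. (c k * f k) *\<^sub>C e k))\<^sup>2"
    by (simp add: scaleR_scaleC scaleC_scaleC)
  also have "\<dots> = (\<Sum>k\<in>F. (cmod (c k))\<^sup>2 * (f k)\<^sup>2)"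
    using F by (simp add: norm_sum_e norm_mult power_mult_distrib)
  also have "\<dots> \<le> (\<Sum>k\<in>F. (cmod (c k))\<^sup>2 * C\<^sup>2)"
    using F assms by (intro sum_mono mult_left_mono) (auto simp: abs_le_square_iff[symmetric] intro: order_trans[OF _ abs_ge_self])
  also have "\<dots> = (\<bar>C\<bar> * norm (\<Sum>k\<in>F. c k *\<^sub>C e k))\<^sup>2"
    using F by (simp add: norm_sum_e power_mult_distrib sum_distrib_left mult.commute)
  finally show "norm (\<Sum>k\<in>F. c k *\<^sub>C f k *\<^sub>R e k) \<le> \<bar>C\<bar> * norm (\<Sum>k\<in>F. c k *\<^sub>C e k)"
    by (rule power2_le_imp_le) simp
qed (use that in auto)

lemma diagonal_coefficient:
  assumes T: "bounded_clinear T" "\<And>k. k \<in> I \<Longrightarrow> T (e k) = f k *\<^sub>R e k" and k: "k \<in> I"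
  shows "cinner (e k) (T v) = of_real (f k) * cinner (e k) v"
proof -
  have "bounded_linear (\<lambda>v. cinner (e k) (T v))"
    by (intro bounded_linear_compose[OF bounded_linear_cinner_right] bounded_clinear_bounded_linear T)
  from has_sum_bounded_linear[OF this expansion[of v]]
  have "((\<lambda>i. cinner (e k) (T (cinner (e i) v *\<^sub>C e i))) has_sum cinner (e k) (T v)) I" .
  moreover have "((\<lambda>i. cinner (e k) (T (cinner (e i) v *\<^sub>C e i))) has_sum of_real (f k) * cinner (e k) v) I"
    using k by (intro has_sum_finite_neutralI[of "{k}"])
      (auto simp: bounded_clinear_scaleC[OF T(1)] T(2) ortho cinner_scaleC_right cinner_scaleR_right)
  ultimately show ?thesis
    using has_sum_unique by blast
qed

lemma diagonal_is_adjoint: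
  assumes T: "bounded_clinear T" "\<And>k. k \<in> I \<Longrightarrow> T (e k) = f k *\<^sub>R e k"
  shows "is_adjoint T T"
  unfolding is_adjoint_def
proof (intro allI)
  fix x y
  have "cinner (T x) (e k) * cinner (e k) y = cinner x (e k) * cinner (e k) (T y)" if "k \<in> I" for k
    using diagonal_coefficient[OF T that, of x] diagonal_coefficient[OF T that, of y]
    by (simp add: cinner_commute[of _ "e k"])
  then have "((\<lambda>k. cinner (T x) (e k) * cinner (e k) y) has_sum cinner x (T y)) I"
    by (intro has_sum_cong[THEN iffD2, OF _ parseval])
  then show "cinner (T x) y = cinner x (T y)"
    by (rule has_sum_unique[OF parseval])
qed

lemma diagonal_positive:
  assumes T: "bounded_clinear T" "\<And>k. k \<in> I \<Longrightarrow> T (e k) = f k *\<^sub>R e k" and f: "\<And>k. k \<in> I \<Longrightarrow> f k \<ge> 0"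
  shows "positive_operator T"
  unfolding positive_operator_def
proof (intro conjI allI T(1))
  fix x
  have *: "cinner x (e k) * cinner (e k) (T x) = of_real (f k * (cmod (cinner (e k) x))\<^sup>2)" if "k \<in> I" for k
  proof -
    have "cinner x (e k) * cinner (e k) (T x) = of_real (f k) * (cnj (cinner (e k) x) * cinner (e k) x)"
      by (simp add: diagonal_coefficient[OF T that] cinner_commute[of x "e k"])
    then show ?thesis by (simp add: mult_cnj_cmod)
  qed
  have **: "((\<lambda>k. of_real (f k * (cmod (cinner (e k) x))\<^sup>2)) has_sum cinner x (T x)) I"
    by (intro has_sum_cong[THEN iffD1, OF _ parseval] *)
  show "Im (cinner x (T x)) = 0"
    using has_sum_unique[OF has_sum_Im[OF **]] by simp
  show "0 \<le> Re (cinner x (T x))"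
    using has_sum_nonneg[OF has_sum_Re[OF **]] f by simp
qed

end

section \<open>Square roots from the binomial series, and absolute values\<close>

subsection \<open>The absolute value of an operator\<close>

text \<open>The Taylor coefficients of sqrt(1 - x) at 0.\<close>

definition sqrt_coeff :: "nat \<Rightarrow> real" where
  "sqrt_coeff k = (1/2 gchoose k) * (- 1) ^ k"

lemma sqrt_coeff_0 [simp]: "sqrt_coeff 0 = 1"
  by (simp add: sqrt_coeff_def)

lemma gbinomial_step: "(a gchoose Suc k) = (a gchoose k) * (a - real k) / real (Suc k)"
  for a :: real
  by (simp add: gbinomial_prod_rev)

lemma sqrt_coeff_Suc: "sqrt_coeff (Suc k) = sqrt_coeff k * (real k - 1/2) / real (Suc k)"
  unfolding sqrt_coeff_def gbinomial_step by (simp add: divide_simps) (simp add: algebra_simps)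

lemma sqrt_coeff_nonpos: "sqrt_coeff (Suc k) \<le> 0"
proof (induction k)
  case (Suc k)
  then have "sqrt_coeff (Suc k) * (real (Suc k) - 1/2) \<le> 0"
    by (intro mult_nonpos_nonneg) auto
  then show ?case
    unfolding sqrt_coeff_Suc[of "Suc k"] by (intro divide_nonpos_nonneg) auto
qed (simp add: sqrt_coeff_Suc)

text \<open>The partial sums are the Taylor coefficients of sqrt(1 - x) / (1 - x) = (1 - x)^(-1/2),
  and these are nonnegative by the recursion for the binomials of -1/2.\<close>

lemma sum_sqrt_coeff_nonneg: "0 \<le> (\<Sum>k\<le>n. sqrt_coeff k)"
proof -
  have "0 \<le> (- 1) ^ n * ((-1/2 :: real) gchoose n)" for n
  proof (induction n)
    case (Suc n)
    have "(- 1) ^ Suc n * ((-1/2 :: real) gchoose Suc n) =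
        ((- 1) ^ n * (-1/2 gchoose n)) * (real n + 1/2) / real (Suc n)"
      unfolding gbinomial_step by (simp add: divide_simps) (simp add: algebra_simps)
    then show ?case using Suc by simp
  qed simp
  then show ?thesis
    using gbinomial_sum_lower_neg[of "1/2::real" n] by (simp add: sqrt_coeff_def)
qed

text \<open>All coefficients after the first are nonpositive, so their absolute sum is 1 minus a
  partial sum. This gives absolute convergence on the boundary of the unit disc, where contractions
  of norm one live.\<close>

lemma sum_abs_sqrt_coeff: "(\<Sum>k\<in>{1..n}. \<bar>sqrt_coeff k\<bar>) \<le> 1"
proof -
  have "(\<Sum>k\<in>{1..n}. \<bar>sqrt_coeff k\<bar>) = (\<Sum>k\<in>{1..n}. - sqrt_coeff k)"
    using sqrt_coeff_nonpos by (intro sum.cong refl) (metis abs_of_nonpos atLeastAtMost_iff not0_implies_Suc not_one_le_zero)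
  also have "\<dots> = 1 - (\<Sum>k\<le>n. sqrt_coeff k)"
    by (simp add: sum_negf atMost_atLeast0 sum.atLeast_Suc_atMost)
  finally show ?thesis using sum_sqrt_coeff_nonneg[of n] by simp
qed

lemma sqrt_coeff_summable: "(\<lambda>k. norm (sqrt_coeff k)) summable_on A"
  and infsum_sqrt_coeff: "(\<Sum>\<^sub>\<infinity>k\<in>{1..}. \<bar>sqrt_coeff k\<bar>) \<le> 1"
proof -
  have fin: "(\<Sum>k\<in>F. \<bar>sqrt_coeff k\<bar>) \<le> 1" if "finite F" "F \<subseteq> {1..}" for F
  proof -
    have "F \<subseteq> {1..Max (insert 0 F)}" using that by auto
    then have "(\<Sum>k\<in>F. \<bar>sqrt_coeff k\<bar>) \<le> (\<Sum>k\<in>{1..Max (insert 0 F)}. \<bar>sqrt_coeff k\<bar>)"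
      by (intro sum_mono2) auto
    also have "\<dots> \<le> 1" by (rule sum_abs_sqrt_coeff)
    finally show ?thesis .
  qed
  have s1: "(\<lambda>k. \<bar>sqrt_coeff k\<bar>) summable_on {1..}"
  proof (rule nonneg_bdd_above_summable_on)
    show "bdd_above (sum (\<lambda>k. \<bar>sqrt_coeff k\<bar>) ` {F. F \<subseteq> {1..} \<and> finite F})"
      by (rule bdd_aboveI2[where M=1], rule fin) simp_all
  qed simp
  then show "(\<Sum>\<^sub>\<infinity>k\<in>{1..}. \<bar>sqrt_coeff k\<bar>) \<le> 1"
    by (rule infsum_le_finite_sums) (rule fin)
  have "(\<lambda>k. \<bar>sqrt_coeff k\<bar>) summable_on (insert 0 {1..})"
    using s1 by (subst summable_on_insert_iff) auto
  also have "insert 0 {1..} = (UNIV :: nat set)" by (auto simp: Suc_le_eq)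
  finally show "(\<lambda>k. norm (sqrt_coeff k)) summable_on A"
    by (simp add: summable_on_subset_banach[of _ UNIV])
qed

text \<open>The Cauchy square of the series is 1 - x; on coefficients this is the Vandermonde
  identity for 1/2 + 1/2 = 1.\<close>

lemma sqrt_coeff_convolution:
  "(\<Sum>i\<le>k. sqrt_coeff i * sqrt_coeff (k - i)) = (if k = 0 then 1 else if k = 1 then -1 else 0)"
proof -
  have "(\<Sum>i\<le>k. sqrt_coeff i * sqrt_coeff (k - i)) =
      (\<Sum>i\<le>k. ((1/2 gchoose i) * (1/2 gchoose (k - i))) * (- 1) ^ k)"
    unfolding sqrt_coeff_def
    by (intro sum.cong refl) (simp add: mult_ac flip: power_add)
  also have "\<dots> = ((1::real) gchoose k) * (- 1) ^ k"
    using gbinomial_Vandermonde[of "1/2::real" "1/2" k]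
    by (simp add: sum_distrib_right[symmetric] atMost_atLeast0)
  also have "(1::real) gchoose k = of_nat (1 choose k)"
    by (simp add: binomial_gbinomial)
  finally show ?thesis by (cases k) (auto simp: binomial_eq_0)
qed

text \<open>Later X is 1 - T'T for a contraction T with adjoint T', so that \<open>sqrt_op\<close>
  becomes |T|.\<close>

locale positive_contraction =
  fixes X :: "'a::complex_hilbert_space \<Rightarrow> 'a"
  assumes lin: "bounded_clinear X" and contr: "norm (X v) \<le> norm v" and sa: "is_adjoint X X"
begin

lemma pow_lin: "bounded_clinear (X ^^ k)"
  by (induction k) (auto simp: o_def lin bounded_clinear_compose bounded_clinear_id id_def)

lemma pow_contr: "norm ((X ^^ k) v) \<le> norm v"
  by (induction k) (auto intro: order_trans contr)

lemma pow_sa: "cinner ((X ^^ k) v) w = cinner v ((X ^^ k) w)"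
  using sa by (induction k arbitrary: v w) (auto simp: is_adjoint_def funpow_swap1)

lemma summable_pow: "(\<lambda>k. sqrt_coeff k *\<^sub>R (X ^^ k) v) summable_on A"
proof (rule abs_summable_summable, rule summable_on_comparison_test)
  show "(\<lambda>k. \<bar>sqrt_coeff k\<bar> * norm v) summable_on A"
    using sqrt_coeff_summable[of A] by (intro summable_on_cmult_left) simp
qed (auto intro: mult_left_mono pow_contr)

definition sqrt_op :: "'a \<Rightarrow> 'a" where
  "sqrt_op v = (\<Sum>\<^sub>\<infinity>k. sqrt_coeff k *\<^sub>R (X ^^ k) v)"

lemma has_sum_sqrt_op: "((\<lambda>k. sqrt_coeff k *\<^sub>R (X ^^ k) v) has_sum sqrt_op v) UNIV"
  unfolding sqrt_op_def using summable_pow by simp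

lemma bounded_clinear_sqrt_op: "bounded_clinear sqrt_op"
proof (rule bounded_clinearI)
  show "sqrt_op (x + y) = sqrt_op x + sqrt_op y" for x y
    using has_sum_add[OF has_sum_sqrt_op[of x] has_sum_sqrt_op[of y]] has_sum_sqrt_op[of "x + y"]
    by (simp add: bounded_clinear_add[OF pow_lin] scaleR_add_right has_sum_unique)
  have "bounded_linear (\<lambda>x::'a. c *\<^sub>C x)" for c
    by (intro bounded_clinear_bounded_linear bounded_clinear_scaleC_op bounded_clinear_id)
  from has_sum_bounded_linear[OF this has_sum_sqrt_op]
  show "sqrt_op (c *\<^sub>C x) = c *\<^sub>C sqrt_op x" for c x
    using has_sum_sqrt_op[of "c *\<^sub>C x"]
    by (simp add: bounded_clinear_scaleC[OF pow_lin] scaleR_scaleC scaleC_scaleC mult.commute has_sum_unique)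
  show "norm (sqrt_op x) \<le> (\<Sum>\<^sub>\<infinity>k. \<bar>sqrt_coeff k\<bar>) * norm x" for x
  proof -
    have "((\<lambda>k. \<bar>sqrt_coeff k\<bar> * norm x) has_sum (\<Sum>\<^sub>\<infinity>k. \<bar>sqrt_coeff k\<bar>) * norm x) UNIV"
      by (intro has_sum_cmult_left has_sum_infsum) (use sqrt_coeff_summable[of UNIV] in simp)
    then show ?thesis
      by (rule norm_infsum_le[OF has_sum_sqrt_op])
         (auto intro: mult_left_mono pow_contr)
  qed
qed

text \<open>The constant term contributes the squared norm of v. All other terms together are at
  least its negative, since the remaining coefficients have absolute sum at most 1 and every power
  of X is a contraction.\<close>

lemma positive_sqrt_op: "positive_operator sqrt_op"
  unfolding positive_operator_def
proof (intro conjI allI bounded_clinear_sqrt_op)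
  fix v
  have real: "cinner v ((X ^^ k) v) = of_real (Re (cinner v ((X ^^ k) v)))" for k
  proof -
    have "cinner v ((X ^^ k) v) = cnj (cinner v ((X ^^ k) v))"
      using cinner_commute[of v "(X ^^ k) v"] pow_sa[of k v v] by simp
    then show ?thesis by (simp add: complex_eq_iff)
  qed
  define r where "r k = Re (cinner v ((X ^^ k) v))" for k
  have *: "((\<lambda>k. cinner v (sqrt_coeff k *\<^sub>R (X ^^ k) v)) has_sum cinner v (sqrt_op v)) UNIV"
    by (rule has_sum_bounded_linear[OF bounded_linear_cinner_right has_sum_sqrt_op])
  have **: "cinner v (sqrt_coeff k *\<^sub>R (X ^^ k) v) = of_real (sqrt_coeff k * r k)" for k
    unfolding cinner_scaleR_right r_def by (subst real) simp
  have sum_r: "((\<lambda>k. of_real (sqrt_coeff k * r k)) has_sum cinner v (sqrt_op v)) UNIV"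
    using * unfolding ** .
  show "Im (cinner v (sqrt_op v)) = 0"
    using has_sum_unique[OF has_sum_Im[OF sum_r]] by simp
  have "\<bar>r k\<bar> \<le> (norm v)\<^sup>2" for k
  proof -
    have "\<bar>r k\<bar> \<le> cmod (cinner v ((X ^^ k) v))"
      unfolding r_def by (rule abs_Re_le_cmod)
    also have "\<dots> \<le> norm v * norm v"
      by (intro order_trans[OF norm_cinner_le] mult_left_mono pow_contr) simp
    finally show ?thesis by (simp add: power2_eq_square)
  qed
  then have r: "sqrt_coeff k * r k \<ge> - (\<bar>sqrt_coeff k\<bar> * (norm v)\<^sup>2)" for k
    using mult_left_mono[of "\<bar>r k\<bar>" "(norm v)\<^sup>2" "\<bar>sqrt_coeff k\<bar>"] abs_ge_minus_self[of "sqrt_coeff k * r k"]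
    by (simp add: abs_mult)
  have s_abs: "((\<lambda>k. - (\<bar>sqrt_coeff k\<bar> * (norm v)\<^sup>2)) has_sum - ((\<Sum>\<^sub>\<infinity>k\<in>{1..}. \<bar>sqrt_coeff k\<bar>) * (norm v)\<^sup>2)) {1..}"
    unfolding has_sum_uminus minus_minus
    by (intro has_sum_cmult_left has_sum_infsum) (use sqrt_coeff_summable[of "{1..}"] in simp)
  have sum_r': "((\<lambda>k. sqrt_coeff k * r k) has_sum Re (cinner v (sqrt_op v))) UNIV"
    using has_sum_Re[OF sum_r] by simp
  have "(\<lambda>k. sqrt_coeff k * r k) summable_on {1..}"
    using summable_on_subset_banach[OF has_sum_imp_summable[OF sum_r']] by simp
  then have s1: "((\<lambda>k. sqrt_coeff k * r k) has_sum (\<Sum>\<^sub>\<infinity>k\<in>{1..}. sqrt_coeff k * r k)) {1..}"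
    by simp
  have "- ((\<Sum>\<^sub>\<infinity>k\<in>{1..}. \<bar>sqrt_coeff k\<bar>) * (norm v)\<^sup>2) \<le> (\<Sum>\<^sub>\<infinity>k\<in>{1..}. sqrt_coeff k * r k)"
    by (rule has_sum_mono[OF s_abs s1 r])
  moreover have "(\<Sum>\<^sub>\<infinity>k\<in>{1..}. \<bar>sqrt_coeff k\<bar>) * (norm v)\<^sup>2 \<le> 1 * (norm v)\<^sup>2"
    by (intro mult_right_mono infsum_sqrt_coeff) simp
  moreover have "((\<lambda>k. sqrt_coeff k * r k) has_sum (sqrt_coeff 0 * r 0 + (\<Sum>\<^sub>\<infinity>k\<in>{1..}. sqrt_coeff k * r k))) (insert 0 {1..})"
    by (rule has_sum_insert[OF _ s1]) simp
  moreover have "insert 0 {1..} = (UNIV :: nat set)" by (auto simp: Suc_le_eq)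
  moreover have "r 0 = (norm v)\<^sup>2" by (simp add: r_def power2_norm_eq_cinner)
  ultimately show "0 \<le> Re (cinner v (sqrt_op v))"
    using has_sum_unique[OF sum_r'] by fastforce
qed

text \<open>Absolute convergence permits rearranging the double series by total degree; the
  convolution identity then removes every degree above 1.\<close>

lemma sqrt_op_square: "sqrt_op (sqrt_op v) = v - X v"
proof -
  define f where "f = (\<lambda>(i, j). (sqrt_coeff i * sqrt_coeff j) *\<^sub>R (X ^^ (i + j)) v)"
  have "(\<lambda>p. norm ((\<lambda>(i, j). sqrt_coeff i * sqrt_coeff j) p)) summable_on UNIV \<times> UNIV"
    using sqrt_coeff_summable[of UNIV]
    by (subst Infinite_Sum.abs_summable_on_Sigma_iff)
       (auto simp: abs_mult infsum_cmult_right' intro!: summable_on_cmult_right summable_on_cmult_left)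
  then have "(\<lambda>p. \<bar>sqrt_coeff (fst p) * sqrt_coeff (snd p)\<bar> * norm v) summable_on UNIV \<times> UNIV"
    by - (rule summable_on_cmult_left, simp add: case_prod_unfold)
  then have "(\<lambda>p. norm (f p)) summable_on UNIV \<times> UNIV"
  proof (rule summable_on_comparison_test)
    show "norm (f p) \<le> \<bar>sqrt_coeff (fst p) * sqrt_coeff (snd p)\<bar> * norm v" for p
      by (simp add: f_def case_prod_unfold mult_left_mono pow_contr)
  qed simp
  then have sf: "f summable_on UNIV \<times> UNIV"
    by (rule abs_summable_summable)
  have "(\<Sum>\<^sub>\<infinity>j. f (i, j)) = sqrt_coeff i *\<^sub>R (X ^^ i) (sqrt_op v)" for i
  proof -
    have "((\<lambda>j. sqrt_coeff i *\<^sub>R (X ^^ i) (sqrt_coeff j *\<^sub>R (X ^^ j) v)) has_sum sqrt_coeff i *\<^sub>R (X ^^ i) (sqrt_op v)) UNIV"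
      by (intro has_sum_bounded_linear[OF _ has_sum_sqrt_op, where h="\<lambda>w. sqrt_coeff i *\<^sub>R (X ^^ i) w"]
          bounded_linear_const_scaleR bounded_clinear_bounded_linear pow_lin)
    then show ?thesis
      by (intro infsumI)
         (simp add: f_def funpow_add scaleR_scaleC bounded_clinear_scaleC[OF pow_lin] scaleC_scaleC)
  qed
  then have "sqrt_op (sqrt_op v) = (\<Sum>\<^sub>\<infinity>i. \<Sum>\<^sub>\<infinity>j. f (i, j))"
    by (simp add: sqrt_op_def[of "sqrt_op v"])
  also have "\<dots> = infsum f (UNIV \<times> UNIV)"
    by (rule infsum_Sigma_banach[OF sf])
  also have "\<dots> = (\<Sum>\<^sub>\<infinity>p\<in>Sigma UNIV (\<lambda>k. {..k}). f (snd p, fst p - snd p))"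
  proof -
    \<comment> \<open>A pair (k, i) with i \<le> k stands for the summand (i, k - i) of total degree
      k.\<close>
    have bij: "bij_betw (\<lambda>p. (snd p, fst p - snd p)) (Sigma UNIV (\<lambda>k. {..k})) (UNIV \<times> (UNIV::nat set))"
      by (rule bij_betw_byWitness[where f'="\<lambda>(i, j). (i + j, i)"]) auto
    show ?thesis
      using infsum_reindex_bij_betw[OF bij, of f] summable_on_reindex_bij_betw[OF bij, of f] by simp
  qed
  also have "\<dots> = (\<Sum>\<^sub>\<infinity>k. \<Sum>\<^sub>\<infinity>i\<in>{..k}. f (i, k - i))"
  proof -
    have bij: "bij_betw (\<lambda>p. (snd p, fst p - snd p)) (Sigma UNIV (\<lambda>k. {..k})) (UNIV \<times> (UNIV::nat set))"
      by (rule bij_betw_byWitness[where f'="\<lambda>(i, j). (i + j, i)"]) auto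
    have "(\<lambda>p. f (snd p, fst p - snd p)) summable_on Sigma UNIV (\<lambda>k. {..k})"
      using summable_on_reindex_bij_betw[OF bij, of f] sf by simp
    from infsum_Sigma_banach[OF this] show ?thesis by simp
  qed
  also have "\<dots> = (\<Sum>\<^sub>\<infinity>k. (if k = 0 then 1 else if k = 1 then - 1 else 0) *\<^sub>R (X ^^ k) v)"
  proof (intro infsum_cong)
    fix k
    have "(\<Sum>\<^sub>\<infinity>i\<in>{..k}. f (i, k - i)) = (\<Sum>i\<le>k. (sqrt_coeff i * sqrt_coeff (k - i)) *\<^sub>R (X ^^ k) v)"
      by (simp add: f_def)
    then show "(\<Sum>\<^sub>\<infinity>i\<in>{..k}. f (i, k - i)) = (if k = 0 then 1 else if k = 1 then - 1 else 0) *\<^sub>R (X ^^ k) v"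
      unfolding scaleR_sum_left[symmetric] sqrt_coeff_convolution .
  qed
  also have "\<dots> = (\<Sum>\<^sub>\<infinity>k\<in>{0, 1::nat}. (if k = 0 then 1 else if k = 1 then - 1 else 0) *\<^sub>R (X ^^ k) v)"
    by (rule infsum_cong_neutral) auto
  also have "\<dots> = v - X v" by simp
  finally show ?thesis .
qed

end

lemma norm_adjoint_le:
  assumes adj: "is_adjoint T T'" and T: "\<And>v. norm (T v) \<le> norm v"
  shows "norm (T' w) \<le> norm w"
proof -
  have "(norm (T' w))\<^sup>2 = Re (cinner (T (T' w)) w)"
    using adj by (simp add: power2_norm_eq_cinner is_adjoint_def)
  also have "\<dots> \<le> norm (T (T' w)) * norm w"
    by (rule order_trans[OF complex_Re_le_cmod norm_cinner_le])
  also have "\<dots> \<le> norm (T' w) * norm w"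
    by (intro mult_right_mono T) simp
  finally show ?thesis
    by (cases "norm (T' w) = 0") (auto simp: power2_eq_square)
qed

lemma is_adjoint_sym: "is_adjoint T T' \<Longrightarrow> is_adjoint T' T"
  unfolding is_adjoint_def by (metis cinner_commute)

lemma absolute_value_contraction:
  assumes T: "bounded_clinear T" "bounded_clinear T'" and adj: "is_adjoint T T'"
    and contr: "\<And>v. norm (T v) \<le> norm v"
  obtains S where "is_absolute_value T S"
proof -
  interpret positive_contraction "\<lambda>v. v - T' (T v)"
  proof
    show "bounded_clinear (\<lambda>v. v - T' (T v))"
      by (intro bounded_clinear_diff_op bounded_clinear_id bounded_clinear_compose[OF T(2,1)])
    have TT: "cinner (T' (T v)) w = cinner (T v) (T w)" "cinner v (T' (T w)) = cinner (T v) (T w)" for v w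
      using adj is_adjoint_sym[OF adj] by (simp_all add: is_adjoint_def)
    show "is_adjoint (\<lambda>v. v - T' (T v)) (\<lambda>v. v - T' (T v))"
      by (simp add: is_adjoint_def cinner_diff_left cinner_diff_right TT)
    fix v
    define u where "u = T' (T v)"
    have u: "cinner v u = cinner (T v) (T v)" "cinner u v = cinner (T v) (T v)"
      by (simp_all only: u_def TT)
    \<comment> \<open>Expanding the square of v - T'Tv gives |v|^2 - 2 |Tv|^2 + |T'Tv|^2, and the
      last term is absorbed because T' is a contraction as well.\<close>
    have "(norm (T' (T v)))\<^sup>2 \<le> (norm (T v))\<^sup>2"
      by (intro power_mono norm_adjoint_le[OF adj contr]) simp
    moreover have "(norm (v - T' (T v)))\<^sup>2 = (norm v)\<^sup>2 - 2 * (norm (T v))\<^sup>2 + (norm (T' (T v)))\<^sup>2"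
      by (simp add: power2_norm_eq_cinner cinner_diff_left cinner_diff_right u flip: u_def)
    ultimately have "(norm (v - T' (T v)))\<^sup>2 \<le> (norm v)\<^sup>2"
      using zero_le_power2[of "norm (T v)"] by linarith
    then show "norm (v - T' (T v)) \<le> norm v"
      by (rule power2_le_imp_le) simp
  qed
  have "sqrt_op \<circ> sqrt_op = T' \<circ> T"
    by (simp add: fun_eq_iff sqrt_op_square)
  then have "is_absolute_value T sqrt_op"
    using positive_sqrt_op T(2) adj unfolding is_absolute_value_def by blast
  then show ?thesis by (rule that)
qed

lemma absolute_value_exists:
  assumes T: "bounded_clinear T" "bounded_clinear T'" and adj: "is_adjoint T T'"
  obtains S where "is_absolute_value T S"
proof -
  obtain K where K: "K \<ge> 0" "\<And>v. norm (T v) \<le> K * norm v"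
    using bounded_clinear_norm_bound[OF T(1)] by blast
  \<comment> \<open>Adding 1 keeps the scaling factor positive even for the zero operator.\<close>
  define M where "M = K + 1"
  have M: "M > 0" "\<And>v. norm (T v) \<le> M * norm v"
    using K by (auto simp: M_def distrib_right intro: add_increasing2)
  define c where "c = complex_of_real (1 / M)"
  have c: "cnj c = c" "c * of_real M = 1" "cmod c = 1 / M" using M by (auto simp: c_def norm_divide)
  obtain S where S: "is_absolute_value (\<lambda>v. c *\<^sub>C T v) S"
  proof (rule absolute_value_contraction)
    show "bounded_clinear (\<lambda>v. c *\<^sub>C T v)" "bounded_clinear (\<lambda>v. c *\<^sub>C T' v)"
      by (intro bounded_clinear_scaleC_op T)+
    show "is_adjoint (\<lambda>v. c *\<^sub>C T v) (\<lambda>v. c *\<^sub>C T' v)"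
      using adj by (simp add: is_adjoint_def cinner_scaleC_left cinner_scaleC_right c)
    show "norm (c *\<^sub>C T v) \<le> norm v" for v
      using M(1) M(2)[of v] by (simp add: c pos_divide_le_eq mult.commute)
  qed
  then obtain T1 where S': "positive_operator S" "bounded_clinear T1" "is_adjoint (\<lambda>v. c *\<^sub>C T v) T1"
    "S \<circ> S = T1 \<circ> (\<lambda>v. c *\<^sub>C T v)"
    unfolding is_absolute_value_def by blast
  \<comment> \<open>The absolute value only provides some adjoint \<open>T1\<close> of the scaled
    operator; uniqueness of adjoints identifies it with the scaled \<open>T'\<close>.\<close>
  have T1: "T1 = (\<lambda>v. c *\<^sub>C T' v)"
  proof
    fix v show "T1 v = c *\<^sub>C T' v"
    proof (rule cinner_extensionality)
      fix z show "cinner z (T1 v) = cinner z (c *\<^sub>C T' v)"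
        using S'(3) adj by (simp add: is_adjoint_def cinner_scaleC_left cinner_scaleC_right c flip: S'(3)[unfolded is_adjoint_def, rule_format])
    qed
  qed
  have Slin: "bounded_clinear S" using S'(1) by (simp add: positive_operator_def)
  have "positive_operator (\<lambda>v. of_real M *\<^sub>C S v)"
    using S'(1) M(1) unfolding positive_operator_def
    by (auto simp: cinner_scaleC_right intro: bounded_clinear_scaleC_op)
  moreover have "of_real M *\<^sub>C S (of_real M *\<^sub>C S v) = T' (T v)" for v
  proof -
    have "S (S v) = c *\<^sub>C T' (c *\<^sub>C T v)"
      using S'(4) T1 by (simp add: fun_eq_iff)
    then have "of_real M *\<^sub>C S (of_real M *\<^sub>C S v) = (of_real M * of_real M * c * c) *\<^sub>C T' (T v)"
      by (simp add: bounded_clinear_scaleC[OF Slin] bounded_clinear_scaleC[OF T(2)] scaleC_scaleC mult.assoc)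
    also have "of_real M * of_real M * c * c = (c * of_real M) * (c * of_real M)"
      by (simp only: mult_ac)
    finally show ?thesis
      by (simp only: c(2) mult_1_left scaleC_one)
  qed
  ultimately have "is_absolute_value T (\<lambda>v. of_real M *\<^sub>C S v)"
    unfolding is_absolute_value_def using T(2) adj by (auto simp: fun_eq_iff)
  then show ?thesis by (rule that)
qed

text \<open>Polarization: the quadratic form is real, and evaluating it at x + y and at x + \<i> y
  recovers the symmetry of the sesquilinear form.\<close>

lemma positive_operator_is_adjoint:
  assumes "positive_operator S"
  shows "is_adjoint S S"
proof -
  have S: "bounded_clinear S" "\<And>x. Im (cinner x (S x)) = 0"
    using assms by (auto simp: positive_operator_def)
  have sym: "cinner x (S x) = cinner (S x) x" for x
    using S(2)[of x] cinner_commute[of "S x" x] by (simp add: complex_eq_iff)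
  have 1: "cinner x (S y) + cinner y (S x) = cinner (S x) y + cinner (S y) x" for x y
    using sym[of "x + y"] sym[of x] sym[of y]
    by (simp add: bounded_clinear_add[OF S(1)] cinner_add_left cinner_add_right) (simp add: add.commute)
  have "cinner (S x) y = cinner x (S y)" for x y
    using 1[of x y] 1[of x "\<i> *\<^sub>C y"]
    by (simp add: bounded_clinear_scaleC[OF S(1)] cinner_scaleC_left cinner_scaleC_right)
       (simp add: complex_eq_iff)
  then show ?thesis by (simp add: is_adjoint_def)
qed

text \<open>With \<open>S = |T|\<close>, \<open>\<langle>e, S e\<rangle> \<le> \<parallel>S e\<parallel> = \<parallel>T e\<parallel>\<close>; no polar decomposition is needed.\<close>

lemma (in onb_family) trace_classI:
  assumes T: "bounded_clinear T" "bounded_clinear T'" and adj: "is_adjoint T T'"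
    and summable: "(\<lambda>i. norm (T (e i))) summable_on I"
  shows "trace_class T"
proof -
  obtain S where S: "is_absolute_value T S"
    using absolute_value_exists[OF T adj] .
  then obtain T1 where T1: "positive_operator S" "is_adjoint T T1" "S \<circ> S = T1 \<circ> T"
    unfolding is_absolute_value_def by blast
  have bound: "0 \<le> Re (cinner x (S x))" "Re (cinner x (S x)) \<le> norm x * norm (T x)" for x
  proof -
    show "0 \<le> Re (cinner x (S x))"
      using T1(1) by (simp add: positive_operator_def)
    have "cinner (S x) (S x) = cinner x (S (S x))"
      using positive_operator_is_adjoint[OF T1(1)] by (simp add: is_adjoint_def)
    also have "\<dots> = cinner x (T1 (T x))"
      using T1(3) by (simp add: fun_eq_iff)
    also have "\<dots> = cinner (T x) (T x)"
      using T1(2) by (simp add: is_adjoint_def)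
    finally have "(norm (S x))\<^sup>2 = (norm (T x))\<^sup>2"
      by (simp add: power2_norm_eq_cinner)
    then have "norm (S x) = norm (T x)"
      by (simp add: power2_eq_iff_nonneg)
    then show "Re (cinner x (S x)) \<le> norm x * norm (T x)"
      using order_trans[OF complex_Re_le_cmod norm_cinner_le[of x "S x"]] by simp
  qed
  have "(\<lambda>i. Re (cinner (e i) (S (e i)))) summable_on I"
  proof (rule summable_on_comparison_test[OF summable])
    show "Re (cinner (e i) (S (e i))) \<le> norm (T (e i))" if "i \<in> I" for i
      using bound(2)[of "e i"] norm_e[OF that] by simp
  qed (rule bound(1))
  then have "(\<lambda>x. Re (cinner x (S x))) summable_on e ` I"
    by (subst summable_on_reindex[OF inj_e]) (simp add: o_def)
  then show ?thesis
    unfolding trace_class_def using T(1) S is_onb by blast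
qed

section \<open>The bounded transform of an operator with an orthonormal eigenbasis\<close>

subsection \<open>Functions of a diagonal self-adjoint operator\<close>

lemma bounded_clinear_scaleR: "bounded_clinear T \<Longrightarrow> T (r *\<^sub>R x) = r *\<^sub>R T x"
  by (simp add: scaleR_scaleC bounded_clinear_scaleC)

text \<open>The vector w = R x - \<mu> x satisfies R w = -\<mu> w, which positivity of R allows only
  for w = 0. This replaces the spectral theorem in the uniqueness of the positive square
  root.\<close>

lemma positive_sqrt_unique_on_eigenvector:
  assumes R: "positive_operator R" and RR: "R (R x) = (\<mu>\<^sup>2) *\<^sub>R x" and "\<mu> > 0"
  shows "R x = \<mu> *\<^sub>R x"
proof -
  have lin: "bounded_clinear R"
    using R by (simp add: positive_operator_def)
  define w where "w = R x - \<mu> *\<^sub>R x"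
  have Rsc: "R (c *\<^sub>R y) = c *\<^sub>R R y" for c y
    by (simp add: scaleR_scaleC bounded_clinear_scaleC[OF lin])
  have "R w = (\<mu>\<^sup>2) *\<^sub>R x - \<mu> *\<^sub>R R x"
    by (simp only: w_def bounded_clinear_diff[OF lin] Rsc RR)
  also have "\<dots> = (- \<mu>) *\<^sub>R w"
    by (simp add: w_def scaleR_diff_right power2_eq_square)
  finally have "Re (cinner w (R w)) = - \<mu> * (norm w)\<^sup>2"
    by (simp add: cinner_scaleR_right cinner_norm)
  moreover have "Re (cinner w (R w)) \<ge> 0"
    using R by (simp add: positive_operator_def)
  ultimately have "\<mu> * (norm w)\<^sup>2 \<le> 0" by simp
  then have "w = 0"
    using \<open>\<mu> > 0\<close> by (simp add: mult_le_0_iff)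
  then show ?thesis by (simp add: w_def)
qed

context onb_family
begin

context
  fixes D :: "('a \<times> 'a) set" and lam :: "'i \<Rightarrow> real"
  assumes sa: "selfadjoint_operator D" and eig: "\<And>i. i \<in> I \<Longrightarrow> (e i, lam i *\<^sub>R e i) \<in> D"
begin

text \<open>A self-adjoint graph is maximal: by Parseval, a pair with matching coefficients lies in
  the adjoint graph, hence in D. Thus the eigenvectors determine D completely, including its
  domain.\<close>

lemma graph_iff_coefficients:
  "(x, y) \<in> D \<longleftrightarrow> (\<forall>i\<in>I. cinner (e i) y = of_real (lam i) * cinner (e i) x)"
proof
  have D: "adjoint_graph D = D"
    using sa by (simp add: selfadjoint_operator_def)
  have coeff: "cinner (e i) y = of_real (lam i) * cinner (e i) x" if "(x, y) \<in> D" "i \<in> I" for x y i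
  proof -
    have "(x, y) \<in> adjoint_graph D" using that D by simp
    then show ?thesis
      using eig[OF \<open>i \<in> I\<close>] by (auto simp: adjoint_graph_def cinner_scaleR_left)
  qed
  show "\<forall>i\<in>I. cinner (e i) y = of_real (lam i) * cinner (e i) x" if "(x, y) \<in> D"
    using coeff that by blast
  show "(x, y) \<in> D" if xy: "\<forall>i\<in>I. cinner (e i) y = of_real (lam i) * cinner (e i) x"
  proof -
    have "cinner w x = cinner u y" if uw: "(u, w) \<in> D" for u w
    proof -
      have "cinner w (e i) * cinner (e i) x = cinner u (e i) * cinner (e i) y" if "i \<in> I" for i
        using coeff[OF uw that] xy that cinner_commute[of w "e i"] cinner_commute[of u "e i"] by simp
      then have "((\<lambda>i. cinner w (e i) * cinner (e i) x) has_sum cinner u y) I"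
        by (intro has_sum_cong[THEN iffD2, OF _ parseval])
      then show ?thesis
        by (rule has_sum_unique[OF parseval])
    qed
    then have "(x, y) \<in> adjoint_graph D"
      by (auto simp: adjoint_graph_def)
    then show ?thesis using D by simp
  qed
qed

lemma inverse_one_plus_square_iff:
  assumes "\<And>i. i \<in> I \<Longrightarrow> cinner (e i) w' = of_real (1 / (1 + (lam i)\<^sup>2)) * cinner (e i) v"
  shows "w' = w \<longleftrightarrow> (w, v) \<in> one_plus_square D"
proof
  have pos: "1 + (lam i)\<^sup>2 > 0" for i
    by (simp add: add_pos_nonneg)
  show "(w, v) \<in> one_plus_square D" if "w' = w"
  proof -
    have w: "cinner (e i) w = of_real (1 / (1 + (lam i)\<^sup>2)) * cinner (e i) v" if "i \<in> I" for i
      using assms that \<open>w' = w\<close> by simp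
    \<comment> \<open>G is D(1 + D^2)^(-1); it supplies the intermediate vector D w required by
      \<open>one_plus_square\<close>.\<close>
    obtain G where G: "bounded_clinear G" "\<And>k. k \<in> I \<Longrightarrow> G (e k) = (lam k / (1 + (lam k)\<^sup>2)) *\<^sub>R e k"
    proof (rule diagonal_operator[of "\<lambda>i. lam i / (1 + (lam i)\<^sup>2)" 1])
      fix i
      have "2 * \<bar>lam i\<bar> \<le> 1 + (lam i)\<^sup>2"
        using zero_le_power2[of "\<bar>lam i\<bar> - 1"] by (simp add: power2_eq_square algebra_simps)
      then have "\<bar>lam i\<bar> \<le> 1 + (lam i)\<^sup>2"
        by simp
      then show "\<bar>lam i / (1 + (lam i)\<^sup>2)\<bar> \<le> 1"
        using pos[of i] by (simp add: abs_divide)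
    qed (rule that)
    have Gc: "cinner (e i) (G v) = of_real (lam i / (1 + (lam i)\<^sup>2)) * cinner (e i) v" if "i \<in> I" for i v
      by (rule diagonal_coefficient[OF G that])
    have 1: "(w, G v) \<in> D"
      unfolding graph_iff_coefficients by (simp add: Gc w)
    have 2: "(G v, v - w) \<in> D"
      unfolding graph_iff_coefficients
    proof
      fix i assume i: "i \<in> I"
      have "(1 - 1 / (1 + (lam i)\<^sup>2)) = lam i * (lam i / (1 + (lam i)\<^sup>2))"
        using pos[of i] by (simp add: field_simps power2_eq_square)
      moreover have "cinner (e i) (v - w) = of_real (1 - 1 / (1 + (lam i)\<^sup>2)) * cinner (e i) v"
        by (simp only: cinner_diff_right w[OF i] of_real_diff of_real_1 left_diff_distrib mult_1_left)
      ultimately show "cinner (e i) (v - w) = of_real (lam i) * cinner (e i) (G v)"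
        by (simp only: Gc[OF i] of_real_mult mult.assoc)
    qed
    have "(w, w + (v - w)) \<in> one_plus_square D"
      using 1 2 unfolding one_plus_square_def by blast
    then show ?thesis by simp
  qed
  show "w' = w" if wv: "(w, v) \<in> one_plus_square D"
  proof -
    obtain y z where yz: "(w, y) \<in> D" "(y, z) \<in> D" "v = w + z"
      using wv unfolding one_plus_square_def mem_Collect_eq prod.inject by blast
    show ?thesis
    proof (rule eq_if_same_coefficients)
      fix i assume i: "i \<in> I"
      have "cinner (e i) z = of_real ((lam i)\<^sup>2) * cinner (e i) w"
        using yz(1,2) i unfolding graph_iff_coefficients by (simp add: power2_eq_square)
      then have "cinner (e i) v = of_real (1 + (lam i)\<^sup>2) * cinner (e i) w"
        by (simp add: yz(3) cinner_add_right distrib_right)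
      then have "cinner (e i) w' = of_real (1 / (1 + (lam i)\<^sup>2) * (1 + (lam i)\<^sup>2)) * cinner (e i) w"
        by (simp only: assms[OF i] of_real_mult mult.assoc)
      also have "1 / (1 + (lam i)\<^sup>2) * (1 + (lam i)\<^sup>2) = 1"
        using pos[of i] by simp
      finally show "cinner (e i) w' = cinner (e i) w" by simp
    qed
  qed
qed

text \<open>Both definite descriptions are resolved by explicit diagonal operators, with uniqueness
  of the square root settled on eigenvectors and uniqueness of the image read off from
  coefficients.\<close>

lemma bounded_transform_diagonal:
  shows "bounded_clinear (bounded_transform D)"
    and "i \<in> I \<Longrightarrow> bounded_transform D (e i) = (lam i / sqrt (1 + (lam i)\<^sup>2)) *\<^sub>R e i"
proof -
  have pos: "1 + (lam i)\<^sup>2 > 0" for i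
    by (simp add: add_pos_nonneg)
  have spos: "sqrt (1 + (lam i)\<^sup>2) > 0" "(sqrt (1 + (lam i)\<^sup>2))\<^sup>2 = 1 + (lam i)\<^sup>2" for i
    using pos[of i] by (auto intro: less_imp_le)
  obtain R where R: "bounded_clinear R" "\<And>k. k \<in> I \<Longrightarrow> R (e k) = (1 / sqrt (1 + (lam k)\<^sup>2)) *\<^sub>R e k"
  proof (rule diagonal_operator[of "\<lambda>i. 1 / sqrt (1 + (lam i)\<^sup>2)" 1])
    show "\<bar>1 / sqrt (1 + (lam i)\<^sup>2)\<bar> \<le> 1" for i
      using spos(1)[of i] real_sqrt_le_mono[of 1 "1 + (lam i)\<^sup>2"] by (simp add: abs_divide pos_divide_le_eq)
  qed (rule that)
  have pR: "positive_operator R"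
    by (rule diagonal_positive[OF R]) (auto simp: less_imp_le)
  have "cinner (e i) (R (R v)) = of_real (1 / (1 + (lam i)\<^sup>2)) * cinner (e i) v" if "i \<in> I" for i v
  proof -
    have "cinner (e i) (R (R v)) = of_real (1 / sqrt (1 + (lam i)\<^sup>2) * (1 / sqrt (1 + (lam i)\<^sup>2))) * cinner (e i) v"
      by (simp only: diagonal_coefficient[OF R that] of_real_mult mult.assoc)
    also have "1 / sqrt (1 + (lam i)\<^sup>2) * (1 / sqrt (1 + (lam i)\<^sup>2)) = 1 / (1 + (lam i)\<^sup>2)"
      using spos(2)[of i] by (simp add: power2_eq_square)
    finally show ?thesis .
  qed
  then have RR: "R (R v) = w \<longleftrightarrow> (w, v) \<in> one_plus_square D" for v w
    by (rule inverse_one_plus_square_iff)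
  have "inverse_sqrt_one_plus_square D = R"
    unfolding inverse_sqrt_one_plus_square_def
  proof (rule the_equality)
    show "positive_operator R \<and> (\<forall>v w. R (R v) = w \<longleftrightarrow> (w, v) \<in> one_plus_square D)"
      using pR RR by blast
    fix R' assume R': "positive_operator R' \<and> (\<forall>v w. R' (R' v) = w \<longleftrightarrow> (w, v) \<in> one_plus_square D)"
    \<comment> \<open>A competing \<open>R'\<close> has the same square as \<open>R\<close>, so on
      each eigenvector it acts as the positive root; density of their span does the rest.\<close>
    have "R' x = R x" if "x \<in> e ` I" for x
    proof -
      from that obtain i where i: "i \<in> I" "x = e i" by auto
      have "R (R x) = (1 / sqrt (1 + (lam i)\<^sup>2))\<^sup>2 *\<^sub>R x"
        using R(2) i by (simp add: bounded_clinear_scaleR[OF R(1)] power2_eq_square)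
      then have "R' (R' x) = (1 / sqrt (1 + (lam i)\<^sup>2))\<^sup>2 *\<^sub>R x"
        using R' RR by blast
      then have "R' x = (1 / sqrt (1 + (lam i)\<^sup>2)) *\<^sub>R x"
        by (rule positive_sqrt_unique_on_eigenvector[OF conjunct1[OF R']]) (use spos(1)[of i] in simp)
      then show ?thesis using i R(2) by simp
    qed
    moreover have "bounded_clinear R'" using R' by (simp add: positive_operator_def)
    ultimately show "R' = R"
      using R(1) dense by (intro bounded_clinear_eq_on_dense[of R' R "e ` I"])
  qed
  moreover obtain F where F: "bounded_clinear F" "\<And>k. k \<in> I \<Longrightarrow> F (e k) = (lam k / sqrt (1 + (lam k)\<^sup>2)) *\<^sub>R e k"
  proof (rule diagonal_operator[of "\<lambda>i. lam i / sqrt (1 + (lam i)\<^sup>2)" 1])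
    show "\<bar>lam i / sqrt (1 + (lam i)\<^sup>2)\<bar> \<le> 1" for i
      using spos(1)[of i] real_sqrt_le_mono[of "(lam i)\<^sup>2" "1 + (lam i)\<^sup>2"] by (simp add: abs_divide)
  qed (rule that)
  ultimately have "bounded_transform D v = F v" for v
    unfolding bounded_transform_def
  proof (intro the_equality)
    assume *: "inverse_sqrt_one_plus_square D = R"
    show in_D: "(inverse_sqrt_one_plus_square D v, F v) \<in> D"
      unfolding * graph_iff_coefficients
      by (simp add: diagonal_coefficient[OF R] diagonal_coefficient[OF F])
    show "y = F v" if "(inverse_sqrt_one_plus_square D v, y) \<in> D" for y
      using in_D that by (intro eq_if_same_coefficients) (simp add: graph_iff_coefficients)
  qed
  then have "bounded_transform D = F" by auto
  then show "bounded_clinear (bounded_transform D)"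
    and "i \<in> I \<Longrightarrow> bounded_transform D (e i) = (lam i / sqrt (1 + (lam i)\<^sup>2)) *\<^sub>R e i"
    using F by simp_all
qed

end
end

section \<open>Convolution, coassociativity and involution on functions of words\<close>

section \<open>The Hopf algebra structure on functionals\<close>

text \<open>Sweedler summation with an arbitrary function of both factors. In this form coproducts
  can be nested, and identities follow by induction on the word from one rule per generator.\<close>

definition cop :: "uq_word \<Rightarrow> (uq_word \<Rightarrow> uq_word \<Rightarrow> complex) \<Rightarrow> complex" where
  "cop x f = (\<Sum>(u, v)\<leftarrow>coproduct x. f u v)"

lemma cop_Nil [simp]: "cop [] f = f [] []"
  by (simp add: cop_def)

lemma cop_gen [simp]:
  "cop (Uk # x) f = cop x (\<lambda>u v. f (Uk # u) (Uk # v))"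
  "cop (Uki # x) f = cop x (\<lambda>u v. f (Uki # u) (Uki # v))"
  "cop (Ue # x) f = cop x (\<lambda>u v. f (Ue # u) (Uk # v)) + cop x (\<lambda>u v. f (Uki # u) (Ue # v))"
  "cop (Uf # x) f = cop x (\<lambda>u v. f (Uf # u) (Uk # v)) + cop x (\<lambda>u v. f (Uki # u) (Uf # v))"
  by (simp_all add: cop_def comp_def case_prod_unfold)

lemma cop_add: "cop x (\<lambda>u v. f u v + g u v) = cop x f + cop x g"
  by (simp add: cop_def case_prod_unfold sum_list_addf)

lemma cop_cmult: "cop x (\<lambda>u v. c * f u v) = c * cop x f"
  by (simp add: cop_def case_prod_unfold sum_list_const_mult)

lemma cop_multc: "cop x (\<lambda>u v. f u v * c) = cop x f * c"
  by (simp add: cop_def case_prod_unfold sum_list_mult_const)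

lemma cop_zero [simp]: "cop x (\<lambda>u v. 0) = 0"
  using cop_cmult[of x 0] by simp

lemma cop_sum: "cop x (\<lambda>u v. \<Sum>i\<in>I. f i u v) = (\<Sum>i\<in>I. cop x (f i))"
  by (induction I rule: infinite_finite_induct) (simp_all add: cop_add)

lemma cop_cnj: "cnj (cop x f) = cop x (\<lambda>u v. cnj (f u v))"
  by (induction x arbitrary: f rule: list.induct) (simp, rename_tac g x f, case_tac g, simp_all)

lemma cop_append: "cop (x @ y) f = cop x (\<lambda>u v. cop y (\<lambda>u' v'. f (u @ u') (v @ v')))"
proof (induction x arbitrary: f)
  case (Cons g x)
  then show ?case by (cases g) simp_all
qed simp

lemma cop_coassoc:
  "cop x (\<lambda>u v. cop u (\<lambda>u1 u2. f u1 u2 v)) = cop x (\<lambda>u v. cop v (\<lambda>v1 v2. f u v1 v2))"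
proof (induction x arbitrary: f)
  case (Cons g x)
  show ?case
    by (cases g) (simp_all add: Cons cop_add)
qed simp

lemma dual_mult_cop: "dual_mult a b x = cop x (\<lambda>u v. a u * b v)"
  by (simp add: dual_mult_def cop_def)

lemma dual_mult_assoc: "dual_mult (dual_mult a b) c = dual_mult a (dual_mult b c)"
proof
  fix x
  show "dual_mult (dual_mult a b) c x = dual_mult a (dual_mult b c) x"
    using cop_coassoc[of x "\<lambda>u v w. a u * b v * c w"]
    by (simp add: dual_mult_cop mult.assoc flip: cop_multc cop_cmult)
qed

lemma dual_mult_add_left: "dual_mult (dual_add a b) c = dual_add (dual_mult a c) (dual_mult b c)"
  by (simp add: fun_eq_iff dual_mult_cop dual_add_def distrib_right cop_add)

lemma dual_mult_add_right: "dual_mult a (dual_add b c) = dual_add (dual_mult a b) (dual_mult a c)"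
  by (simp add: fun_eq_iff dual_mult_cop dual_add_def distrib_left cop_add)

lemma dual_mult_scale_left: "dual_mult (dual_scale c a) b = dual_scale c (dual_mult a b)"
  by (simp add: fun_eq_iff dual_mult_cop dual_scale_def mult.assoc cop_cmult)

lemma dual_mult_scale_right: "dual_mult a (dual_scale c b) = dual_scale c (dual_mult a b)"
  by (simp add: fun_eq_iff dual_mult_cop dual_scale_def mult.left_commute cop_cmult)

lemma dual_mult_zero_right: "dual_mult a (\<lambda>x. 0) = (\<lambda>x. 0)"
  by (simp add: fun_eq_iff dual_mult_cop)

lemma dual_mult_zero_left: "dual_mult (\<lambda>x. 0) a = (\<lambda>x. 0)"
  by (simp add: fun_eq_iff dual_mult_cop)

lemma counit_Cons [simp]: "counit [] = 1" "counit (g # x) = counit_gen g * counit x"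
  by (simp_all add: counit_def)

lemma dual_mult_counit_left: "dual_mult counit a = a"
proof -
  have "cop x (\<lambda>u v. counit u * f v) = f x" for x and f :: uq_functional
  proof (induction x arbitrary: f)
    case (Cons g x)
    show ?case by (cases g) (simp_all add: Cons[of "\<lambda>v. f (_ # v)"])
  qed simp
  then show ?thesis by (simp add: fun_eq_iff dual_mult_cop)
qed

subsection \<open>The involution\<close>

abbreviation flip_gen :: "uq_gen \<Rightarrow> uq_gen" where
  "flip_gen g \<equiv> star_gen (antipode_gen g)"

text \<open>Antipode and star both reverse words, so their composite acts letter by letter.\<close>

lemma star_antipode_word: "star_word (antipode_word x) = map flip_gen x"
  by (simp add: star_word_def antipode_word_def rev_map)

lemma dual_star_eq: "dual_star q a x = cnj (antipode_coeff q x * a (map flip_gen x))"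
  by (simp add: dual_star_def star_antipode_word)

lemma antipode_coeff_simps [simp]:
  "antipode_coeff q [] = 1"
  "antipode_coeff q (g # x) = of_real (antipode_coeff_gen q g) * antipode_coeff q x"
  by (simp_all add: antipode_coeff_def)

lemma cnj_antipode_coeff [simp]: "cnj (antipode_coeff q x) = antipode_coeff q x"
  by (simp add: antipode_coeff_def)

text \<open>The map sending x to the star of S(x) preserves the order of products but reverses the
  coproduct; this is why the dual involution is antimultiplicative.\<close>

lemma cop_map_flip: "cop (map flip_gen x) f = cop x (\<lambda>u v. f (map flip_gen v) (map flip_gen u))"
proof (induction x arbitrary: f)
  case (Cons g x)
  show ?case by (cases g) (simp_all add: Cons add.commute)
qed simp

text \<open>Each summand of the coproduct distributes the letters e and f of x over its two factors,
  and the letters k and k^-1 contribute 1. The two coefficients therefore always multiply to that of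
  x.\<close>

lemma cop_antipode_coeff:
  "cop x (\<lambda>u v. antipode_coeff q u * antipode_coeff q v * f u v) = antipode_coeff q x * cop x f"
proof (induction x arbitrary: f)
  case (Cons g x)
  have key: "cop x (\<lambda>u v. (k * antipode_coeff q u) * (k' * antipode_coeff q v) * f u v) =
      (k * k') * (antipode_coeff q x * cop x f)" for k k' f
  proof -
    have "cop x (\<lambda>u v. (k * antipode_coeff q u) * (k' * antipode_coeff q v) * f u v) =
        cop x (\<lambda>u v. (k * k') * (antipode_coeff q u * antipode_coeff q v * f u v))"
      by (simp add: mult_ac)
    then show ?thesis by (simp only: cop_cmult Cons)
  qed
  show ?case
    by (cases g) (simp_all only: cop_gen antipode_coeff_simps key, simp_all add: distrib_left mult.assoc)
qed simp

lemma dual_star_mult: "dual_star q (dual_mult a b) = dual_mult (dual_star q b) (dual_star q a)"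
proof
  fix x
  have "dual_star q (dual_mult a b) x =
      cnj (antipode_coeff q x * cop x (\<lambda>u v. a (map flip_gen v) * b (map flip_gen u)))"
    by (simp add: dual_star_eq dual_mult_cop cop_map_flip)
  also have "\<dots> = cnj (cop x (\<lambda>u v. antipode_coeff q u * antipode_coeff q v *
      (a (map flip_gen v) * b (map flip_gen u))))"
    by (simp only: cop_antipode_coeff)
  also have "\<dots> = dual_mult (dual_star q b) (dual_star q a) x"
    unfolding cop_cnj dual_mult_cop dual_star_eq
    by (rule arg_cong[where f="cop x"]) (simp add: fun_eq_iff mult_ac)
  finally show "dual_star q (dual_mult a b) x = dual_mult (dual_star q b) (dual_star q a) x" .
qed

lemma dual_star_add: "dual_star q (dual_add a b) = dual_add (dual_star q a) (dual_star q b)"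
  by (simp add: fun_eq_iff dual_star_eq dual_add_def distrib_left)

lemma dual_star_scale: "dual_star q (dual_scale c a) = dual_scale (cnj c) (dual_star q a)"
  by (simp add: fun_eq_iff dual_star_eq dual_scale_def mult_ac)

text \<open>\<open>S(x') x'' = \<epsilon>(x)\<close>.\<close>

lemma cop_antipode:
  assumes a: "respects_relations q a" and q: "q > 0"
  shows "cop x (\<lambda>u v. antipode_coeff q u * a (antipode_word u @ v)) = counit x * a []"
proof -
  have r: "a (u @ Uk # Uki # v) = a (u @ v)" "a (u @ Uki # Uk # v) = a (u @ v)"
    "a (u @ Uk # Ue # Uki # v) = of_real q * a (u @ Ue # v)"
    "a (u @ Uk # Uf # Uki # v) = of_real (inverse q) * a (u @ Uf # v)" for u v
    using a unfolding respects_relations_def by simp_all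
  \<comment> \<open>The relations for k e k^-1 and k f k^-1, multiplied by k on the right.\<close>
  have ke: "a (u @ Uk # Ue # v) = of_real q * a (u @ Ue # Uk # v)"
    "a (u @ Uk # Uf # v) = of_real (inverse q) * a (u @ Uf # Uk # v)" for u v
    using r(3)[of u "Uk # v"] r(4)[of u "Uk # v"] r(2)[of "u @ [Uk, Ue]" v] r(2)[of "u @ [Uk, Uf]" v]
    by simp_all
  show ?thesis
  proof (induction x)
    case (Cons g x)
    have S: "antipode_word (g # u) = antipode_word u @ [antipode_gen g]" for g u
      by (simp add: antipode_word_def)
    show ?case
    proof (cases g)
      case Ue
      \<comment> \<open>The two summands of the coproduct of e contribute -q e k and k e = q e k,
        which cancel, as the counit of e demands.\<close>
      have "cop x (\<lambda>u v. - (of_real q * antipode_coeff q u * a (antipode_word u @ Ue # Uk # v))) +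
          cop x (\<lambda>u v. antipode_coeff q u * (of_real q * a (antipode_word u @ Ue # Uk # v))) = 0"
        unfolding cop_add[symmetric] by simp
      then show ?thesis by (simp add: Ue S ke)
    next
      case Uf
      have "cop x (\<lambda>u v. - (antipode_coeff q u * a (antipode_word u @ Uf # Uk # v) / of_real q)) +
          cop x (\<lambda>u v. antipode_coeff q u * a (antipode_word u @ Uf # Uk # v) / of_real q) = 0"
        unfolding cop_add[symmetric] by simp
      then show ?thesis by (simp add: Uf S ke divide_inverse mult_ac)
    qed (use Cons in \<open>simp_all add: S r\<close>)
  qed (simp add: antipode_word_def)
qed

section \<open>Matrix elements: q-integers, ladder coefficients, unitarity\<close>

section \<open>Matrix elements\<close>

subsection \<open>Weights and $q$-integers\<close>

lemma weights_iff: "n \<in> weights l \<longleftrightarrow> n + l \<in> \<int> \<and> - l \<le> n \<and> n \<le> l"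
proof
  assume "n + l \<in> \<int> \<and> - l \<le> n \<and> n \<le> l"
  then have "n + l \<in> \<nat>" "n \<le> l" by (auto simp: Nats_altdef2)
  then obtain k :: nat where "n + l = real k" by (auto simp: Nats_def)
  with \<open>n \<le> l\<close> show "n \<in> weights l"
    by (auto simp: weights_def intro!: exI[of _ k])
qed (auto simp: weights_def)

lemma weights_half [simp]: "weights (1/2) = {-1/2, 1/2}"
proof -
  have "k = 0 \<or> k = 1" if "real k \<le> 1" for k :: nat
    using that by linarith
  then show ?thesis
    by (fastforce simp: weights_def intro: exI[of _ "0::nat"] exI[of _ "1::nat"])
qed

lemma half_nats_Ints: "l \<in> half_nats \<Longrightarrow> 2 * l \<in> \<int>" and half_nats_ge: "l \<in> half_nats \<Longrightarrow> l \<ge> 0"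
  by (auto simp: half_nats_def)

lemma weights_add_half:
  assumes n: "n \<in> weights l" and s: "s \<in> weights (1/2)"
  shows "n + s \<in> weights (l + 1/2)"
proof -
  have s: "s = -1/2 \<or> s = 1/2"
    using s unfolding weights_half by simp
  have "(n + l) + (s + 1/2) \<in> \<int>"
  proof (rule Ints_add)
    have "s + 1/2 = 0 \<or> s + 1/2 = 1" using s by auto
    then show "s + 1/2 \<in> \<int>" by (metis Ints_0 Ints_1)
  qed (use n in \<open>simp add: weights_iff\<close>)
  moreover have "(n + l) + (s + 1/2) = n + s + (l + 1/2)"
    by simp
  ultimately show ?thesis
    using n s by (auto simp: weights_iff)
qed

lemma Ints_cases_lt: "x \<in> \<int> \<Longrightarrow> y \<in> \<int> \<Longrightarrow> x < y \<Longrightarrow> x + 1 \<le> (y::real)"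
  by (auto elim!: Ints_cases)

lemma weights_uminus:
  assumes "l \<in> half_nats"
  shows "- n \<in> weights l \<longleftrightarrow> n \<in> weights l"
proof -
  have "- n + l \<in> \<int> \<longleftrightarrow> n + l \<in> \<int>"
  proof -
    have "- n + l = 2 * l - (n + l)" "n + l = 2 * l - (- n + l)" by simp_all
    then show ?thesis using half_nats_Ints[OF assms] Ints_diff by metis
  qed
  then show ?thesis by (auto simp: weights_iff)
qed

lemma weights_pred: "n \<in> weights l \<Longrightarrow> n - 1 \<notin> weights l \<Longrightarrow> n = - l"
proof (rule ccontr)
  assume n: "n \<in> weights l" "n - 1 \<notin> weights l" "n \<noteq> - l"
  then have "0 + 1 \<le> n + l" by (intro Ints_cases_lt) (auto simp: weights_iff)
  moreover have "n - 1 + l \<in> \<int>"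
    using Ints_diff[of "n + l" 1] n(1) by (simp add: weights_iff algebra_simps)
  ultimately show False using n by (auto simp: weights_iff)
qed

lemma weights_succ:
  assumes l: "l \<in> half_nats" and n: "n \<in> weights l" "n + 1 \<notin> weights l"
  shows "n = l"
  using weights_pred[of "- n" l] weights_uminus[OF l, of n] weights_uminus[OF l, of "n + 1"] n by simp

lemma qint_0 [simp]: "qint q 0 = 0"
  by (simp add: qint_def)

lemma q_diff_nonzero: "q > 0 \<Longrightarrow> q \<noteq> 1 \<Longrightarrow> q - inverse q \<noteq> 0" for q :: real
  by (auto simp: field_simps) (metis abs_of_pos abs_square_eq_1 power2_eq_square)

text \<open>The twisted addition rule to which the normalisation of the Clebsch-Gordan coefficients,
  their recursions and the growth of q-integers all reduce.\<close>

lemma qint_add: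
  assumes "q > 0"
  shows "qint q (a + b) = q powr b * qint q a + q powr (- a) * qint q b"
proof -
  have "q powr (a + b) = q powr a * q powr b" "q powr (- (a + b)) = q powr (- a) * q powr (- b)"
    by (simp_all add: powr_add[symmetric])
  then show ?thesis
    unfolding qint_def by (simp only: times_divide_eq_right add_divide_distrib[symmetric]) (simp add: algebra_simps)
qed

lemma qint_one [simp]: "q > 0 \<Longrightarrow> q \<noteq> 1 \<Longrightarrow> qint q 1 = 1"
  using q_diff_nonzero by (simp add: qint_def powr_minus)

lemma qint_inverse: "q > 0 \<Longrightarrow> q \<noteq> 1 \<Longrightarrow> qint (inverse q) x = qint q x"
proof -
  assume "q > 0" "q \<noteq> 1"
  then have "qint (inverse q) x = (q powr (- x) - q powr x) / (inverse q - q)"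
    by (simp add: qint_def powr_minus inverse_powr)
  also have "\<dots> = qint q x"
    unfolding qint_def by (metis minus_diff_eq minus_divide_divide)
  finally show ?thesis .
qed

lemma qint_pos:
  assumes q: "q > 0" "q \<noteq> 1" and "x > 0"
  shows "qint q x > 0"
proof (cases "q > 1")
  case True
  then have "q powr (- x) < q powr x" "inverse q < 1"
    using assms by (auto intro: powr_less_mono simp: inverse_less_1_iff)
  then show ?thesis using True by (simp add: qint_def)
next
  case False
  then have "q < 1" using q by simp
  then have "q powr x < q powr (- x)" "1 < inverse q"
    using assms by (auto intro!: powr_less_mono' simp: one_less_inverse_iff)
  then show ?thesis using \<open>q < 1\<close> by (simp add: qint_def divide_neg_neg)
qed

subsection \<open>Ladder operators\<close>

text \<open>The matrix entry of e from weight m to m + 1 and of f back. It vanishes at both ends of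
  the weight chain, which disposes of the boundary cases below.\<close>

definition ladder :: "real \<Rightarrow> real \<Rightarrow> real \<Rightarrow> real" where
  "ladder q l m = sqrt (qint q (l - m) * qint q (l + m + 1))"

lemma ladder_bottom [simp]: "ladder q l (- l - 1) = 0" "ladder q l l = 0"
  by (simp_all add: ladder_def)

lemma ladder_uminus: "ladder q l (- n - 1) = ladder q l n"
  by (simp add: ladder_def algebra_simps)

lemma ladder_half [simp]: "q > 0 \<Longrightarrow> q \<noteq> 1 \<Longrightarrow> ladder q (1/2) (-1/2) = 1"
  by (simp add: ladder_def)

lemma ladder_inverse: "q > 0 \<Longrightarrow> q \<noteq> 1 \<Longrightarrow> ladder (inverse q) l m = ladder q l m"
  by (simp add: ladder_def qint_inverse)

lemma rep_gen_ladder: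
  "rep_gen q l Ue n p = (if p = n - 1 then of_real (ladder q l (n - 1)) else 0)"
  "rep_gen q l Uf n p = (if p = n + 1 then of_real (ladder q l n) else 0)"
proof -
  have "l - (n - 1) = l - n + 1" "l + (n - 1) + 1 = l + n" "l - (n + 1) + 1 = l - n" "l + (n + 1) = l + n + 1"
    by simp_all
  then show "rep_gen q l Ue n p = (if p = n - 1 then of_real (ladder q l (n - 1)) else 0)"
    "rep_gen q l Uf n p = (if p = n + 1 then of_real (ladder q l n) else 0)"
    by (auto simp: ladder_def add.assoc)
qed

lemma rep_gen_ladder':
  "rep_gen q l Ue p m = (if p = m + 1 then of_real (ladder q l m) else 0)"
  "rep_gen q l Uf p m = (if p = m - 1 then of_real (ladder q l (m - 1)) else 0)"
  unfolding rep_gen_ladder by auto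

text \<open>Values of \<open>rep\<close> at indices that are not weights are multiplied by zero here and below.\<close>

lemma rep_Cons_gen:
  assumes n: "n \<in> weights l"
  shows "rep q l (Uk # x) n m = of_real (q powr n) * rep q l x n m"
    "rep q l (Uki # x) n m = of_real (q powr (- n)) * rep q l x n m"
    "rep q l (Ue # x) n m = of_real (ladder q l (n - 1)) * rep q l x (n - 1) m"
    "l \<in> half_nats \<Longrightarrow> rep q l (Uf # x) n m = of_real (ladder q l n) * rep q l x (n + 1) m"
proof -
  show "rep q l (Uk # x) n m = of_real (q powr n) * rep q l x n m"
    "rep q l (Uki # x) n m = of_real (q powr (- n)) * rep q l x n m"
    using n by (simp_all add: if_distrib[of "\<lambda>c. c * _"] cong: if_cong)
  have "rep q l (Ue # x) n m =
      (\<Sum>p\<in>weights l. if p = n - 1 then of_real (ladder q l (n - 1)) * rep q l x (n - 1) m else 0)"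
    unfolding rep.simps rep_gen_ladder by (intro sum.cong refl) auto
  then show "rep q l (Ue # x) n m = of_real (ladder q l (n - 1)) * rep q l x (n - 1) m"
    using weights_pred[OF n] by (auto simp: ladder_bottom)
  assume l: "l \<in> half_nats"
  have "rep q l (Uf # x) n m =
      (\<Sum>p\<in>weights l. if p = n + 1 then of_real (ladder q l n) * rep q l x (n + 1) m else 0)"
    unfolding rep.simps rep_gen_ladder by (intro sum.cong refl) auto
  then show "rep q l (Uf # x) n m = of_real (ladder q l n) * rep q l x (n + 1) m"
    using weights_succ[OF l n] by (auto simp: ladder_bottom)
qed

lemma rep_snoc_gen:
  assumes n: "n \<in> weights l" and m: "m \<in> weights l"
  shows "rep q l (x @ [Uk]) n m = of_real (q powr m) * rep q l x n m"
    "rep q l (x @ [Uki]) n m = of_real (q powr (- m)) * rep q l x n m"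
    "l \<in> half_nats \<Longrightarrow> rep q l (x @ [Ue]) n m = of_real (ladder q l m) * rep q l x n (m + 1)"
    "rep q l (x @ [Uf]) n m = of_real (ladder q l (m - 1)) * rep q l x n (m - 1)"
proof -
  have gen: "rep q l [g] p m = rep_gen q l g p m" for g p
    using m by (simp add: if_distrib[of "\<lambda>c. _ * c"] cong: if_cong)
  show "rep q l (x @ [Uk]) n m = of_real (q powr m) * rep q l x n m"
    "rep q l (x @ [Uki]) n m = of_real (q powr (- m)) * rep q l x n m"
    unfolding rep_append[OF n] gen using m by (simp_all add: if_distrib[of "\<lambda>c. _ * c"] cong: if_cong)
  have "rep q l (x @ [Uf]) n m =
      (\<Sum>p\<in>weights l. if p = m - 1 then of_real (ladder q l (m - 1)) * rep q l x n (m - 1) else 0)"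
    unfolding rep_append[OF n] gen rep_gen_ladder' by (intro sum.cong refl) auto
  then show "rep q l (x @ [Uf]) n m = of_real (ladder q l (m - 1)) * rep q l x n (m - 1)"
    using weights_pred[OF m] by (auto simp: ladder_bottom)
  assume l: "l \<in> half_nats"
  have "rep q l (x @ [Ue]) n m =
      (\<Sum>p\<in>weights l. if p = m + 1 then of_real (ladder q l m) * rep q l x n (m + 1) else 0)"
    unfolding rep_append[OF n] gen rep_gen_ladder' by (intro sum.cong refl) auto
  then show "rep q l (x @ [Ue]) n m = of_real (ladder q l m) * rep q l x n (m + 1)"
    using weights_succ[OF l m] by (auto simp: ladder_bottom)
qed

lemma cnj_rep: "cnj (rep q l x n m) = rep q l x n m"
proof -
  have gen: "cnj (rep_gen q l g n p) = rep_gen q l g n p" for g n p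
    by (cases g) auto
  show ?thesis
    by (induction x arbitrary: n) (simp_all add: gen)
qed

lemma rep_star:
  assumes l: "l \<in> half_nats" and "n \<in> weights l" "m \<in> weights l"
  shows "rep q l (star_word x) n m = rep q l x m n"
  using assms(2,3)
proof (induction x arbitrary: m)
  case (Cons g x)
  have star: "star_word (g # x) = star_word x @ [star_gen g]" for g
    by (simp add: star_word_def)
  show ?case
  proof (cases g)
    case Ue
    have "m - 1 \<in> weights l \<or> ladder q l (m - 1) = 0"
      using weights_pred[OF Cons.prems(2)] ladder_bottom(1)[of q l] by metis
    then show ?thesis
      using Cons l by (auto simp: star Ue rep_snoc_gen rep_Cons_gen simp del: rep.simps)
  next
    case Uf
    have "m + 1 \<in> weights l \<or> ladder q l m = 0"
      using weights_succ[OF l Cons.prems(2)] ladder_bottom(2)[of q l] by metis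
    then show ?thesis
      using Cons l by (auto simp: star Uf rep_snoc_gen rep_Cons_gen simp del: rep.simps)
  qed (use Cons in \<open>simp_all add: star rep_snoc_gen rep_Cons_gen del: rep.simps\<close>)
qed (auto simp: star_word_def)

text \<open>The star of t_nm is S(t_mn), so the sum is S(x') x'' = \<epsilon>(x) evaluated under
  t_mm': the columns of the matrix (t_nm) are orthonormal over the algebra. This gives both the
  nonvanishing of the Haar norms and the boundedness of left multiplication.\<close>

lemma sum_star_mult_matrix_element:
  assumes q: "q > 0" "q \<noteq> 1" and l: "l \<in> half_nats" and m: "m \<in> weights l" "m' \<in> weights l"
  shows "(\<Sum>n\<in>weights l. dual_mult (dual_star q (matrix_element q l n m)) (matrix_element q l n m') x) =
    (if m = m' then counit x else 0)"
proof -
  have "(\<Sum>n\<in>weights l. dual_star q (matrix_element q l n m) u * matrix_element q l n m' v) =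
      antipode_coeff q u * matrix_element q l m m' (antipode_word u @ v)" for u v
  proof -
    have "(\<Sum>n\<in>weights l. dual_star q (matrix_element q l n m) u * matrix_element q l n m' v) =
        (\<Sum>n\<in>weights l. antipode_coeff q u * (rep q l (antipode_word u) m n * rep q l v n m'))"
      using m by (intro sum.cong refl)
        (simp add: dual_star_eq matrix_element_def cnj_rep rep_star[OF l] flip: star_antipode_word)
    also have "\<dots> = antipode_coeff q u * matrix_element q l m m' (antipode_word u @ v)"
      unfolding matrix_element_def rep_append[OF m(1)] by (rule sum_distrib_left[symmetric])
    finally show ?thesis .
  qed
  then show ?thesis
    using cop_antipode[OF respects_relations_matrix_element[OF q l m(1), of m'] q(1), of x]
    unfolding dual_mult_cop cop_sum[symmetric] by (simp add: matrix_element_def)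
qed

text \<open>The diagonal rescaling that identifies V_l with its dual. For a weight n the number n +
  l is a natural number, so the floor only changes the type.\<close>

definition star_phase :: "real \<Rightarrow> real \<Rightarrow> real \<Rightarrow> real" where
  "star_phase q l n = (- 1) ^ nat \<lfloor>n + l\<rfloor> * q powr (- n)"

lemma star_phase_nonzero: "q > 0 \<Longrightarrow> star_phase q l n \<noteq> 0"
  by (simp add: star_phase_def)

lemma star_phase_step:
  assumes "q > 0" "n \<in> weights l"
  shows "star_phase q l (n + 1) = - star_phase q l n / q"
proof -
  obtain k :: nat where k: "n = real k - l"
    using assms by (auto simp: weights_def)
  have "nat \<lfloor>n + 1 + l\<rfloor> = Suc k" "nat \<lfloor>n + l\<rfloor> = k"
    using k by (auto simp: floor_eq_iff nat_eq_iff)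
  moreover have "q powr (- (n + 1)) = q powr (- n) / q"
    using assms(1) by (simp add: powr_diff)
  ultimately show ?thesis
    by (simp add: star_phase_def)
qed

text \<open>V_l is self-dual: \<open>flip_gen\<close> exchanges e with f and k with k^-1, hence n
  with -n, and the step rule of the phases absorbs the antipode coefficients -q and -1/q.\<close>

lemma dual_star_matrix_element:
  assumes q: "q > 0" and l: "l \<in> half_nats" and n: "n \<in> weights l" and m: "m \<in> weights l"
  shows "dual_star q (matrix_element q l n m) =
    dual_scale (of_real (star_phase q l n / star_phase q l m)) (matrix_element q l (- n) (- m))"
proof -
  note ph = star_phase_nonzero[OF q, of l]
  have neg: "n \<in> weights l \<Longrightarrow> - n \<in> weights l" for n
    using weights_uminus[OF l] by simp
  have "antipode_coeff q x * rep q l (map flip_gen x) n m =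
      of_real (star_phase q l n / star_phase q l m) * rep q l x (- n) (- m)" for x
    using n
  proof (induction x arbitrary: n)
    case Nil
    then show ?case using ph by auto
  next
    case (Cons g x)
    note n = Cons.prems
    show ?case
    proof (cases g)
      case Uk
      have "antipode_coeff q (g # x) * rep q l (map flip_gen (g # x)) n m =
          of_real (q powr (- n)) * (antipode_coeff q x * rep q l (map flip_gen x) n m)"
        using n by (simp add: Uk rep_Cons_gen del: rep.simps)
      then show ?thesis
        unfolding Cons.IH[OF n] using neg[OF n] by (simp add: Uk rep_Cons_gen del: rep.simps)
    next
      case Uki
      have "antipode_coeff q (g # x) * rep q l (map flip_gen (g # x)) n m =
          of_real (q powr n) * (antipode_coeff q x * rep q l (map flip_gen x) n m)"
        using n by (simp add: Uki rep_Cons_gen del: rep.simps)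
      then show ?thesis
        unfolding Cons.IH[OF n] using neg[OF n] by (simp add: Uki rep_Cons_gen del: rep.simps)
    next
      case Ue
      have *: "of_real (star_phase q l (n + 1)) = - complex_of_real (star_phase q l n) / of_real q"
        using star_phase_step[OF q n] by simp
      show ?thesis
      proof (cases "n + 1 \<in> weights l")
        case True
        have "antipode_coeff q (g # x) * rep q l (map flip_gen (g # x)) n m =
            - of_real q * of_real (ladder q l n) * (antipode_coeff q x * rep q l (map flip_gen x) (n + 1) m)"
          using n l by (simp add: Ue rep_Cons_gen mult_ac del: rep.simps)
        also have "\<dots> = of_real (ladder q l n) * (of_real (star_phase q l n / star_phase q l m) * rep q l x (- n - 1) (- m))"
        proof -
          define R where "R = rep q l x (- n - 1) (- m)"
          have R: "rep q l x (- (n + 1)) (- m) = R" by (simp add: R_def)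
          show ?thesis
            unfolding Cons.IH[OF True] of_real_divide * R R_def[symmetric] using q by simp
        qed
        finally show ?thesis
          using neg[OF n] by (simp add: Ue rep_Cons_gen ladder_uminus mult_ac del: rep.simps)
      next
        case False
        then have "n = l" using weights_succ[OF l n] by simp
        then show ?thesis
          using n l neg[OF n] by (simp add: Ue rep_Cons_gen ladder_uminus del: rep.simps)
      qed
    next
      case Uf
      show ?thesis
      proof (cases "n - 1 \<in> weights l")
        case True
        have *: "complex_of_real (star_phase q l n) = - of_real (star_phase q l (n - 1)) / of_real q"
          using star_phase_step[OF q True] by simp
        have "antipode_coeff q (g # x) * rep q l (map flip_gen (g # x)) n m =
            - of_real (inverse q) * of_real (ladder q l (n - 1)) * (antipode_coeff q x * rep q l (map flip_gen x) (n - 1) m)"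
          using n by (simp add: Uf rep_Cons_gen mult_ac del: rep.simps)
        also have "\<dots> = of_real (ladder q l (n - 1)) * (of_real (star_phase q l n / star_phase q l m) * rep q l x (- n + 1) (- m))"
        proof -
          define R where "R = rep q l x (- n + 1) (- m)"
          have R: "rep q l x (- (n - 1)) (- m) = R" by (simp add: R_def)
          show ?thesis
            unfolding Cons.IH[OF True] of_real_divide * R R_def[symmetric] using q by (simp add: divide_inverse mult_ac)
        qed
        finally show ?thesis
          using neg[OF n] l ladder_uminus[of q l "n - 1"] by (simp add: Uf rep_Cons_gen mult_ac del: rep.simps)
      next
        case False
        then have "n = - l" using weights_pred[OF n] by simp
        then show ?thesis
          using n l neg[OF n] by (simp add: Uf rep_Cons_gen del: rep.simps)
      qed
    qed
  qed
  then show ?thesis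
    by (simp add: fun_eq_iff dual_star_eq dual_scale_def matrix_element_def cnj_rep)
qed

section \<open>Coupling with spin one half and products of matrix elements\<close>

subsection \<open>Clebsch-Gordan coefficients for spin one half\<close>

text \<open>In \<open>V_l \<otimes> V_1/2\<close> the vector of weight \<open>M\<close> and spin \<open>spin up l\<close> is
  \<open>\<Sum>s. cg q up l M s |l,M-s\<rangle> \<otimes> |1/2,s\<rangle>\<close>; for \<open>V_1/2 \<otimes> V_l\<close>, replace \<open>q\<close> by \<open>q\<^sup>-\<^sup>1\<close>.
  With \<open>a = l+M+1/2\<close> and \<open>b = l-M+1/2\<close> the coefficients are \<open>cgA q a b\<close> and \<open>cgB q a b\<close>.\<close>

definition cgA :: "real \<Rightarrow> real \<Rightarrow> real \<Rightarrow> real" where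
  "cgA q a b = q powr (b/2) * sqrt (qint q a) / sqrt (qint q (a + b))"

definition cgB :: "real \<Rightarrow> real \<Rightarrow> real \<Rightarrow> real" where
  "cgB q a b = q powr (- (a/2)) * sqrt (qint q b) / sqrt (qint q (a + b))"

definition cg :: "real \<Rightarrow> bool \<Rightarrow> real \<Rightarrow> real \<Rightarrow> real \<Rightarrow> real" where
  "cg q up l M s =
     (if up then (if s > 0 then cgA q (l + M + 1/2) (l - M + 1/2) else cgB q (l + M + 1/2) (l - M + 1/2))
      else (if s > 0 then - cgB q (l + M + 1/2) (l - M + 1/2) else cgA q (l + M + 1/2) (l - M + 1/2)))"

definition spin :: "bool \<Rightarrow> real \<Rightarrow> real" where
  "spin up l = (if up then l + 1/2 else l - 1/2)"

lemma cgA_cgB_square: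
  assumes q: "q > 0" "q \<noteq> 1" and "a \<ge> 0" "b \<ge> 0" "a + b > 0"
  shows "cgA q a b * cgA q a b + cgB q a b * cgB q a b = 1"
proof -
  have pos: "qint q (a + b) > 0" "qint q a \<ge> 0" "qint q b \<ge> 0"
    using assms qint_pos qint_nonneg by auto
  have p: "q powr (b/2) * q powr (b/2) = q powr b" "q powr (- (a/2)) * q powr (- (a/2)) = q powr (- a)"
    by (simp_all add: powr_add[symmetric])
  have "cgA q a b * cgA q a b = (q powr (b/2) * q powr (b/2)) * (sqrt (qint q a) * sqrt (qint q a)) /
      (sqrt (qint q (a + b)) * sqrt (qint q (a + b)))"
    by (simp add: cgA_def)
  then have A: "cgA q a b * cgA q a b = q powr b * qint q a / qint q (a + b)"
    using pos by (simp only: p real_sqrt_mult_self abs_of_nonneg less_imp_le)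
  have "cgB q a b * cgB q a b = (q powr (- (a/2)) * q powr (- (a/2))) * (sqrt (qint q b) * sqrt (qint q b)) /
      (sqrt (qint q (a + b)) * sqrt (qint q (a + b)))"
    by (simp add: cgB_def)
  then have B: "cgB q a b * cgB q a b = q powr (- a) * qint q b / qint q (a + b)"
    using pos by (simp only: p real_sqrt_mult_self abs_of_nonneg less_imp_le)
  show ?thesis
    unfolding A B add_divide_distrib[symmetric] using qint_add[OF q(1), of a b] pos by simp
qed

text \<open>The action of e on coupled vectors. The first and third identities belong to s = 1/2,
  where both coproduct terms of e contribute, the other two to s = -1/2; the first two are for spin
  l + 1/2, the last two for l - 1/2. Once the common denominator is cancelled, each is a comparison
  of powers of q, with \<open>qint_add\<close> combining the two terms.\<close>

lemma cg_step_aux: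
  assumes q: "q > 0" "q \<noteq> 1"
  shows "a \<ge> 0 \<Longrightarrow> q powr (1/2) * (sqrt (qint q b) * sqrt (qint q a)) * cgA q a b + q powr ((b - a - 1)/2) * cgB q a b =
      sqrt (qint q b) * sqrt (qint q (a + 1)) * cgA q (a + 1) (b - 1)" (is "_ \<Longrightarrow> ?E1")
    and "q powr (- (1/2)) * (sqrt (qint q (b - 1)) * sqrt (qint q (a + 1))) * cgB q a b =
      sqrt (qint q b) * sqrt (qint q (a + 1)) * cgB q (a + 1) (b - 1)" (is ?E2)
    and "b \<ge> 1 \<Longrightarrow> - (q powr (1/2) * (sqrt (qint q b) * sqrt (qint q a)) * cgB q a b) + q powr ((b - a - 1)/2) * cgA q a b =
      - (sqrt (qint q (b - 1)) * sqrt (qint q a) * cgB q (a + 1) (b - 1))" (is "_ \<Longrightarrow> ?E3")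
    and "q powr (- (1/2)) * (sqrt (qint q (b - 1)) * sqrt (qint q (a + 1))) * cgA q a b =
      sqrt (qint q (b - 1)) * sqrt (qint q a) * cgA q (a + 1) (b - 1)" (is ?E4)
proof -
  have ab: "(a + 1) + (b - 1) = a + b" by simp
  define D where "D = inverse (sqrt (qint q (a + b)))"
  have e: "cgA q a b = q powr (b/2) * sqrt (qint q a) * D" "cgB q a b = q powr (- (a/2)) * sqrt (qint q b) * D"
    "cgA q (a + 1) (b - 1) = q powr ((b - 1)/2) * sqrt (qint q (a + 1)) * D"
    "cgB q (a + 1) (b - 1) = q powr (- ((a + 1)/2)) * sqrt (qint q (b - 1)) * D"
    by (simp_all only: cgA_def cgB_def ab D_def divide_inverse)
  have p: "q powr (1/2) * q powr (b/2) = q powr ((b - 1)/2) * q"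
    "q powr ((b - a - 1)/2) * q powr (- (a/2)) = q powr ((b - 1)/2) * q powr (- a)"
    "q powr (- (1/2)) * q powr (- (a/2)) = q powr (- ((a + 1)/2))"
    "q powr (1/2) * q powr (- (a/2)) = q powr (- ((a + 1)/2)) * q"
    "q powr ((b - a - 1)/2) * q powr (b/2) = q powr (- ((a + 1)/2)) * q powr b"
    "q powr (- (1/2)) * q powr (b/2) = q powr ((b - 1)/2)"
  proof -
    have q1: "q powr x * q = q powr (x + 1)" for x
      using q by (simp add: powr_add)
    show "q powr (1/2) * q powr (b/2) = q powr ((b - 1)/2) * q"
      "q powr (1/2) * q powr (- (a/2)) = q powr (- ((a + 1)/2)) * q"
      unfolding q1 powr_add[symmetric] by (rule arg_cong[where f="\<lambda>x. q powr x"], simp add: field_simps)+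
  qed (unfold powr_add[symmetric], (rule arg_cong[where f="\<lambda>x. q powr x"], simp add: field_simps)+)
  show ?E1 if a: "a \<ge> 0"
  proof -
    have sq: "sqrt (qint q a) * sqrt (qint q a) = qint q a" "sqrt (qint q (a + 1)) * sqrt (qint q (a + 1)) = qint q (a + 1)"
      using qint_nonneg[OF q(1)] a by simp_all
    have "q powr (1/2) * (sqrt (qint q b) * sqrt (qint q a)) * cgA q a b + q powr ((b - a - 1)/2) * cgB q a b =
      sqrt (qint q b) * D * ((q powr (1/2) * q powr (b/2)) * (sqrt (qint q a) * sqrt (qint q a)) +
        q powr ((b - a - 1)/2) * q powr (- (a/2)))"
      unfolding e by (simp only: distrib_left mult_ac)
    also have "\<dots> = sqrt (qint q b) * D * (q powr ((b - 1)/2) * qint q (a + 1))"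
      unfolding p sq using qint_add[OF q(1), of a 1] q by (simp add: algebra_simps)
    also have "\<dots> = sqrt (qint q b) * D * (q powr ((b - 1)/2) * (sqrt (qint q (a + 1)) * sqrt (qint q (a + 1))))"
      unfolding sq ..
    also have "\<dots> = sqrt (qint q b) * sqrt (qint q (a + 1)) * cgA q (a + 1) (b - 1)"
      unfolding e by (simp only: mult_ac)
    finally show ?thesis .
  qed
  show ?E2 unfolding e p(3)[symmetric] by (simp only: mult_ac)
  show ?E4 unfolding e p(6)[symmetric] by (simp only: mult_ac)
  show ?E3 if b: "b \<ge> 1"
  proof -
    have sq: "sqrt (qint q b) * sqrt (qint q b) = qint q b" "sqrt (qint q (b - 1)) * sqrt (qint q (b - 1)) = qint q (b - 1)"
      using qint_nonneg[OF q(1)] b by simp_all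
    have "- (q powr (1/2) * (sqrt (qint q b) * sqrt (qint q a)) * cgB q a b) + q powr ((b - a - 1)/2) * cgA q a b =
      sqrt (qint q a) * D * (- ((q powr (1/2) * q powr (- (a/2))) * (sqrt (qint q b) * sqrt (qint q b))) +
        q powr ((b - a - 1)/2) * q powr (b/2))"
      unfolding e by (simp only: distrib_left mult_ac mult_minus_right)
    also have "\<dots> = sqrt (qint q a) * D * (q powr (- ((a + 1)/2)) * (- qint q (b - 1)))"
    proof -
      have "qint q b = qint q (1 + (b - 1))" by simp
      also have "\<dots> = q powr (b - 1) + inverse q * qint q (b - 1)"
        using qint_add[OF q(1), of 1 "b - 1"] q by (simp add: powr_minus)
      finally have "q * qint q b = q powr b + qint q (b - 1)"
        using q by (simp add: distrib_left powr_diff)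
      then have e1: "qint q (b - 1) = q * qint q b - q powr b" by simp
      show ?thesis unfolding p sq e1 by (simp add: algebra_simps)
    qed
    also have "\<dots> = sqrt (qint q a) * D * (q powr (- ((a + 1)/2)) * (- (sqrt (qint q (b - 1)) * sqrt (qint q (b - 1)))))"
      unfolding sq ..
    also have "\<dots> = - (sqrt (qint q (b - 1)) * sqrt (qint q a) * cgB q (a + 1) (b - 1))"
      unfolding e by (simp only: mult_ac mult_minus_right)
    finally show ?thesis .
  qed
qed

text \<open>Swapping the two basis vectors of \<open>V_1/2\<close> turns \<open>e\<close> into \<open>f\<close>.\<close>

lemma cgA_swap: "q > 0 \<Longrightarrow> q \<noteq> 1 \<Longrightarrow> cgA (inverse q) a b = cgB q b a"
  and cgB_swap: "q > 0 \<Longrightarrow> q \<noteq> 1 \<Longrightarrow> cgB (inverse q) a b = cgA q b a"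
  by (simp_all add: cgA_def cgB_def qint_inverse add.commute inverse_powr powr_minus)

lemma ladder_eq: "ladder q l m = sqrt (qint q (l - m)) * sqrt (qint q (l + m + 1))"
  by (simp add: ladder_def real_sqrt_mult)

text \<open>Read coefficientwise, e applied to a coupled vector is the ladder coefficient of
  \<open>spin up l\<close> times the next coupled vector.\<close>

lemma cg_raise:
  assumes q: "q > 0" "q \<noteq> 1" and n: "n \<in> weights l" and s: "s \<in> weights (1/2)"
  shows "q powr s * ladder q l (n - 1) * cg q up l (n + s - 1) s +
      q powr (- n) * ladder q (1/2) (s - 1) * cg q up l (n + s - 1) (s - 1) =
      ladder q (spin up l) (n + s - 1) * cg q up l (n + s) s"
proof -
  consider "s = 1/2" | "s = - (1/2)" using s by auto
  then show ?thesis
  proof cases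
    case 1
    define a b where "a = l + n" and "b = l - n + 1"
    have ab: "a \<ge> 0" "b \<ge> 1" using n by (auto simp: a_def b_def weights_iff)
    have r: "l - (n - 1) = b" "l + (n - 1) + 1 = a" "l + (n + 1/2 - 1) + 1/2 = a" "l - (n + 1/2 - 1) + 1/2 = b"
      "l + (n + 1/2) + 1/2 = a + 1" "l - (n + 1/2) + 1/2 = b - 1"
      "l + 1/2 - (n + 1/2 - 1) = b" "l + 1/2 + (n + 1/2 - 1) + 1 = a + 1"
      "l - 1/2 - (n + 1/2 - 1) = b - 1" "l - 1/2 + (n + 1/2 - 1) + 1 = a"
      by (simp_all add: a_def b_def)
    have m: "- n = (b - a - 1)/2" by (simp add: a_def b_def)
    have L: "ladder q (1/2) (1/2 - 1) = 1" using ladder_half[OF q] by simp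
    note L' = L[unfolded ladder_eq]
    have c: "(0::real) < 1/2 \<longleftrightarrow> True" "(0::real) < 1/2 - 1 \<longleftrightarrow> False" by simp_all
    show ?thesis
    proof (cases up)
      case True
      show ?thesis
        using cg_step_aux(1)[OF q ab(1), of b]
        by (simp only: 1 cg_def spin_def L' True if_True if_False c ladder_eq r m mult_1_right)
    next
      case False
      show ?thesis
        using cg_step_aux(3)[OF q ab(2), of a]
        by (simp only: 1 cg_def spin_def L' False if_True if_False c ladder_eq r m mult_1_right mult_minus_right)
    qed
  next
    case 2
    define a b where "a = l + n - 1" and "b = l - n + 2"
    have r: "l - (n - 1) = b - 1" "l + (n - 1) + 1 = a + 1" "l + (n + - (1/2) - 1) + 1/2 = a" "l - (n + - (1/2) - 1) + 1/2 = b"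
      "l + (n + - (1/2)) + 1/2 = a + 1" "l - (n + - (1/2)) + 1/2 = b - 1"
      "l + 1/2 - (n + - (1/2) - 1) = b" "l + 1/2 + (n + - (1/2) - 1) + 1 = a + 1"
      "l - 1/2 - (n + - (1/2) - 1) = b - 1" "l - 1/2 + (n + - (1/2) - 1) + 1 = a"
      by (simp_all add: a_def b_def)
    have L: "ladder q (1/2) (- (1/2) - 1) = 0" by (rule ladder_bottom)
    note L' = L[unfolded ladder_eq]
    have c: "(0::real) < - (1/2) \<longleftrightarrow> False" "(0::real) < - (1/2) - 1 \<longleftrightarrow> False" by simp_all
    show ?thesis
    proof (cases up)
      case True
      show ?thesis
        using cg_step_aux(2)[OF q, of b a]
        by (simp only: 2 cg_def spin_def L' True if_True if_False c ladder_eq r mult_zero_left mult_zero_right add_0_right)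
    next
      case False
      show ?thesis
        using cg_step_aux(4)[OF q, of b a]
        by (simp only: 2 cg_def spin_def L' False if_True if_False c ladder_eq r mult_zero_left mult_zero_right add_0_right)
    qed
  qed
qed

text \<open>Negating all weights and inverting q turns e into f, so the relation follows from
  \<open>cg_raise\<close> at \<open>inverse q\<close>.\<close>

lemma cg_lower:
  assumes q: "q > 0" "q \<noteq> 1" and l: "l \<in> half_nats" and n: "n \<in> weights l" and s: "s \<in> weights (1/2)"
  shows "q powr s * ladder q l n * cg q up l (n + s + 1) s +
      q powr (- n) * ladder q (1/2) s * cg q up l (n + s + 1) (s + 1) =
      ladder q (spin up l) (n + s) * cg q up l (n + s) s"
proof -
  define p where "p = inverse q"
  have p: "p > 0" "p \<noteq> 1" using q by (auto simp: p_def)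
  \<comment> \<open>The symmetry preserves the coupled vectors of spin l + 1/2 and changes the sign
    of those of spin l - 1/2.\<close>
  define \<sigma> where "\<sigma> = (if up then 1 else - 1 :: real)"
  have cg': "cg q up l M s = \<sigma> * cg p up l (- M) (- s)" if "s \<noteq> 0" for M s
    using that by (auto simp: cg_def \<sigma>_def p_def cgA_swap[OF q] cgB_swap[OF q] add.commute)
  have "- n \<in> weights l" "- s \<in> weights (1/2)" using weights_uminus[OF l] n s by auto
  from cg_raise[OF p this, of up]
  have "p powr (- s) * ladder q l (- n - 1) * cg p up l (- n + - s - 1) (- s) +
      p powr (- (- n)) * ladder q (1/2) (- s - 1) * cg p up l (- n + - s - 1) (- s - 1) =
      ladder q (spin up l) (- n + - s - 1) * cg p up l (- n + - s) (- s)"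
    by (simp add: p_def ladder_inverse[OF q])
  moreover have "- n + - s - 1 = - (n + s) - 1" "- n + - s = - (n + s)" "- (n + s) - 1 = - (n + s + 1)" "- s - 1 = - (s + 1)" by simp_all
  moreover have "p powr (- s) = q powr s" "p powr (- (- n)) = q powr (- n)"
    using q by (simp_all add: p_def inverse_powr powr_minus)
  ultimately have *: "q powr s * ladder q l n * cg p up l (- (n + s + 1)) (- s) +
      q powr (- n) * ladder q (1/2) s * cg p up l (- (n + s + 1)) (- (s + 1)) =
      ladder q (spin up l) (n + s) * cg p up l (- (n + s)) (- s)"
    using ladder_uminus[of q l n] ladder_uminus[of q "1/2" s] ladder_uminus[of q "spin up l" "n + s"] by metis
  have "s \<noteq> 0" "s + 1 \<noteq> 0" using s by auto
  then show ?thesis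
    unfolding cg'[OF \<open>s \<noteq> 0\<close>] cg'[OF \<open>s + 1 \<noteq> 0\<close>] using arg_cong[OF *, of "\<lambda>x. \<sigma> * x"]
    by (simp add: distrib_left mult_ac)
qed


text \<open>Only the extreme pairs n = l, s = 1/2 and n = -l, s = -1/2 leave the weights of spin l -
  1/2, and there the coefficient contains the root of [0].\<close>

lemma cg_nonweight:
  assumes l: "l \<in> half_nats" and n: "n \<in> weights l" and s: "s \<in> weights (1/2)" and nw: "n + s \<notin> weights (spin up l)"
  shows "cg q up l (n + s) s = 0"
proof -
  have up: "\<not> up"
    using weights_add_half[OF n s] nw by (auto simp: spin_def)
  have "n + s + (l - 1/2) \<in> \<int>"
  proof -
    have "n + s + (l + 1/2) - 1 \<in> \<int>"
      using weights_add_half[OF n s] by (intro Ints_diff) (auto simp: weights_iff)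
    then show ?thesis by (simp add: algebra_simps)
  qed
  then have bad: "\<not> (- (l - 1/2) \<le> n + s \<and> n + s \<le> l - 1/2)"
    using nw up by (auto simp: weights_iff spin_def)
  consider "s = 1/2" | "s = -1/2" using s by auto
  then show ?thesis
  proof cases
    case 1
    have "n = l"
    proof (rule ccontr)
      assume "n \<noteq> l"
      moreover have "- n \<in> weights l" using weights_uminus[OF l] n by simp
      ultimately have "0 + 1 \<le> - n + l" using n by (intro Ints_cases_lt) (auto simp: weights_iff)
      then show False using bad 1 n by (auto simp: weights_iff)
    qed
    then show ?thesis using up unfolding 1 by (simp add: cg_def cgB_def)
  next
    case 2
    have "n = - l"
    proof (rule ccontr)
      assume "n \<noteq> - l"
      then have "0 + 1 \<le> n + l" using n by (intro Ints_cases_lt) (auto simp: weights_iff)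
      then show False using bad 2 n by (auto simp: weights_iff)
    qed
    then show ?thesis using up unfolding 2 by (simp add: cg_def cgA_def)
  qed
qed


text \<open>The values at the empty word and the four generator rules determine S, and
  \<open>cg_raise\<close> and \<open>cg_lower\<close> show that the coupled matrix elements obey the
  same rules. The parameter p is q or its inverse according to the order of the tensor
  factors.\<close>

lemma intertwine_words:
  fixes S :: "real \<Rightarrow> real \<Rightarrow> uq_functional"
  assumes p: "p > 0" "p \<noteq> 1" and l: "l \<in> half_nats" and ladder_p: "\<And>l m. ladder p l m = ladder q l m"
    and Nil: "\<And>n s. n \<in> weights l \<Longrightarrow> s \<in> weights (1/2) \<Longrightarrow> S n s [] = (if n + s = M then of_real (cg p up l M s) else 0)"
    and Uk: "\<And>n s x. n \<in> weights l \<Longrightarrow> s \<in> weights (1/2) \<Longrightarrow> S n s (Uk # x) = of_real (q powr (n + s)) * S n s x"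
    and Uki: "\<And>n s x. n \<in> weights l \<Longrightarrow> s \<in> weights (1/2) \<Longrightarrow> S n s (Uki # x) = of_real (q powr (- (n + s))) * S n s x"
    and Ue: "\<And>n s x. n \<in> weights l \<Longrightarrow> s \<in> weights (1/2) \<Longrightarrow> S n s (Ue # x) =
      of_real (p powr s * ladder q l (n - 1)) * S (n - 1) s x + of_real (p powr (- n) * ladder q (1/2) (s - 1)) * S n (s - 1) x"
    and Uf: "\<And>n s x. n \<in> weights l \<Longrightarrow> s \<in> weights (1/2) \<Longrightarrow> S n s (Uf # x) =
      of_real (p powr s * ladder q l n) * S (n + 1) s x + of_real (p powr (- n) * ladder q (1/2) s) * S n (s + 1) x"
    and ns: "n \<in> weights l" "s \<in> weights (1/2)"
  shows "S n s x = of_real (cg p up l (n + s) s) * rep q (spin up l) x (n + s) M"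
  using ns
proof (induction x arbitrary: n s)
  case Nil
  then show ?case by (simp add: assms(5))
next
  case (Cons g x)
  note ns = Cons.prems
  have spin: "up \<or> l > 0 \<Longrightarrow> spin up l \<in> half_nats"
  proof -
    assume a: "up \<or> l > 0"
    obtain k :: nat where k: "l = real k / 2" using l by (auto simp: half_nats_def)
    then have "spin up l = real (if up then k + 1 else k - 1) / 2"
      using a by (auto simp: spin_def of_nat_diff field_simps)
    then show ?thesis unfolding half_nats_def by blast
  qed
  have spin: "spin up l \<in> half_nats" if True: "n + s \<in> weights (spin up l)"
    proof (rule spin)
      show "up \<or> l > 0"
      proof (rule ccontr)
        assume "\<not> (up \<or> l > 0)"
        then have "\<not> up" "l = 0" using half_nats_ge[OF l] by auto
        then show False using True by (auto simp: spin_def weights_iff)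
      qed
    qed
  show ?case
    proof (cases g)
      case Uk
      show ?thesis
        using ns cg_nonweight[OF l ns, of up p]
        by (cases "n + s \<in> weights (spin up l)") (simp_all add: Uk assms(6) Cons.IH rep_Cons_gen del: rep.simps)
    next
      case Uki
      show ?thesis
        using ns cg_nonweight[OF l ns, of up p]
        by (cases "n + s \<in> weights (spin up l)") (simp_all add: Uki assms(7) Cons.IH rep_Cons_gen del: rep.simps)
    next
      case Ue
      \<comment> \<open>If n - 1 is not a weight, the induction hypothesis says nothing about the
        shifted term, but then n = -l and its ladder coefficient is 0.\<close>
      have 1: "of_real (ladder q l (n - 1)) * S (n - 1) s x =
          of_real (ladder q l (n - 1)) * (of_real (cg p up l (n + s - 1) s) * rep q (spin up l) x (n + s - 1) M)"
      proof (cases "n - 1 \<in> weights l")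
        case True
        then show ?thesis using Cons.IH[OF True ns(2)] by (simp add: algebra_simps)
      next
        case False
        then show ?thesis using weights_pred[OF ns(1)] by simp
      qed
      have 2: "of_real (ladder q (1/2) (s - 1)) * S n (s - 1) x =
          of_real (ladder q (1/2) (s - 1)) * (of_real (cg p up l (n + s - 1) (s - 1)) * rep q (spin up l) x (n + s - 1) M)"
      proof (cases "s - 1 \<in> weights (1/2)")
        case True
        then show ?thesis using Cons.IH[OF ns(1) True] by (simp add: add_diff_eq)
      next
        case False
        have "s = - (1/2)" using weights_pred[OF ns(2) False] .
        then have "ladder q (1/2) (s - 1) = 0" by (simp only: ladder_bottom)
        then show ?thesis by (simp only: of_real_0 mult_zero_left)
      qed
      have "S n s (g # x) = of_real (p powr s * ladder q l (n - 1) * cg p up l (n + s - 1) s +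
          p powr (- n) * ladder q (1/2) (s - 1) * cg p up l (n + s - 1) (s - 1)) * rep q (spin up l) x (n + s - 1) M"
        unfolding Ue assms(8)[OF ns] of_real_mult of_real_add mult.assoc 1 2 by (simp only: distrib_right mult.assoc)
      also have "\<dots> = of_real (ladder q (spin up l) (n + s - 1) * cg p up l (n + s) s) * rep q (spin up l) x (n + s - 1) M"
        using cg_raise[OF p ns, of up] by (simp only: ladder_p)
      finally show ?thesis
        using cg_nonweight[OF l ns, of up p]
        by (cases "n + s \<in> weights (spin up l)") (simp_all add: Ue rep_Cons_gen del: rep.simps)
    next
      case Uf
      have 1: "of_real (ladder q l n) * S (n + 1) s x =
          of_real (ladder q l n) * (of_real (cg p up l (n + s + 1) s) * rep q (spin up l) x (n + s + 1) M)"
      proof (cases "n + 1 \<in> weights l")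
        case True
        then show ?thesis using Cons.IH[OF True ns(2)] by (simp add: algebra_simps)
      next
        case False
        then show ?thesis using weights_succ[OF l ns(1)] by simp
      qed
      have 2: "of_real (ladder q (1/2) s) * S n (s + 1) x =
          of_real (ladder q (1/2) s) * (of_real (cg p up l (n + s + 1) (s + 1)) * rep q (spin up l) x (n + s + 1) M)"
      proof (cases "s + 1 \<in> weights (1/2)")
        case True
        then show ?thesis using Cons.IH[OF ns(1) True] by (simp add: add.assoc)
      next
        case False
        then have "s = 1/2" using ns(2) by auto
        then have "ladder q (1/2) s = 0" by (simp only: ladder_bottom)
        then show ?thesis by (simp only: of_real_0 mult_zero_left)
      qed
      have "S n s (g # x) = of_real (p powr s * ladder q l n * cg p up l (n + s + 1) s +
          p powr (- n) * ladder q (1/2) s * cg p up l (n + s + 1) (s + 1)) * rep q (spin up l) x (n + s + 1) M"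
        unfolding Uf assms(9)[OF ns] of_real_mult of_real_add mult.assoc 1 2 by (simp only: distrib_right mult.assoc)
      also have "\<dots> = of_real (ladder q (spin up l) (n + s) * cg p up l (n + s) s) * rep q (spin up l) x (n + s + 1) M"
        using cg_lower[OF p l ns, of up] by (simp only: ladder_p)
      finally show ?thesis
        using cg_nonweight[OF l ns, of up p] spin
        by (cases "n + s \<in> weights (spin up l)") (simp_all add: Uf rep_Cons_gen del: rep.simps)
    qed
qed


lemma dual_mult_matrix_element_gen:
  fixes q l1 l2 m1 m2 :: real
  assumes n: "n1 \<in> weights l1" "n2 \<in> weights l2"
  defines "D \<equiv> \<lambda>n1 n2. dual_mult (matrix_element q l1 n1 m1) (matrix_element q l2 n2 m2)"
  shows "D n1 n2 (Uk # x) = of_real (q powr (n1 + n2)) * D n1 n2 x"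
    "D n1 n2 (Uki # x) = of_real (q powr (- (n1 + n2))) * D n1 n2 x"
    "D n1 n2 (Ue # x) = of_real (q powr n2 * ladder q l1 (n1 - 1)) * D (n1 - 1) n2 x +
       of_real (q powr (- n1) * ladder q l2 (n2 - 1)) * D n1 (n2 - 1) x"
    "l1 \<in> half_nats \<Longrightarrow> l2 \<in> half_nats \<Longrightarrow>
     D n1 n2 (Uf # x) = of_real (q powr n2 * ladder q l1 n1) * D (n1 + 1) n2 x +
       of_real (q powr (- n1) * ladder q l2 n2) * D n1 (n2 + 1) x"
  unfolding D_def dual_mult_cop matrix_element_def cop_cmult[symmetric]
  by (simp_all add: rep_Cons_gen n powr_add powr_diff powr_minus divide_inverse mult_ac del: rep.simps)

lemma half_half_nats [simp]: "1/2 \<in> half_nats"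
  by (auto simp: half_nats_def intro: exI[of _ "1::nat"])

text \<open>The version for the action on H, where the spinor is the right tensor factor.\<close>

lemma cg_right:
  assumes q: "q > 0" "q \<noteq> 1" and l: "l \<in> half_nats" and n: "n \<in> weights l" "s \<in> weights (1/2)"
  shows "(\<Sum>s'\<in>weights (1/2). of_real (cg q up l M s') *
      dual_mult (matrix_element q l n (M - s')) (matrix_element q (1/2) s s') x) =
    of_real (cg q up l (n + s) s) * rep q (spin up l) x (n + s) M"
proof (rule intertwine_words[OF q l _ _ _ _ _ _ n, where
    S="\<lambda>n s x. \<Sum>s'\<in>weights (1/2). of_real (cg q up l M s') *
      dual_mult (matrix_element q l n (M - s')) (matrix_element q (1/2) s s') x"])
  fix n s x assume n: "n \<in> weights l" "s \<in> weights (1/2)"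
  note g = dual_mult_matrix_element_gen[OF n, of q]
  have "(\<Sum>s'\<in>weights (1/2). of_real (cg q up l M s') *
      dual_mult (matrix_element q l n (M - s')) (matrix_element q (1/2) s s') []) =
      (\<Sum>s'\<in>weights (1/2). if s = s' then (if n + s = M then complex_of_real (cg q up l M s) else 0) else 0)"
    by (intro sum.cong refl) (auto simp: dual_mult_cop matrix_element_def)
  also have "\<dots> = (if n + s = M then of_real (cg q up l M s) else 0)"
    using n(2) by (subst sum.delta') simp_all
  finally show "(\<Sum>s'\<in>weights (1/2). of_real (cg q up l M s') *
      dual_mult (matrix_element q l n (M - s')) (matrix_element q (1/2) s s') []) = (if n + s = M then of_real (cg q up l M s) else 0)" .
qed (simp_all only: dual_mult_matrix_element_gen l half_half_nats sum_distrib_left distrib_left sum.distrib mult.left_commute)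

text \<open>The version for products in the algebra: generators multiply from the left, so spin one
  half is the first factor. Interchanging the factors inverts the powers of q in the coproducts of e
  and f, hence \<open>inverse q\<close>.\<close>

lemma cg_left:
  assumes q: "q > 0" "q \<noteq> 1" and l: "l \<in> half_nats" and n: "n \<in> weights l" "s \<in> weights (1/2)"
  shows "(\<Sum>s'\<in>weights (1/2). of_real (cg (inverse q) up l M s') *
      dual_mult (matrix_element q (1/2) s s') (matrix_element q l n (M - s')) x) =
    of_real (cg (inverse q) up l (n + s) s) * rep q (spin up l) x (n + s) M"
proof (rule intertwine_words[OF _ _ l _ _ _ _ _ _ n, where
    S="\<lambda>n s x. \<Sum>s'\<in>weights (1/2). of_real (cg (inverse q) up l M s') *
      dual_mult (matrix_element q (1/2) s s') (matrix_element q l n (M - s')) x"])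
  show "inverse q > 0" "inverse q \<noteq> 1" using q by auto
  show "ladder (inverse q) l m = ladder q l m" for l m by (rule ladder_inverse[OF q])
  have pw: "inverse q powr r = q powr (- r)" for r using q by (simp add: inverse_powr powr_minus)
  fix n s x assume n: "n \<in> weights l" "s \<in> weights (1/2)"
  have "(\<Sum>s'\<in>weights (1/2). of_real (cg (inverse q) up l M s') *
      dual_mult (matrix_element q (1/2) s s') (matrix_element q l n (M - s')) []) =
      (\<Sum>s'\<in>weights (1/2). if s = s' then (if n + s = M then complex_of_real (cg (inverse q) up l M s) else 0) else 0)"
    by (intro sum.cong refl) (auto simp: dual_mult_cop matrix_element_def)
  also have "\<dots> = (if n + s = M then of_real (cg (inverse q) up l M s) else 0)"
    using n(2) by (subst sum.delta') simp_all
  finally show "(\<Sum>s'\<in>weights (1/2). of_real (cg (inverse q) up l M s') *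
      dual_mult (matrix_element q (1/2) s s') (matrix_element q l n (M - s')) []) =
      (if n + s = M then of_real (cg (inverse q) up l M s) else 0)" .
  note g = dual_mult_matrix_element_gen[OF n(2,1), of q]
  let ?S = "\<lambda>n s x. \<Sum>s'\<in>weights (1/2). of_real (cg (inverse q) up l M s') *
      dual_mult (matrix_element q (1/2) s s') (matrix_element q l n (M - s')) x"
  show "?S n s (Uk # x) = of_real (q powr (n + s)) * ?S n s x"
    "?S n s (Uki # x) = of_real (q powr (- (n + s))) * ?S n s x"
    unfolding g add.commute[of n s] sum_distrib_left by (simp_all only: mult.left_commute)
  show "?S n s (Ue # x) = of_real (inverse q powr s * ladder q l (n - 1)) * ?S (n - 1) s x +
      of_real (inverse q powr (- n) * ladder q (1/2) (s - 1)) * ?S n (s - 1) x"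
    unfolding g pw minus_minus by (simp only: sum_distrib_left distrib_left sum.distrib mult.left_commute add.commute)
  show "?S n s (Uf # x) = of_real (inverse q powr s * ladder q l n) * ?S (n + 1) s x +
      of_real (inverse q powr (- n) * ladder q (1/2) s) * ?S n (s + 1) x"
    unfolding g(4)[OF half_half_nats l] pw minus_minus
    by (simp only: sum_distrib_left distrib_left sum.distrib mult.left_commute add.commute)
qed

lemma cg_complete:
  assumes q: "q > 0" "q \<noteq> 1" and l: "l \<ge> 0" and n: "n \<in> weights l" and s: "s \<in> weights (1/2)" "s' \<in> weights (1/2)"
  shows "cg q True l (n + s) s' * cg q True l (n + s) s + cg q False l (n + s) s' * cg q False l (n + s) s =
    (if s' = s then 1 else 0)"
proof -
  have "l + (n + s) + 1/2 \<ge> 0" "l - (n + s) + 1/2 \<ge> 0" "(l + (n + s) + 1/2) + (l - (n + s) + 1/2) > 0"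
    using n s l by (auto simp: weights_iff)
  from cgA_cgB_square[OF q this] show ?thesis
    using s by (auto simp: cg_def add.commute)
qed

text \<open>The Clebsch-Gordan series. \<open>cg_left\<close> evaluates each coupled combination of
  products, and completeness of the coefficients solves for a single product.\<close>

lemma matrix_element_half_mult:
  assumes q: "q > 0" "q \<noteq> 1" and l: "l \<in> half_nats" and n: "n \<in> weights l" "s \<in> weights (1/2)"
    and m: "m \<in> weights l" "s0 \<in> weights (1/2)"
  shows "dual_mult (matrix_element q (1/2) s s0) (matrix_element q l n m) x =
    (\<Sum>up\<in>UNIV. of_real (cg (inverse q) up l (n + s) s * cg (inverse q) up l (m + s0) s0) *
      matrix_element q (spin up l) (n + s) (m + s0) x)"
proof -
  define c where "c up s' = cg (inverse q) up l (m + s0) s'" for up s'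
  define D where "D s' = dual_mult (matrix_element q (1/2) s s') (matrix_element q l n (m + s0 - s')) x" for s'
  have ip: "inverse q > 0" "inverse q \<noteq> 1" using q by auto
  have sum: "(\<Sum>up\<in>UNIV. c up s' * c up s0) = (if s' = s0 then 1 else 0)" if "s' \<in> weights (1/2)" for s'
    using cg_complete[OF ip half_nats_ge[OF l] m that] by (simp add: c_def UNIV_bool add.commute)
  have "dual_mult (matrix_element q (1/2) s s0) (matrix_element q l n m) x = D s0"
    by (simp add: D_def)
  also have "\<dots> = (\<Sum>s'\<in>weights (1/2). (if s0 = s' then D s' else 0))"
    using m(2) by (subst sum.delta') simp_all
  also have "\<dots> = (\<Sum>s'\<in>weights (1/2). of_real (\<Sum>up\<in>UNIV. c up s' * c up s0) * D s')"
    by (intro sum.cong refl) (simp only: sum, auto)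
  also have "\<dots> = (\<Sum>up\<in>UNIV. of_real (c up s0) * (\<Sum>s'\<in>weights (1/2). of_real (c up s') * D s'))"
    by (simp only: of_real_sum of_real_mult sum_distrib_right sum_distrib_left, subst sum.swap, simp only: mult_ac)
  also have "\<dots> = (\<Sum>up\<in>UNIV. of_real (cg (inverse q) up l (n + s) s * cg (inverse q) up l (m + s0) s0) *
      matrix_element q (spin up l) (n + s) (m + s0) x)"
    unfolding c_def D_def cg_left[OF q l n] by (simp only: matrix_element_def of_real_mult mult_ac)
  finally show ?thesis .
qed

section \<open>Closure properties of the coordinate algebra and its generation by spin one
  half\<close>

section \<open>The coordinate algebra\<close>

lemma coordinate_algebra_zero: "(\<lambda>x. 0) \<in> coordinate_algebra q"
  unfolding coordinate_algebra_def mem_Collect_eq by (intro exI[of _ "{}"]) simp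

lemma coordinate_algebra_matrix_element:
  assumes "l \<in> half_nats" "n \<in> weights l" "m \<in> weights l"
  shows "matrix_element q l n m \<in> coordinate_algebra q"
  unfolding coordinate_algebra_def mem_Collect_eq
  using assms by (intro exI[of _ "{(l, n, m)}"] exI[of _ "\<lambda>_. 1"]) simp

lemma coordinate_algebra_add:
  assumes "a \<in> coordinate_algebra q" "b \<in> coordinate_algebra q"
  shows "dual_add a b \<in> coordinate_algebra q"
proof -
  obtain I c where I: "finite I" "I \<subseteq> {(l, n, m). l \<in> half_nats \<and> n \<in> weights l \<and> m \<in> weights l}"
    "a = (\<lambda>x. \<Sum>(l, n, m)\<in>I. c (l, n, m) * matrix_element q l n m x)"
    using assms(1) unfolding coordinate_algebra_def mem_Collect_eq by blast
  obtain J d where J: "finite J" "J \<subseteq> {(l, n, m). l \<in> half_nats \<and> n \<in> weights l \<and> m \<in> weights l}"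
    "b = (\<lambda>x. \<Sum>(l, n, m)\<in>J. d (l, n, m) * matrix_element q l n m x)"
    using assms(2) unfolding coordinate_algebra_def mem_Collect_eq by blast
  define e where "e i = (if i \<in> I then c i else 0) + (if i \<in> J then d i else 0)" for i
  have "dual_add a b = (\<lambda>x. \<Sum>(l, n, m)\<in>I \<union> J. e (l, n, m) * matrix_element q l n m x)"
  proof
    fix x
    define M where "M = (\<lambda>(l, n, m). matrix_element q l n m x)"
    have "(\<Sum>i\<in>I \<union> J. e i * M i) = (\<Sum>i\<in>I \<union> J. (if i \<in> I then c i else 0) * M i) + (\<Sum>i\<in>I \<union> J. (if i \<in> J then d i else 0) * M i)"
      by (simp add: e_def distrib_right sum.distrib)
    also have "(\<Sum>i\<in>I \<union> J. (if i \<in> I then c i else 0) * M i) = (\<Sum>i\<in>I. c i * M i)"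
      using I(1) J(1) by (intro sum.mono_neutral_cong_right) auto
    also have "(\<Sum>i\<in>I \<union> J. (if i \<in> J then d i else 0) * M i) = (\<Sum>i\<in>J. d i * M i)"
      using I(1) J(1) by (intro sum.mono_neutral_cong_right) auto
    finally show "dual_add a b x = (\<Sum>(l, n, m)\<in>I \<union> J. e (l, n, m) * matrix_element q l n m x)"
      unfolding dual_add_def I(3) J(3) by (simp add: case_prod_unfold M_def)
  qed
  then show ?thesis
    unfolding coordinate_algebra_def mem_Collect_eq using I J by (intro exI[of _ "I \<union> J"] exI[of _ e]) blast
qed

lemma coordinate_algebra_scale:
  assumes "a \<in> coordinate_algebra q"
  shows "dual_scale c a \<in> coordinate_algebra q"
proof -
  obtain I d where I: "finite I" "I \<subseteq> {(l, n, m). l \<in> half_nats \<and> n \<in> weights l \<and> m \<in> weights l}"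
    "a = (\<lambda>x. \<Sum>(l, n, m)\<in>I. d (l, n, m) * matrix_element q l n m x)"
    using assms unfolding coordinate_algebra_def mem_Collect_eq by blast
  have "dual_scale c a = (\<lambda>x. \<Sum>(l, n, m)\<in>I. (c * d (l, n, m)) * matrix_element q l n m x)"
    unfolding dual_scale_def I(3) by (simp add: sum_distrib_left case_prod_unfold mult.assoc)
  then show ?thesis
    unfolding coordinate_algebra_def mem_Collect_eq using I(1,2)
    by (intro exI[of _ I] exI[of _ "\<lambda>i. c * d i"]) blast
qed

lemma dual_scale_zero: "dual_scale 0 a = (\<lambda>x. 0)"
  by (simp add: dual_scale_def)

lemma coordinate_algebra_induct [consumes 1, case_names zero add scale matrix_element]:
  assumes a: "a \<in> coordinate_algebra q"
    and zero: "P (\<lambda>x. 0)"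
    and add: "\<And>a b. a \<in> coordinate_algebra q \<Longrightarrow> b \<in> coordinate_algebra q \<Longrightarrow> P a \<Longrightarrow> P b \<Longrightarrow> P (dual_add a b)"
    and scale: "\<And>c a. a \<in> coordinate_algebra q \<Longrightarrow> P a \<Longrightarrow> P (dual_scale c a)"
    and elem: "\<And>l n m. l \<in> half_nats \<Longrightarrow> n \<in> weights l \<Longrightarrow> m \<in> weights l \<Longrightarrow> P (matrix_element q l n m)"
  shows "P a"
proof -
  obtain I d where I: "finite I" "I \<subseteq> {(l, n, m). l \<in> half_nats \<and> n \<in> weights l \<and> m \<in> weights l}"
    "a = (\<lambda>x. \<Sum>(l, n, m)\<in>I. d (l, n, m) * matrix_element q l n m x)"
    using a unfolding coordinate_algebra_def mem_Collect_eq by blast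
  have "P (\<lambda>x. \<Sum>(l, n, m)\<in>I. d (l, n, m) * matrix_element q l n m x) \<and>
      (\<lambda>x. \<Sum>(l, n, m)\<in>I. d (l, n, m) * matrix_element q l n m x) \<in> coordinate_algebra q"
    using I(1,2)
  proof (induction I rule: finite_induct)
    case empty
    then show ?case using zero coordinate_algebra_zero by simp
  next
    case (insert i I)
    obtain l n m where i: "i = (l, n, m)" by (cases i)
    have lnm: "l \<in> half_nats" "n \<in> weights l" "m \<in> weights l" using insert.prems i by auto
    have "(\<lambda>x. \<Sum>(l, n, m)\<in>insert i I. d (l, n, m) * matrix_element q l n m x) =
        dual_add (dual_scale (d i) (matrix_element q l n m)) (\<lambda>x. \<Sum>(l, n, m)\<in>I. d (l, n, m) * matrix_element q l n m x)"
      using insert.hyps by (simp add: fun_eq_iff dual_add_def dual_scale_def i)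
    then show ?case
      using insert.IH insert.prems lnm
      by (auto intro!: add scale elem coordinate_algebra_add coordinate_algebra_scale coordinate_algebra_matrix_element)
  qed
  then show ?thesis using I(3) by simp
qed

lemma spin_half_nats:
  assumes l: "l \<in> half_nats" and M: "M \<in> weights (spin up l)"
  shows "spin up l \<in> half_nats"
proof -
  obtain k :: nat where k: "l = real k / 2" using l by (auto simp: half_nats_def)
  have "up \<or> k > 0"
  proof (rule ccontr)
    assume "\<not> (up \<or> k > 0)"
    then have "\<not> up" "l = 0" using k by auto
    then show False using M by (auto simp: spin_def weights_iff)
  qed
  then have "spin up l = real (if up then k + 1 else k - 1) / 2"
    using k by (auto simp: spin_def of_nat_diff field_simps)
  then show ?thesis unfolding half_nats_def by blast
qed

text \<open>When a shifted index is not a weight, the matrix element may lie outside the algebra,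
  but its coefficient is 0. This includes spin -1/2, which occurs formally for l = 0.\<close>

lemma coordinate_algebra_cg_term:
  assumes l: "l \<in> half_nats" and n: "n \<in> weights l" "s \<in> weights (1/2)"
    and m: "m \<in> weights l" "s0 \<in> weights (1/2)"
  shows "dual_scale (of_real (cg p up l (n + s) s * cg p up l (m + s0) s0)) (matrix_element q (spin up l) (n + s) (m + s0))
    \<in> coordinate_algebra q"
proof (cases "n + s \<in> weights (spin up l) \<and> m + s0 \<in> weights (spin up l)")
  case True
  then show ?thesis
    using spin_half_nats[OF l] by (intro coordinate_algebra_scale coordinate_algebra_matrix_element) auto
next
  case False
  then have "cg p up l (n + s) s * cg p up l (m + s0) s0 = 0"
    using cg_nonweight[OF l n] cg_nonweight[OF l m] by auto
  then show ?thesis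
    by (simp only: of_real_0 dual_scale_zero coordinate_algebra_zero)
qed

lemma matrix_element_half_mult':
  assumes q: "q > 0" "q \<noteq> 1" and l: "l \<in> half_nats" and n: "n \<in> weights l" "s \<in> weights (1/2)"
    and m: "m \<in> weights l" "s0 \<in> weights (1/2)"
  defines "c \<equiv> \<lambda>up. complex_of_real (cg (inverse q) up l (n + s) s * cg (inverse q) up l (m + s0) s0)"
  shows "dual_mult (matrix_element q (1/2) s s0) (matrix_element q l n m) =
    dual_add (dual_scale (c True) (matrix_element q (spin True l) (n + s) (m + s0)))
      (dual_scale (c False) (matrix_element q (spin False l) (n + s) (m + s0)))"
  using matrix_element_half_mult[OF q l n m]
  by (simp add: fun_eq_iff dual_add_def dual_scale_def UNIV_bool c_def add.commute)

lemma coordinate_algebra_half_mult: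
  assumes q: "q > 0" "q \<noteq> 1" and a: "a \<in> coordinate_algebra q" and s: "s \<in> weights (1/2)" "s0 \<in> weights (1/2)"
  shows "dual_mult (matrix_element q (1/2) s s0) a \<in> coordinate_algebra q"
  using a
proof (induction rule: coordinate_algebra_induct)
  case (matrix_element l n m)
  show ?case
    unfolding matrix_element_half_mult'[OF q matrix_element(1,2) s(1) matrix_element(3) s(2)]
    by (intro coordinate_algebra_add coordinate_algebra_cg_term matrix_element s)
qed (simp_all add: dual_mult_zero_right coordinate_algebra_zero dual_mult_add_right dual_mult_scale_right
    coordinate_algebra_add coordinate_algebra_scale)

lemma matrix_element_0:
  assumes "q > 0"
  shows "matrix_element q 0 0 0 = counit"
proof
  fix x
  have w: "(0::real) \<in> weights 0" by (simp add: weights_iff)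
  have "(0::real) \<in> half_nats" by (auto simp: half_nats_def intro: exI[of _ "0::nat"])
  note r = rep_Cons_gen[OF w] rep_Cons_gen(4)[OF w this]
  have "ladder q 0 (-1) = 0" "ladder q 0 0 = 0"
    using ladder_bottom(1)[of q 0] ladder_bottom(2)[of q 0] by simp_all
  then have "rep q 0 x 0 0 = counit x"
  proof (induction x)
    case (Cons g x)
    then show ?case using assms by (cases g) (simp_all add: r del: rep.simps)
  qed simp
  then show "matrix_element q 0 0 0 x = counit x" by (simp add: matrix_element_def)
qed

lemma counit_in_coordinate_algebra:
  assumes "q > 0"
  shows "counit \<in> coordinate_algebra q"
proof -
  have "(0::real) \<in> half_nats" by (auto simp: half_nats_def intro: exI[of _ "0::nat"])
  then show ?thesis
    using coordinate_algebra_matrix_element[of 0 0 0 q] assms by (simp add: matrix_element_0 weights_iff)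
qed

text \<open>s = 1/2 works except at the lowest weight. The nonvanishing coefficient is what makes
  the top term of the Clebsch-Gordan series solvable.\<close>

lemma weights_half_split:
  assumes p: "p > 0" "p \<noteq> 1" and l: "l \<in> half_nats" and K: "K \<in> weights (l + 1/2)"
  obtains n s where "n \<in> weights l" "s \<in> weights (1/2)" "K = n + s" "cg p True l K s \<noteq> 0"
proof (cases "K = - (l + 1/2)")
  case True
  have "- l \<in> weights l" using half_nats_ge[OF l] by (simp add: weights_iff)
  moreover have "cg p True l K (-1/2) \<noteq> 0"
    using True half_nats_ge[OF l] qint_pos[OF p, of "1 + 2 * l"] p by (simp add: cg_def cgB_def)
  ultimately show ?thesis using True by (intro that[of "- l" "-1/2"]) auto
next
  case False
  have "0 + 1 \<le> K + (l + 1/2)"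
    using K False by (intro Ints_cases_lt) (auto simp: weights_iff)
  moreover have "K + (l + 1/2) - 1 \<in> \<int>" using K by (intro Ints_diff) (auto simp: weights_iff)
  ultimately have n: "K - 1/2 \<in> weights l"
    using K by (simp add: weights_iff algebra_simps)
  have "cg p True l K (1/2) \<noteq> 0"
    using \<open>0 + 1 \<le> K + (l + 1/2)\<close> half_nats_ge[OF l] qint_pos[OF p, of "l + K + 1/2"] qint_pos[OF p, of "2 * l + 1"] p
    by (simp add: cg_def cgA_def)
  then show ?thesis using n by (intro that[of "K - 1/2" "1/2"]) auto
qed

text \<open>The spin 1/2 matrix elements generate the algebra: a suitable product of one of them
  with a matrix element of spin l contains any given element of spin l + 1/2 with nonzero
  coefficient, plus a term of spin l - 1/2. Strong induction on N = 2l handles the rest.\<close>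

lemma coordinate_algebra_generator_induct [consumes 3, case_names counit add scale mult]:
  assumes q: "q > 0" "q \<noteq> 1" and a: "a \<in> coordinate_algebra q"
    and counit: "P counit"
    and add: "\<And>a b. a \<in> coordinate_algebra q \<Longrightarrow> b \<in> coordinate_algebra q \<Longrightarrow> P a \<Longrightarrow> P b \<Longrightarrow> P (dual_add a b)"
    and scale: "\<And>c a. a \<in> coordinate_algebra q \<Longrightarrow> P a \<Longrightarrow> P (dual_scale c a)"
    and mult: "\<And>s s0 a. s \<in> weights (1/2) \<Longrightarrow> s0 \<in> weights (1/2) \<Longrightarrow> a \<in> coordinate_algebra q \<Longrightarrow> P a \<Longrightarrow>
      P (dual_mult (matrix_element q (1/2) s s0) a)"
  shows "P a"
proof -
  have ip: "inverse q > 0" "inverse q \<noteq> 1" using q by auto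
  have zero: "P (\<lambda>x. 0)"
    using scale[OF counit_in_coordinate_algebra[OF q(1)] counit, of 0] by (simp add: dual_scale_zero)
  have elem: "n \<in> weights (real N / 2) \<Longrightarrow> m \<in> weights (real N / 2) \<Longrightarrow> P (matrix_element q (real N / 2) n m)" for N n m
  proof (induction N arbitrary: n m rule: less_induct)
    case (less N)
    show ?case
    proof (cases N)
      case 0
      then have "n = 0" "m = 0" using less.prems by (auto simp: weights_iff)
      then show ?thesis using 0 counit by (simp add: matrix_element_0[OF q(1)])
    next
      case (Suc N')
      define l where "l = real N' / 2"
      have l: "l \<in> half_nats" by (auto simp: l_def half_nats_def)
      have N: "real N / 2 = l + 1/2" by (simp add: l_def Suc)
      obtain n1 s where n: "n1 \<in> weights l" "s \<in> weights (1/2)" "n = n1 + s" "cg (inverse q) True l n s \<noteq> 0"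
        using weights_half_split[OF ip l, of n] less.prems N by metis
      obtain m1 s0 where m: "m1 \<in> weights l" "s0 \<in> weights (1/2)" "m = m1 + s0" "cg (inverse q) True l m s0 \<noteq> 0"
        using weights_half_split[OF ip l, of m] less.prems N by metis
      define c where "c up = complex_of_real (cg (inverse q) up l (n1 + s) s * cg (inverse q) up l (m1 + s0) s0)" for up
      define T where "T = matrix_element q (spin True l) n m"
      define T' where "T' = dual_scale (c False) (matrix_element q (spin False l) n m)"
      define Q where "Q = dual_mult (matrix_element q (1/2) s s0) (matrix_element q l n1 m1)"
      have Q: "Q = dual_add (dual_scale (c True) T) T'"
        unfolding Q_def T_def T'_def c_def n(3) m(3) by (rule matrix_element_half_mult'[OF q l n(1,2) m(1,2)])
      have c: "c True \<noteq> 0" using n(4) m(4) n(3) m(3) by (simp add: c_def)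
      have mem: "matrix_element q l n1 m1 \<in> coordinate_algebra q"
        by (intro coordinate_algebra_matrix_element l n m)
      have Q_mem: "Q \<in> coordinate_algebra q"
        unfolding Q_def by (intro coordinate_algebra_half_mult q mem n m)
      have PQ: "P Q"
        unfolding Q_def using less.IH[of N'] Suc n m mem by (intro mult) (auto simp: l_def)
      have T'_mem: "T' \<in> coordinate_algebra q"
        unfolding T'_def c_def n(3) m(3) by (intro coordinate_algebra_cg_term l n m)
      have PT': "P T'"
      proof (cases "n \<in> weights (spin False l) \<and> m \<in> weights (spin False l)")
        case True
        then have "spin False l \<in> half_nats" using spin_half_nats[OF l] by blast
        then obtain N'' :: nat where N'': "spin False l = real N'' / 2"
          unfolding half_nats_def by blast
        then have "N'' < N" using Suc by (simp add: spin_def l_def)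
        then show ?thesis
          unfolding T'_def N'' using less.IH[of N''] True N''
          by (intro scale coordinate_algebra_matrix_element) (auto simp: half_nats_def)
      next
        case False
        then have "c False = 0"
          using cg_nonweight[OF l n(1,2), of False "inverse q"] cg_nonweight[OF l m(1,2), of False "inverse q"] n(3) m(3)
          by (auto simp: c_def)
        then show ?thesis by (simp add: T'_def dual_scale_zero zero)
      qed
      \<comment> \<open>The Clebsch-Gordan series solved for its component of highest spin.\<close>
      have "T = dual_scale (1 / c True) (dual_add Q (dual_scale (- 1) T'))"
        using c by (simp add: fun_eq_iff Q dual_add_def dual_scale_def)
      moreover have "P (dual_scale (1 / c True) (dual_add Q (dual_scale (- 1) T')))"
        by (intro scale add coordinate_algebra_add coordinate_algebra_scale Q_mem T'_mem PQ PT')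
      ultimately show ?thesis by (simp add: T_def N spin_def)
    qed
  qed
  show ?thesis
    using a
  proof (induction rule: coordinate_algebra_induct)
    case (matrix_element l n m)
    then show ?case using elem by (auto simp: half_nats_def)
  qed (use zero add scale in auto)
qed

lemma coordinate_algebra_mult:
  assumes q: "q > 0" "q \<noteq> 1" and a: "a \<in> coordinate_algebra q" and b: "b \<in> coordinate_algebra q"
  shows "dual_mult a b \<in> coordinate_algebra q"
  using q a
proof (induction rule: coordinate_algebra_generator_induct)
  case (mult s s0 a)
  then show ?case
    unfolding dual_mult_assoc by (intro coordinate_algebra_half_mult q)
qed (simp_all add: dual_mult_counit_left b dual_mult_add_left dual_mult_scale_left
    coordinate_algebra_add coordinate_algebra_scale)

lemma coordinate_algebra_star:
  assumes q: "q > 0" and a: "a \<in> coordinate_algebra q"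
  shows "dual_star q a \<in> coordinate_algebra q"
  using a
proof (induction rule: coordinate_algebra_induct)
  case zero
  have "dual_star q (\<lambda>x. 0) = (\<lambda>x. 0)" by (simp add: dual_star_eq fun_eq_iff)
  then show ?case using coordinate_algebra_zero by simp
next
  case (matrix_element l n m)
  then show ?case
    unfolding dual_star_matrix_element[OF q matrix_element]
    by (intro coordinate_algebra_scale coordinate_algebra_matrix_element) (simp_all add: weights_uminus)
qed (simp_all add: dual_star_add dual_star_scale coordinate_algebra_add coordinate_algebra_scale)

lemma is_star_algebra_coordinate_algebra:
  assumes "q > 0" "q \<noteq> 1"
  shows "is_star_algebra q (coordinate_algebra q)"
  unfolding is_star_algebra_def
  using assms by (auto intro: counit_in_coordinate_algebra coordinate_algebra_add coordinate_algebra_mult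
      coordinate_algebra_scale coordinate_algebra_star)

section \<open>Schur orthogonality from invariance of the Haar state\<close>

section \<open>The Haar state\<close>

text \<open>The weights form a single chain of unit steps, so invariance under one step means
  constancy.\<close>

lemma weights_walk:
  assumes step: "\<And>m. m \<in> weights l \<Longrightarrow> m + 1 \<in> weights l \<Longrightarrow> f (m + 1) = f m"
    and "m \<in> weights l" "m' \<in> weights l"
  shows "f m = f m'"
proof -
  have "f (real k - l) = f (- l)" if "real k \<le> 2 * l" for k
    using that
  proof (induction k)
    case (Suc k)
    then have "real k - l \<in> weights l" "real k - l + 1 \<in> weights l"
      by (auto simp: weights_def intro: exI[of _ k] exI[of _ "Suc k"])
    from step[OF this] Suc show ?case by (simp add: algebra_simps)
  qed simp
  moreover obtain k k' :: nat where "m = real k - l" "real k \<le> 2 * l" "m' = real k' - l" "real k' \<le> 2 * l"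
    using assms(2,3) by (auto simp: weights_def)
  ultimately show ?thesis by simp
qed

lemma ladder_pos:
  assumes "q > 0" "q \<noteq> 1" "- l \<le> m" "m < l"
  shows "ladder q l m > 0"
  using assms by (simp add: ladder_def qint_pos)

locale gns =
  fixes q :: real and h :: "uq_functional \<Rightarrow> complex"
    and \<iota> :: "uq_functional \<Rightarrow> real \<Rightarrow> 'h::complex_hilbert_space"
  assumes q: "q > 0" "q \<noteq> 1" and haar: "is_haar_state q h" and gns: "is_gns_completion q h \<iota>"
begin

abbreviation A :: "uq_functional set" where "A \<equiv> coordinate_algebra q"
abbreviation t :: "real \<Rightarrow> real \<Rightarrow> real \<Rightarrow> uq_functional" where "t \<equiv> matrix_element q"

lemma h_add: "a \<in> A \<Longrightarrow> b \<in> A \<Longrightarrow> h (dual_add a b) = h a + h b"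
  and h_scale: "a \<in> A \<Longrightarrow> h (dual_scale c a) = c * h a"
  and h_counit: "h counit = 1"
  and h_pos: "a \<in> A \<Longrightarrow> Im (h (dual_mult (dual_star q a) a)) = 0 \<and> 0 \<le> Re (h (dual_mult (dual_star q a) a))"
  and h_left: "a \<in> A \<Longrightarrow> h (\<lambda>v. a (u @ v)) = counit u * h a"
  and h_right: "a \<in> A \<Longrightarrow> h (\<lambda>v. a (v @ u)) = counit u * h a"
  using haar unfolding is_haar_state_def by blast+

lemma h_zero [simp]: "h (\<lambda>x. 0) = 0"
  using h_scale[OF coordinate_algebra_zero, of 0] by (simp add: dual_scale_def)

lemma h_sum:
  "finite I \<Longrightarrow> (\<And>i. i \<in> I \<Longrightarrow> f i \<in> A) \<Longrightarrow> (\<lambda>x. \<Sum>i\<in>I. f i x) \<in> A \<and> h (\<lambda>x. \<Sum>i\<in>I. f i x) = (\<Sum>i\<in>I. h (f i))"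
proof (induction I rule: finite_induct)
  case (insert i I)
  have "(\<lambda>x. \<Sum>i\<in>insert i I. f i x) = dual_add (f i) (\<lambda>x. \<Sum>i\<in>I. f i x)"
    using insert.hyps by (simp add: fun_eq_iff dual_add_def)
  then show ?case using insert by (simp add: h_add coordinate_algebra_add)
qed (simp add: coordinate_algebra_zero)

text \<open>Extending the values of h by zero outside the weights makes the recursions from e hold
  without boundary cases.\<close>

definition bform :: "real \<Rightarrow> real \<Rightarrow> real \<Rightarrow> real \<Rightarrow> real \<Rightarrow> real \<Rightarrow> complex" where
  "bform l n m l' n' m' = (if n \<in> weights l \<and> m \<in> weights l \<and> n' \<in> weights l' \<and> m' \<in> weights l'
     then h (dual_mult (t l n m) (t l' n' m')) else 0)"

lemma dual_mult_t_in_A: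
  "l \<in> half_nats \<Longrightarrow> l' \<in> half_nats \<Longrightarrow> n \<in> weights l \<Longrightarrow> m \<in> weights l \<Longrightarrow> n' \<in> weights l' \<Longrightarrow> m' \<in> weights l' \<Longrightarrow>
   dual_mult (t l n m) (t l' n' m') \<in> A"
  by (intro coordinate_algebra_mult q coordinate_algebra_matrix_element)

context
  fixes l n m l' n' m' :: real
  assumes l: "l \<in> half_nats" "l' \<in> half_nats"
    and w: "n \<in> weights l" "m \<in> weights l" "n' \<in> weights l'" "m' \<in> weights l'"
begin

text \<open>Translation by the grouplike k scales the product by q^(m+m') but leaves h fixed, and
  this factor differs from 1.\<close>

lemma bform_right_k: "m + m' \<noteq> 0 \<Longrightarrow> bform l n m l' n' m' = 0"
proof -
  assume nz: "m + m' \<noteq> 0"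
  let ?D = "dual_mult (t l n m) (t l' n' m')"
  have "(\<lambda>v. ?D (v @ [Uk])) = dual_scale (of_real (q powr (m + m'))) ?D"
    by (simp add: fun_eq_iff dual_scale_def dual_mult_cop cop_append matrix_element_def rep_snoc_gen w
        powr_add mult_ac flip: cop_cmult del: rep.simps)
  then have "h ?D = of_real (q powr (m + m')) * h ?D"
    using h_right[OF dual_mult_t_in_A[OF l w], of "[Uk]"] h_scale[OF dual_mult_t_in_A[OF l w]] by simp
  moreover have "q powr (m + m') \<noteq> 1"
    using nz q by (auto simp: powr_def)
  then have "complex_of_real (q powr (m + m')) \<noteq> 1"
    by (metis of_real_1 of_real_eq_iff)
  ultimately show ?thesis by (simp add: bform_def)
qed

lemma bform_left_k: "n + n' \<noteq> 0 \<Longrightarrow> bform l n m l' n' m' = 0"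
proof -
  assume nz: "n + n' \<noteq> 0"
  let ?D = "dual_mult (t l n m) (t l' n' m')"
  have "(\<lambda>v. ?D ([Uk] @ v)) = dual_scale (of_real (q powr (n + n'))) ?D"
    using dual_mult_matrix_element_gen(1)[OF w(1,3)] by (simp add: fun_eq_iff dual_scale_def)
  then have "h ?D = of_real (q powr (n + n')) * h ?D"
    using h_left[OF dual_mult_t_in_A[OF l w], of "[Uk]"] h_scale[OF dual_mult_t_in_A[OF l w]] by simp
  moreover have "q powr (n + n') \<noteq> 1"
    using nz q by (auto simp: powr_def)
  then have "complex_of_real (q powr (n + n')) \<noteq> 1"
    by (metis of_real_1 of_real_eq_iff)
  ultimately show ?thesis by (simp add: bform_def)
qed

text \<open>Since the counit of e is 0, invariance of h annihilates the two-term coproduct expansion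
  and links values at neighbouring columns.\<close>

lemma bform_right_e:
  "of_real (q powr m' * ladder q l m) * bform l n (m + 1) l' n' m' +
   of_real (q powr (- m) * ladder q l' m') * bform l n m l' n' (m' + 1) = 0"
proof -
  let ?D = "dual_mult (t l n m) (t l' n' m')"
  define D1 where "D1 = (if m + 1 \<in> weights l then dual_mult (t l n (m + 1)) (t l' n' m') else (\<lambda>x. 0))"
  define D2 where "D2 = (if m' + 1 \<in> weights l' then dual_mult (t l n m) (t l' n' (m' + 1)) else (\<lambda>x. 0))"
  have A: "D1 \<in> A" "D2 \<in> A"
    using l w by (auto simp: D1_def D2_def coordinate_algebra_zero intro: dual_mult_t_in_A)
  have "(\<lambda>v. ?D (v @ [Ue])) = dual_add (dual_scale (of_real (q powr m' * ladder q l m)) D1)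
      (dual_scale (of_real (q powr (- m) * ladder q l' m')) D2)"
  proof
    fix v
    have 1: "of_real (ladder q l m) * D1 v = of_real (ladder q l m) * dual_mult (t l n (m + 1)) (t l' n' m') v"
      using weights_succ[OF l(1) w(2)] by (auto simp: D1_def)
    have 2: "of_real (ladder q l' m') * D2 v = of_real (ladder q l' m') * dual_mult (t l n m) (t l' n' (m' + 1)) v"
      using weights_succ[OF l(2) w(4)] by (auto simp: D2_def)
    have "?D (v @ [Ue]) = of_real (q powr m') * (of_real (ladder q l m) * dual_mult (t l n (m + 1)) (t l' n' m') v) +
        of_real (q powr (- m)) * (of_real (ladder q l' m') * dual_mult (t l n m) (t l' n' (m' + 1)) v)"
      by (simp add: dual_mult_cop cop_append matrix_element_def rep_snoc_gen w l cop_add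
          mult_ac flip: cop_cmult del: rep.simps)
    then show "?D (v @ [Ue]) = dual_add (dual_scale (of_real (q powr m' * ladder q l m)) D1)
      (dual_scale (of_real (q powr (- m) * ladder q l' m')) D2) v"
      by (simp only: dual_add_def dual_scale_def of_real_mult mult.assoc 1 2)
  qed
  then have "h (\<lambda>v. ?D (v @ [Ue])) = of_real (q powr m' * ladder q l m) * h D1 + of_real (q powr (- m) * ladder q l' m') * h D2"
    using A by (simp only: h_add h_scale coordinate_algebra_scale)
  moreover have "h (\<lambda>v. ?D (v @ [Ue])) = 0"
    using h_right[OF dual_mult_t_in_A[OF l w], of "[Ue]"] by simp
  moreover have "h D1 = bform l n (m + 1) l' n' m'" "h D2 = bform l n m l' n' (m' + 1)"
    using w by (simp_all add: D1_def D2_def bform_def)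
  ultimately show ?thesis by simp
qed

lemma bform_left_e:
  "of_real (q powr n' * ladder q l (n - 1)) * bform l (n - 1) m l' n' m' +
   of_real (q powr (- n) * ladder q l' (n' - 1)) * bform l n m l' (n' - 1) m' = 0"
proof -
  let ?D = "dual_mult (t l n m) (t l' n' m')"
  define D1 where "D1 = (if n - 1 \<in> weights l then dual_mult (t l (n - 1) m) (t l' n' m') else (\<lambda>x. 0))"
  define D2 where "D2 = (if n' - 1 \<in> weights l' then dual_mult (t l n m) (t l' (n' - 1) m') else (\<lambda>x. 0))"
  have A: "D1 \<in> A" "D2 \<in> A"
    using l w by (auto simp: D1_def D2_def coordinate_algebra_zero intro: dual_mult_t_in_A)
  have "(\<lambda>v. ?D ([Ue] @ v)) = dual_add (dual_scale (of_real (q powr n' * ladder q l (n - 1))) D1)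
      (dual_scale (of_real (q powr (- n) * ladder q l' (n' - 1))) D2)"
  proof
    fix v
    have 1: "of_real (ladder q l (n - 1)) * D1 v = of_real (ladder q l (n - 1)) * dual_mult (t l (n - 1) m) (t l' n' m') v"
      using weights_pred[OF w(1)] by (auto simp: D1_def)
    have 2: "of_real (ladder q l' (n' - 1)) * D2 v = of_real (ladder q l' (n' - 1)) * dual_mult (t l n m) (t l' (n' - 1) m') v"
      using weights_pred[OF w(3)] by (auto simp: D2_def)
    show "?D ([Ue] @ v) = dual_add (dual_scale (of_real (q powr n' * ladder q l (n - 1))) D1)
      (dual_scale (of_real (q powr (- n) * ladder q l' (n' - 1))) D2) v"
      by (simp only: append.simps dual_mult_matrix_element_gen(3)[OF w(1,3)] dual_add_def dual_scale_def of_real_mult mult.assoc 1 2)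
  qed
  then have "h (\<lambda>v. ?D ([Ue] @ v)) = of_real (q powr n' * ladder q l (n - 1)) * h D1 + of_real (q powr (- n) * ladder q l' (n' - 1)) * h D2"
    using A by (simp only: h_add h_scale coordinate_algebra_scale)
  moreover have "h (\<lambda>v. ?D ([Ue] @ v)) = 0"
    using h_left[OF dual_mult_t_in_A[OF l w], of "[Ue]"] by simp
  moreover have "h D1 = bform l (n - 1) m l' n' m'" "h D2 = bform l n m l' (n' - 1) m'"
    using w by (simp_all add: D1_def D2_def bform_def)
  ultimately show ?thesis by simp
qed

end

text \<open>The recursion in m starts at m = l, where the ladder coefficient of spin l vanishes
  while that of the larger spin l' does not. Every lower m then follows from m + 1.\<close>

lemma bform_zero_lt:
  assumes l: "l \<in> half_nats" "l' \<in> half_nats" and lt: "l < l'"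
  shows "bform l n m l' n' m' = 0"
proof (cases "n \<in> weights l \<and> m \<in> weights l \<and> n' \<in> weights l' \<and> m' \<in> weights l' \<and> m + m' = 0")
  case False
  then show ?thesis using bform_right_k[OF l, of n m n' m'] by (auto simp: bform_def)
next
  case True
  then have w: "n \<in> weights l" "n' \<in> weights l'" by auto
  have step: "bform l n m l' n' (- m) = 0"
    if m: "m \<in> weights l" "- m \<in> weights l'" and next0: "ladder q l m = 0 \<or> bform l n (m + 1) l' n' (- (m + 1)) = 0" for m
  proof -
    have "- m - 1 \<in> weights l'"
      using weights_pred[OF m(2)] m(1) lt by (auto simp: weights_iff)
    from bform_right_e[OF l w(1) m(1) w(2) this] next0
    have "ladder q l' m = 0 \<or> bform l n m l' n' (- m) = 0"
      using q by (auto simp: ladder_uminus)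
    moreover have "ladder q l' m > 0"
      using m(1) lt by (intro ladder_pos q) (auto simp: weights_iff)
    ultimately show ?thesis by simp
  qed
  have "m \<in> weights l \<Longrightarrow> - m \<in> weights l' \<Longrightarrow> l - m = real k \<Longrightarrow> bform l n m l' n' (- m) = 0" for k m
  proof (induction k arbitrary: m)
    case (0 m)
    then show ?case using step[of m] by simp
  next
    case (Suc k m)
    have "bform l n (m + 1) l' n' (- (m + 1)) = 0"
    proof (cases "m + 1 \<in> weights l \<and> - (m + 1) \<in> weights l'")
      case True
      then show ?thesis using Suc.IH[of "m + 1"] Suc.prems(3) by simp
    qed (auto simp: bform_def)
    then show ?case using step[OF Suc.prems(1,2)] by simp
  qed
  moreover obtain k :: nat where "l - m = real k"
  proof -
    have "- m \<in> weights l" using weights_uminus[OF l(1)] True by simp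
    then show ?thesis using that by (auto simp: weights_def algebra_simps)
  qed
  moreover have "m' = - m" using True by simp
  ultimately show ?thesis using True by blast
qed

lemma bform_right_step:
  assumes l: "l \<in> half_nats" and m: "m \<in> weights l" "m + 1 \<in> weights l" and n: "n \<in> weights l" "n' \<in> weights l"
  shows "bform l n m l n' (- m) = - bform l n (m + 1) l n' (- (m + 1)) / of_real q"
proof -
  have "ladder q l m > 0" using m by (intro ladder_pos q) (auto simp: weights_iff)
  have "- m - 1 \<in> weights l" using weights_uminus[OF l, of "m + 1"] m by simp
  from bform_right_e[OF l l n(1) m(1) n(2) this]
  have "of_real (q powr (- m)) * of_real (ladder q l m) * (bform l n (m + 1) l n' (- m - 1) / of_real q + bform l n m l n' (- m)) = 0"
    using q by (simp add: ladder_uminus powr_diff distrib_left mult_ac)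
  then have "bform l n (m + 1) l n' (- m - 1) / of_real q + bform l n m l n' (- m) = 0"
    using \<open>ladder q l m > 0\<close> q by simp
  moreover have "- (m + 1) = - m - 1" by simp
  ultimately show ?thesis by (metis add_eq_0_iff minus_divide_left)
qed

lemma bform_left_step:
  assumes l: "l \<in> half_nats" and n: "n \<in> weights l" "n + 1 \<in> weights l" and m: "m \<in> weights l" "m' \<in> weights l"
  shows "bform l n m l (- n) m' = - bform l (n + 1) m l (- (n + 1)) m' / of_real q"
proof -
  have "ladder q l n > 0" using n by (intro ladder_pos q) (auto simp: weights_iff)
  have "- n \<in> weights l" using weights_uminus[OF l, of n] n by simp
  from bform_left_e[OF l l n(2) m(1) this m(2)]
  have "of_real (q powr (- n)) * of_real (ladder q l n) * (bform l (n + 1) m l (- n - 1) m' / of_real q + bform l n m l (- n) m') = 0"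
    using q by (simp add: ladder_uminus powr_diff distrib_left mult_ac) (simp add: add.commute)
  then have "bform l (n + 1) m l (- n - 1) m' / of_real q + bform l n m l (- n) m' = 0"
    using \<open>ladder q l n > 0\<close> q by simp
  moreover have "- (n + 1) = - n - 1" by simp
  ultimately show ?thesis by (metis add_eq_0_iff minus_divide_left)
qed


definition norm_sq :: "real \<Rightarrow> real \<Rightarrow> real \<Rightarrow> complex" where
  "norm_sq l n m = h (dual_mult (dual_star q (t l n m)) (t l n m))"

lemma h_star_mult:
  assumes l: "l \<in> half_nats" and w: "n \<in> weights l" "m \<in> weights l" "n' \<in> weights l'" "m' \<in> weights l'" and l': "l' \<in> half_nats"
  shows "h (dual_mult (dual_star q (t l n m)) (t l' n' m')) =
    of_real (star_phase q l n / star_phase q l m) * bform l (- n) (- m) l' n' m'"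
proof -
  have w': "- n \<in> weights l" "- m \<in> weights l" using w weights_uminus[OF l] by auto
  show ?thesis
    unfolding dual_star_matrix_element[OF q(1) l w(1,2)] dual_mult_scale_left
      h_scale[OF dual_mult_t_in_A[OF l l' w' w(3,4)]]
    using w w' by (simp add: bform_def)
qed

lemma norm_sq_eq:
  assumes l: "l \<in> half_nats" and w: "n \<in> weights l" "m \<in> weights l"
  shows "norm_sq l n m = of_real (star_phase q l n / star_phase q l m) * bform l (- n) (- m) l n m"
  unfolding norm_sq_def using h_star_mult[OF l w w l] .

text \<open>The factor -1/q in the recursion for h and the one in \<open>star_phase\<close>
  compensate each other as the column moves. This is why the normalisation \<open>t_norm\<close>
  needs only the row.\<close>

lemma norm_sq_column:
  assumes l: "l \<in> half_nats" and w: "n \<in> weights l" "m \<in> weights l" "m' \<in> weights l"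
  shows "norm_sq l n m = norm_sq l n m'"
  using w(2,3)
proof (rule weights_walk[where f="norm_sq l n", rotated])
  fix m assume m: "m \<in> weights l" "m + 1 \<in> weights l"
  have w': "- (m + 1) \<in> weights l" "- (m + 1) + 1 \<in> weights l" "- n \<in> weights l"
    using weights_uminus[OF l, of "m + 1"] weights_uminus[OF l, of m] weights_uminus[OF l, of n] m w(1) by auto
  have "bform l (- n) (- (m + 1)) l n (m + 1) = - bform l (- n) (- m) l n m / of_real q"
    using bform_right_step[OF l w'(1,2) w'(3) w(1)] by (simp add: add.commute)
  then show "norm_sq l n (m + 1) = norm_sq l n m"
    unfolding norm_sq_eq[OF l w(1) m(1)] norm_sq_eq[OF l w(1) m(2)] star_phase_step[OF q(1) m(1)]
    using q by simp
qed

text \<open>The row recursion has nonzero factors, so one vanishing norm forces its whole column to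
  vanish; yet the norms of a column add up to h(1) = 1.\<close>

lemma norm_sq_nonzero:
  assumes l: "l \<in> half_nats" and w: "n \<in> weights l" "m \<in> weights l"
  shows "norm_sq l n m \<noteq> 0"
proof
  assume z: "norm_sq l n m = 0"
  have walk: "(norm_sq l n' m = 0) = (norm_sq l n m = 0)" if "n' \<in> weights l" for n'
    using that w(1)
  proof (rule weights_walk[where f="\<lambda>n. norm_sq l n m = 0", rotated])
    fix n assume n: "n \<in> weights l" "n + 1 \<in> weights l"
    have w': "- (n + 1) \<in> weights l" "- (n + 1) + 1 \<in> weights l" "- m \<in> weights l"
      using weights_uminus[OF l, of "n + 1"] weights_uminus[OF l, of n] weights_uminus[OF l, of m] n w(2) by auto
    have "bform l (- (n + 1)) (- m) l (n + 1) m = - bform l (- n) (- m) l n m / of_real q"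
      using bform_left_step[OF l w'(1,2) w'(3) w(2)] by (simp add: add.commute)
    then show "(norm_sq l (n + 1) m = 0) = (norm_sq l n m = 0)"
      unfolding norm_sq_eq[OF l n(1) w(2)] norm_sq_eq[OF l n(2) w(2)]
      using q star_phase_nonzero[OF q(1)] by simp
  qed
  have "counit = (\<lambda>x. \<Sum>n\<in>weights l. dual_mult (dual_star q (t l n m)) (t l n m) x)"
    using sum_star_mult_matrix_element[OF q l w(2) w(2)] by (simp add: fun_eq_iff)
  then have "1 = h (\<lambda>x. \<Sum>n\<in>weights l. dual_mult (dual_star q (t l n m)) (t l n m) x)"
    using h_counit by simp
  also have "\<dots> = (\<Sum>n\<in>weights l. norm_sq l n m)"
    unfolding norm_sq_def using h_sum[of "weights l" "\<lambda>n. dual_mult (dual_star q (t l n m)) (t l n m)"] l w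
    by (simp add: coordinate_algebra_mult coordinate_algebra_star coordinate_algebra_matrix_element q)
  also have "\<dots> = 0"
    using walk z by simp
  finally show False by simp
qed

text \<open>Every column gives the same value; the lowest weight is a uniform choice.\<close>

definition t_norm :: "real \<Rightarrow> real \<Rightarrow> real" where
  "t_norm l n = sqrt (Re (norm_sq l n (- l)))"

lemma t_norm:
  assumes l: "l \<in> half_nats" and w: "n \<in> weights l" "m \<in> weights l"
  shows "t_norm l n > 0" "norm_sq l n m = of_real ((t_norm l n)\<^sup>2)"
proof -
  have wl: "- l \<in> weights l" using half_nats_ge[OF l] by (simp add: weights_iff)
  have "Im (norm_sq l n (- l)) = 0" "0 \<le> Re (norm_sq l n (- l))"
    using h_pos[OF coordinate_algebra_matrix_element[OF l w(1) wl, of q]] by (simp_all add: norm_sq_def)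
  moreover have "norm_sq l n (- l) \<noteq> 0"
    by (rule norm_sq_nonzero[OF l w(1) wl])
  ultimately have "0 < Re (norm_sq l n (- l))"
    by (simp add: complex_eq_iff less_le)
  then show "t_norm l n > 0" "norm_sq l n m = of_real ((t_norm l n)\<^sup>2)"
    using norm_sq_column[OF l w wl] \<open>Im (norm_sq l n (- l)) = 0\<close>
    by (simp_all add: t_norm_def complex_eq_iff)
qed

section \<open>The orthonormal basis of normalised matrix elements\<close>

subsection \<open>The Hilbert space\<close>

lemma iota_add: "a \<in> A \<Longrightarrow> b \<in> A \<Longrightarrow> s \<in> weights (1/2) \<Longrightarrow> \<iota> (dual_add a b) s = \<iota> a s + \<iota> b s"
  and iota_scale: "a \<in> A \<Longrightarrow> s \<in> weights (1/2) \<Longrightarrow> \<iota> (dual_scale c a) s = c *\<^sub>C \<iota> a s"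
  and iota_inner: "a \<in> A \<Longrightarrow> b \<in> A \<Longrightarrow> s \<in> weights (1/2) \<Longrightarrow> s' \<in> weights (1/2) \<Longrightarrow>
    cinner (\<iota> a s) (\<iota> b s') = (if s = s' then h (dual_mult (dual_star q a) b) else 0)"
  and iota_dense: "closure (cspan {\<iota> a s |a s. a \<in> A \<and> s \<in> weights (1/2)}) = UNIV"
  using gns unfolding is_gns_completion_def by blast+

text \<open>Hermitian symmetry of h is inherited from the inner product of the completion.\<close>

lemma h_star_commute: "a \<in> A \<Longrightarrow> b \<in> A \<Longrightarrow> h (dual_mult (dual_star q a) b) = cnj (h (dual_mult (dual_star q b) a))"
  using iota_inner[of a b "1/2" "1/2"] iota_inner[of b a "1/2" "1/2"] cinner_commute[of "\<iota> a (1/2)" "\<iota> b (1/2)"]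
  by simp

lemma h_star_mult_ortho:
  assumes l: "l \<in> half_nats" "l' \<in> half_nats"
    and w: "n \<in> weights l" "m \<in> weights l" "n' \<in> weights l'" "m' \<in> weights l'"
  shows "h (dual_mult (dual_star q (t l n m)) (t l' n' m')) =
    (if l = l' \<and> n = n' \<and> m = m' then of_real ((t_norm l n)\<^sup>2) else 0)"
proof (cases "l = l' \<and> n = n' \<and> m = m'")
  case True
  then show ?thesis using t_norm(2)[OF l(1) w(1,2)] by (simp add: norm_sq_def)
next
  case ne: False
  note mem = coordinate_algebra_matrix_element[OF l(1) w(1,2), of q] coordinate_algebra_matrix_element[OF l(2) w(3,4), of q]
  have "h (dual_mult (dual_star q (t l n m)) (t l' n' m')) = 0"
  proof -
    consider "l < l'" | "l' < l" | "l = l'" "n \<noteq> n' \<or> m \<noteq> m'" using ne by force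
    then show ?thesis
    proof cases
      case 1
      then show ?thesis using h_star_mult[OF l(1) w l(2)] bform_zero_lt[OF l] by simp
    next
      case 2
      \<comment> \<open>\<open>bform_zero_lt\<close> treats the smaller spin in the first place;
        Hermitian symmetry supplies the other order.\<close>
      then show ?thesis
        using h_star_mult[OF l(2) w(3,4,1,2) l(1)] bform_zero_lt[OF l(2,1)] h_star_commute[OF mem] by simp
    next
      case 3
      have w': "- n \<in> weights l" "- m \<in> weights l" using w weights_uminus[OF l(1)] by auto
      have "bform l (- n) (- m) l' n' m' = 0"
        using bform_left_k[OF l w' w(3,4)] bform_right_k[OF l w' w(3,4)] 3(2) by auto
      then show ?thesis using h_star_mult[OF l(1) w l(2)] by simp
    qed
  qed
  then show ?thesis unfolding if_not_P[OF ne] .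
qed

definition ev :: "real \<Rightarrow> real \<Rightarrow> real \<Rightarrow> real \<Rightarrow> 'h" where
  "ev l m n s = of_real (1 / t_norm l n) *\<^sub>C \<iota> (t l n m) s"

lemma basis_vector_eq_ev:
  assumes l: "l \<in> half_nats" and w: "m \<in> weights l" "n \<in> weights l" and s: "s \<in> weights (1/2)"
  shows "basis_vector q h \<iota> l m n s = ev l m n s"
proof -
  have "sqrt (Re (h (dual_mult (dual_star q (t l n m)) (t l n m)))) = t_norm l n"
    using t_norm[OF l w(2,1)] by (simp add: norm_sq_def[symmetric])
  then show ?thesis
    unfolding basis_vector_def ev_def Let_def
    using iota_scale[OF coordinate_algebra_matrix_element[OF l w(2,1)] s] by simp
qed

lemma iota_t_eq:
  assumes l: "l \<in> half_nats" and w: "m \<in> weights l" "n \<in> weights l"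
  shows "\<iota> (t l n m) s = of_real (t_norm l n) *\<^sub>C ev l m n s"
  using t_norm(1)[OF l w(2,1)] by (simp add: ev_def scaleC_scaleC scaleC_one flip: of_real_mult)

lemma ev_ortho:
  assumes l: "l \<in> half_nats" "l' \<in> half_nats"
    and w: "m \<in> weights l" "n \<in> weights l" "m' \<in> weights l'" "n' \<in> weights l'" and s: "s \<in> weights (1/2)" "s' \<in> weights (1/2)"
  shows "cinner (ev l m n s) (ev l' m' n' s') = (if l = l' \<and> m = m' \<and> n = n' \<and> s = s' then 1 else 0)"
proof -
  have "t_norm l n > 0" by (rule t_norm(1)[OF l(1) w(2,1)])
  then have "complex_of_real (1 / t_norm l n) * (of_real (1 / t_norm l n) * of_real ((t_norm l n)\<^sup>2)) = 1"
    by (simp add: power2_eq_square)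
  moreover have "cinner (\<iota> (t l n m) s) (\<iota> (t l' n' m') s') = (if l = l' \<and> m = m' \<and> n = n' \<and> s = s' then of_real ((t_norm l n)\<^sup>2) else 0)"
    using iota_inner[OF coordinate_algebra_matrix_element[OF l(1) w(2,1)] coordinate_algebra_matrix_element[OF l(2) w(4,3)] s]
      h_star_mult_ortho[OF l w(2,1,4,3)] by auto
  ultimately show ?thesis
    unfolding ev_def cinner_scaleC_left cinner_scaleC_right by (auto simp: mult.commute)
qed

definition ev_set :: "'h set" where
  "ev_set = {ev l m n s |l m n s. l \<in> half_nats \<and> m \<in> weights l \<and> n \<in> weights l \<and> s \<in> weights (1/2)}"

lemma iota_zero: "s \<in> weights (1/2) \<Longrightarrow> \<iota> (\<lambda>x. 0) s = 0"
  using iota_scale[OF coordinate_algebra_zero, of s 0] by (simp add: dual_scale_def complex_vector.scale_zero_left)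

lemma iota_in_span:
  assumes a: "a \<in> A" and s: "s \<in> weights (1/2)"
  shows "\<iota> a s \<in> cspan ev_set"
  using a
proof (induction rule: coordinate_algebra_induct)
  case (matrix_element l n m)
  then have "ev l m n s \<in> ev_set" using s by (auto simp: ev_set_def)
  then show ?case
    unfolding iota_t_eq[OF matrix_element(1,3,2)] by (intro complex_vector.span_scale complex_vector.span_base)
qed (use s in \<open>simp_all add: iota_zero iota_add iota_scale complex_vector.span_zero complex_vector.span_add complex_vector.span_scale\<close>)

lemma ev_set_dense: "closure (cspan ev_set) = UNIV"
proof -
  have "{\<iota> a s |a s. a \<in> A \<and> s \<in> weights (1/2)} \<subseteq> cspan ev_set"
    using iota_in_span by blast
  then have "cspan {\<iota> a s |a s. a \<in> A \<and> s \<in> weights (1/2)} \<subseteq> cspan ev_set"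
    by (rule complex_vector.span_minimal) (rule complex_vector.subspace_span)
  then have "closure (cspan {\<iota> a s |a s. a \<in> A \<and> s \<in> weights (1/2)}) \<subseteq> closure (cspan ev_set)"
    by (rule closure_mono)
  then show ?thesis using iota_dense by auto
qed

end

section \<open>Clebsch-Gordan coefficients at the edges of the weight range\<close>

section \<open>The eigenbasis of the Dirac operator\<close>

lemma sum_weights_half: "(\<Sum>s\<in>weights (1/2). f s) = f (1/2) + f (-1/2)"
  by (simp add: add.commute)

lemma cg_rows:
  assumes q: "q > 0" "q \<noteq> 1" and l: "l \<ge> 0" and M: "M \<in> weights (l + 1/2)"
  shows "(\<Sum>s\<in>weights (1/2). cg q up l M s * cg q up' l M s) = (if up = up' then 1 else 0)"
proof -
  have "l + M + 1/2 \<ge> 0" "l - M + 1/2 \<ge> 0" "(l + M + 1/2) + (l - M + 1/2) > 0"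
    using M l by (auto simp: weights_iff)
  from cgA_cgB_square[OF q this] show ?thesis
    by (auto simp: cg_def add.commute)
qed

lemma weights_spin:
  assumes "M \<in> weights (spin up l)"
  shows "M \<in> weights (l + 1/2)"
proof (cases up)
  case False
  have "M + (l - 1/2) + 1 \<in> \<int>" by (rule Ints_add) (use False assms in \<open>simp_all add: weights_iff spin_def\<close>)
  with False assms show ?thesis by (auto simp: weights_iff spin_def algebra_simps)
qed (use assms in \<open>simp add: spin_def\<close>)

lemma cg_nonweight':
  assumes l: "l \<in> half_nats" and M: "M \<in> weights (l + 1/2)" and s: "s \<in> weights (1/2)"
    and nw: "M - s \<notin> weights l"
  shows "cg q True l M s = 0" "M \<notin> weights (spin False l)"
proof -
  have int: "M - s + l \<in> \<int>"
  proof -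
    have "s + 1/2 = 0 \<or> s + 1/2 = 1" using s by auto
    then have "s + 1/2 \<in> \<int>" by (metis Ints_0 Ints_1)
    then have "M + (l + 1/2) - (s + 1/2) \<in> \<int>" using M by (intro Ints_diff) (auto simp: weights_iff)
    then show ?thesis by (simp add: algebra_simps)
  qed
  then have bad: "M - s < - l \<or> l < M - s" using nw by (auto simp: weights_iff)
  consider "s = 1/2" | "s = - (1/2)" using s by auto
  then have "s = 1/2 \<and> M = - (l + 1/2) \<or> s = - (1/2) \<and> M = l + 1/2"
  proof cases
    case 1
    have "M = - (l + 1/2)"
    proof (rule ccontr)
      assume "M \<noteq> - (l + 1/2)"
      then have "0 + 1 \<le> M + (l + 1/2)" using M by (intro Ints_cases_lt) (auto simp: weights_iff)
      then show False using bad M 1 by (auto simp: weights_iff)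
    qed
    then show ?thesis using 1 by simp
  next
    case 2
    have "M = l + 1/2"
    proof (rule ccontr)
      assume "M \<noteq> l + 1/2"
      moreover have "l + 1/2 - M \<in> \<int>"
      proof -
        have "(2 * l + 1) - (M + (l + 1/2)) \<in> \<int>"
          by (rule Ints_diff, rule Ints_add) (use half_nats_Ints[OF l] M in \<open>simp_all add: weights_iff\<close>)
        then show ?thesis by (simp add: algebra_simps)
      qed
      ultimately have "0 + 1 \<le> l + 1/2 - M" using M by (intro Ints_cases_lt) (auto simp: weights_iff)
      then show False using bad M 2 by (auto simp: weights_iff)
    qed
    then show ?thesis using 2 by simp
  qed
  then show "cg q True l M s = 0" "M \<notin> weights (spin False l)"
    by (auto simp: cg_def cgA_def cgB_def weights_iff spin_def)
qed

lemma cg_nonweight_spin: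
  assumes l: "l \<in> half_nats" and M: "M \<in> weights (spin up l)" and s: "s \<in> weights (1/2)"
    and nw: "M - s \<notin> weights l"
  shows "cg q up l M s = 0"
  using cg_nonweight'[OF l weights_spin[OF M] s nw] M by (cases up) auto

section \<open>Cancellation and decay of the entries between different signs\<close>

subsection \<open>Off-diagonal matrix elements of the generators\<close>

text \<open>\<open>\<Sum>s. \<langle>l+1/2,up',M+\<epsilon>| (t \<otimes> 1) |l,up,M\<rangle>\<close>, where \<open>t\<close> raises the spin; a \<open>q\<close>-6j-symbol times a
  Clebsch-Gordan coefficient.\<close>

definition raising :: "real \<Rightarrow> bool \<Rightarrow> bool \<Rightarrow> real \<Rightarrow> real \<Rightarrow> real \<Rightarrow> real" where
  "raising q up up' l M \<epsilon> = (\<Sum>s\<in>weights (1/2).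
     cg q up' (l + 1/2) (M + \<epsilon>) s * cg q up l M s * cg (inverse q) True l (M - s + \<epsilon>) \<epsilon>)"

text \<open>Bookkeeping for a sum of two triple products: the p's stand for powers of q, x, y, z for
  roots of q-integers, and D, D' for the normalising denominators.\<close>

lemma regroup_two_terms_y: "- (p1 * y * D') * (p2 * x * D) * (p3 * x * D) + (p4 * z * D') * (p5 * y * D) * (p6 * z * D) =
    (- ((p1 * p2 * p3) * (x * x)) + (p4 * p5 * p6) * (z * z)) * (y * (D * D) * D')" for x :: real
  by (simp add: algebra_simps)

lemma regroup_two_terms_zx: "- (p1 * z * D') * (p2 * y * D) * (p3 * z * D) + (p4 * y * D') * (p5 * x * D) * (p6 * x * D) =
    (- ((p1 * p2 * p3) * (z * z)) + (p4 * p5 * p6) * (x * x)) * (y * (D * D) * D')" for x :: real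
  by (simp add: algebra_simps)

context
  fixes q a b :: real
  assumes q: "q > 0" "q \<noteq> 1" and ab: "a \<ge> 0" "b \<ge> 0" "a + b \<ge> 1"
begin

lemma sqrt_qint_sq:
  "sqrt (qint q a) * sqrt (qint q a) = qint q a" "sqrt (qint q b) * sqrt (qint q b) = qint q b"
  "sqrt (qint q (a + 1)) * sqrt (qint q (a + 1)) = qint q (a + 1)"
  "sqrt (qint q (b + 1)) * sqrt (qint q (b + 1)) = qint q (b + 1)"
  "sqrt (qint q (a + b)) * sqrt (qint q (a + b)) = qint q (a + b)"
  using ab qint_nonneg[OF q(1)] by simp_all

text \<open>The case \<epsilon> = 1/2. From the lower to the upper sign both terms carry the same
  power of q and cancel. From upper to lower, q[a+1] - [a] = q^(a+1) leaves 1/[a+b] times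
  q^((a+1)/2) sqrt([b]/[a+b+1]), and this last factor is at most 1 by
  \<open>qint_add\<close>.\<close>

lemma raising_plus:
  "cgA q (a + 1) b * (- cgB q a b) * cgB q b a + cgB q (a + 1) b * cgA q a b * cgB q (b - 1) (a + 1) = 0"
  "\<bar>- cgB q (a + 1) b * cgA q a b * cgB q b a + cgA q (a + 1) b * cgB q a b * cgB q (b - 1) (a + 1)\<bar> \<le> 1 / qint q (a + b)"
proof -
  define D D' where "D = inverse (sqrt (qint q (a + b)))" and "D' = inverse (sqrt (qint q (a + b + 1)))"
  have DD: "D * D = 1 / qint q (a + b)" "D' > 0" "qint q (a + b) > 0" "qint q (a + b + 1) > 0" "D > 0"
    using sqrt_qint_sq(5) qint_pos[OF q, of "a + b + 1"] qint_pos[OF q, of "a + b"] ab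
    by (simp_all add: D_def D'_def inverse_eq_divide)
  have ba: "b + a = a + b" "b - 1 + (a + 1) = a + b" "a + 1 + b = a + b + 1" by simp_all
  have e: "cgA q (a + 1) b = q powr (b/2) * sqrt (qint q (a + 1)) * D'"
    "cgB q (a + 1) b = q powr (- ((a + 1)/2)) * sqrt (qint q b) * D'"
    "cgA q a b = q powr (b/2) * sqrt (qint q a) * D" "cgB q a b = q powr (- (a/2)) * sqrt (qint q b) * D"
    "cgB q b a = q powr (- (b/2)) * sqrt (qint q a) * D"
    "cgB q (b - 1) (a + 1) = q powr (- ((b - 1)/2)) * sqrt (qint q (a + 1)) * D"
    by (simp_all only: cgA_def cgB_def D_def D'_def divide_inverse ba)
  have "cgA q (a + 1) b * cgB q a b * cgB q b a =
      (q powr (b/2) * q powr (- (a/2)) * q powr (- (b/2))) * (sqrt (qint q (a + 1)) * sqrt (qint q b) * sqrt (qint q a) * D * D * D')"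
    unfolding e by (simp only: mult_ac)
  also have "q powr (b/2) * q powr (- (a/2)) * q powr (- (b/2)) =
      q powr (- ((a + 1)/2)) * q powr (b/2) * q powr (- ((b - 1)/2))"
    unfolding powr_add[symmetric] by (rule arg_cong[where f="\<lambda>x. q powr x"]) (simp add: field_simps)
  also have "\<dots> * (sqrt (qint q (a + 1)) * sqrt (qint q b) * sqrt (qint q a) * D * D * D') =
      cgB q (a + 1) b * cgA q a b * cgB q (b - 1) (a + 1)"
    unfolding e by (simp only: mult_ac)
  finally show "cgA q (a + 1) b * (- cgB q a b) * cgB q b a + cgB q (a + 1) b * cgA q a b * cgB q (b - 1) (a + 1) = 0"
    by simp
  have pw: "q powr (- ((a + 1)/2)) * q powr (b/2) * q powr (- (b/2)) = q powr (- ((a + 1)/2))"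
    "q powr (b/2) * q powr (- (a/2)) * q powr (- ((b - 1)/2)) = q powr (- ((a + 1)/2)) * q"
    "q powr (- ((a + 1)/2)) * q powr (a + 1) = q powr ((a + 1)/2)"
    "(q powr ((a + 1)/2))\<^sup>2 = q powr (a + 1)"
  proof -
    have q1: "q powr x * q = q powr (x + 1)" for x using q by (simp add: powr_add)
    show "q powr (b/2) * q powr (- (a/2)) * q powr (- ((b - 1)/2)) = q powr (- ((a + 1)/2)) * q"
      unfolding q1 powr_add[symmetric] by (rule arg_cong[where f="\<lambda>x. q powr x"]) (simp add: field_simps)
  qed (unfold power2_eq_square powr_add[symmetric], (rule arg_cong[where f="\<lambda>x. q powr x"], simp add: field_simps)+)
  have "- cgB q (a + 1) b * cgA q a b * cgB q b a + cgA q (a + 1) b * cgB q a b * cgB q (b - 1) (a + 1) =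
     (- ((q powr (- ((a + 1)/2)) * q powr (b/2) * q powr (- (b/2))) * (sqrt (qint q a) * sqrt (qint q a))) +
      (q powr (b/2) * q powr (- (a/2)) * q powr (- ((b - 1)/2))) * (sqrt (qint q (a + 1)) * sqrt (qint q (a + 1)))) *
     (sqrt (qint q b) * (D * D) * D')"
    unfolding e by (rule regroup_two_terms_y)
  also have "\<dots> = (q powr (- ((a + 1)/2)) * (q * qint q (a + 1) - qint q a)) * (sqrt (qint q b) * (D * D) * D')"
    unfolding pw sqrt_qint_sq by (simp add: algebra_simps)
  also have "q * qint q (a + 1) - qint q a = q powr (a + 1)"
    using qint_add[OF q(1), of 1 a] q by (simp add: powr_add powr_minus add.commute[of 1 a] distrib_left)
  also have "q powr (- ((a + 1)/2)) * q powr (a + 1) = q powr ((a + 1)/2)" by (rule pw)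
  finally have R: "- cgB q (a + 1) b * cgA q a b * cgB q b a + cgA q (a + 1) b * cgB q a b * cgB q (b - 1) (a + 1) =
      (q powr ((a + 1)/2) * sqrt (qint q b) * D') * (1 / qint q (a + b))"
    by (simp only: DD mult_ac)
  have "q powr (a + 1) * qint q b \<le> qint q (a + b + 1)"
    using qint_add[OF q(1), of b "a + 1"] qint_nonneg[OF q(1), of "a + 1"] ab by (simp add: add_ac)
  then have "sqrt (q powr (a + 1) * qint q b) \<le> sqrt (qint q (a + b + 1))"
    by (rule real_sqrt_le_mono)
  also have "sqrt (q powr (a + 1) * qint q b) = q powr ((a + 1)/2) * sqrt (qint q b)"
    unfolding real_sqrt_mult pw(4)[symmetric] by simp
  finally have "q powr ((a + 1)/2) * sqrt (qint q b) * D' \<le> 1"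
    using DD(4) by (simp add: D'_def divide_inverse[symmetric])
  moreover have "0 \<le> q powr ((a + 1)/2) * sqrt (qint q b) * D'"
    using DD qint_nonneg[OF q(1) ab(2)] by simp
  ultimately show "\<bar>- cgB q (a + 1) b * cgA q a b * cgB q b a + cgA q (a + 1) b * cgB q a b * cgB q (b - 1) (a + 1)\<bar> \<le> 1 / qint q (a + b)"
    unfolding R abs_mult using DD(3) by (simp add: divide_le_eq_1 mult_left_le_one_le divide_right_mono)
qed

text \<open>The case \<epsilon> = -1/2, with [b+1] - q[b] = q^(-b) in the role of the previous
  difference.\<close>

lemma raising_minus:
  "cgA q a (b + 1) * (- cgB q a b) * cgA q (b + 1) (a - 1) + cgB q a (b + 1) * cgA q a b * cgA q b a = 0"
  "\<bar>- cgB q a (b + 1) * cgA q a b * cgA q (b + 1) (a - 1) + cgA q a (b + 1) * cgB q a b * cgA q b a\<bar> \<le> 1 / qint q (a + b)"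
proof -
  define D D' where "D = inverse (sqrt (qint q (a + b)))" and "D' = inverse (sqrt (qint q (a + b + 1)))"
  have DD: "D * D = 1 / qint q (a + b)" "D' > 0" "qint q (a + b) > 0" "qint q (a + b + 1) > 0" "D > 0"
    using sqrt_qint_sq(5) qint_pos[OF q, of "a + b + 1"] qint_pos[OF q, of "a + b"] ab
    by (simp_all add: D_def D'_def inverse_eq_divide)
  have ba: "b + a = a + b" "b + 1 + (a - 1) = a + b" "a + (b + 1) = a + b + 1" by simp_all
  have e: "cgA q a (b + 1) = q powr ((b + 1)/2) * sqrt (qint q a) * D'"
    "cgB q a (b + 1) = q powr (- (a/2)) * sqrt (qint q (b + 1)) * D'"
    "cgA q a b = q powr (b/2) * sqrt (qint q a) * D" "cgB q a b = q powr (- (a/2)) * sqrt (qint q b) * D"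
    "cgA q b a = q powr (a/2) * sqrt (qint q b) * D"
    "cgA q (b + 1) (a - 1) = q powr ((a - 1)/2) * sqrt (qint q (b + 1)) * D"
    by (simp_all only: cgA_def cgB_def D_def D'_def divide_inverse ba)
  have "cgA q a (b + 1) * cgB q a b * cgA q (b + 1) (a - 1) =
      (q powr ((b + 1)/2) * q powr (- (a/2)) * q powr ((a - 1)/2)) * (sqrt (qint q (b + 1)) * sqrt (qint q b) * sqrt (qint q a) * D * D * D')"
    unfolding e by (simp only: mult_ac)
  also have "q powr ((b + 1)/2) * q powr (- (a/2)) * q powr ((a - 1)/2) =
      q powr (- (a/2)) * q powr (b/2) * q powr (a/2)"
    unfolding powr_add[symmetric] by (rule arg_cong[where f="\<lambda>x. q powr x"]) (simp add: field_simps)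
  also have "\<dots> * (sqrt (qint q (b + 1)) * sqrt (qint q b) * sqrt (qint q a) * D * D * D') =
      cgB q a (b + 1) * cgA q a b * cgA q b a"
    unfolding e by (simp only: mult_ac)
  finally show "cgA q a (b + 1) * (- cgB q a b) * cgA q (b + 1) (a - 1) + cgB q a (b + 1) * cgA q a b * cgA q b a = 0"
    by simp
  have pw: "q powr (- (a/2)) * q powr (b/2) * q powr ((a - 1)/2) = q powr ((b - 1)/2)"
    "q powr ((b + 1)/2) * q powr (- (a/2)) * q powr (a/2) = q powr ((b - 1)/2) * q"
    "q powr ((b - 1)/2) * q powr (- b) = q powr (- ((b + 1)/2))"
    "(q powr (- ((b + 1)/2)))\<^sup>2 = q powr (- (b + 1))"
  proof -
    have q1: "q powr x * q = q powr (x + 1)" for x using q by (simp add: powr_add)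
    show "q powr ((b + 1)/2) * q powr (- (a/2)) * q powr (a/2) = q powr ((b - 1)/2) * q"
      unfolding q1 powr_add[symmetric] by (rule arg_cong[where f="\<lambda>x. q powr x"]) (simp add: field_simps)
  qed (unfold power2_eq_square powr_add[symmetric], (rule arg_cong[where f="\<lambda>x. q powr x"], simp add: field_simps)+)
  have "- cgB q a (b + 1) * cgA q a b * cgA q (b + 1) (a - 1) + cgA q a (b + 1) * cgB q a b * cgA q b a =
     (- ((q powr (- (a/2)) * q powr (b/2) * q powr ((a - 1)/2)) * (sqrt (qint q (b + 1)) * sqrt (qint q (b + 1)))) +
      (q powr ((b + 1)/2) * q powr (- (a/2)) * q powr (a/2)) * (sqrt (qint q b) * sqrt (qint q b))) *
     (sqrt (qint q a) * (D * D) * D')"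
    unfolding e by (rule regroup_two_terms_zx)
  also have "\<dots> = - (q powr ((b - 1)/2) * (qint q (b + 1) - q * qint q b)) * (sqrt (qint q a) * (D * D) * D')"
    unfolding pw sqrt_qint_sq by (simp add: algebra_simps)
  also have "qint q (b + 1) - q * qint q b = q powr (- b)"
    using qint_add[OF q(1), of b 1] q by simp
  also have "q powr ((b - 1)/2) * q powr (- b) = q powr (- ((b + 1)/2))" by (rule pw)
  finally have R: "- cgB q a (b + 1) * cgA q a b * cgA q (b + 1) (a - 1) + cgA q a (b + 1) * cgB q a b * cgA q b a =
      - ((q powr (- ((b + 1)/2)) * sqrt (qint q a) * D') * (1 / qint q (a + b)))"
    by (simp only: DD mult_ac mult_minus_left mult_minus_right)
  have "q powr (- (b + 1)) * qint q a \<le> qint q (a + b + 1)"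
    using qint_add[OF q(1), of "b + 1" a] qint_nonneg[OF q(1), of "b + 1"] ab by (simp add: add_ac)
  then have "sqrt (q powr (- (b + 1)) * qint q a) \<le> sqrt (qint q (a + b + 1))"
    by (rule real_sqrt_le_mono)
  also have "sqrt (q powr (- (b + 1)) * qint q a) = q powr (- ((b + 1)/2)) * sqrt (qint q a)"
    unfolding real_sqrt_mult pw(4)[symmetric] by simp
  finally have "q powr (- ((b + 1)/2)) * sqrt (qint q a) * D' \<le> 1"
    using DD(4) by (simp add: D'_def divide_inverse[symmetric])
  moreover have "0 \<le> q powr (- ((b + 1)/2)) * sqrt (qint q a) * D'"
    using DD qint_nonneg[OF q(1) ab(1)] by simp
  ultimately show "\<bar>- cgB q a (b + 1) * cgA q a b * cgA q (b + 1) (a - 1) + cgA q a (b + 1) * cgB q a b * cgA q b a\<bar> \<le> 1 / qint q (a + b)"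
    unfolding R abs_mult abs_minus_cancel using DD(3) by (simp add: divide_le_eq_1 mult_left_le_one_le divide_right_mono)
qed

end

lemma raising_bound:
  assumes q: "q > 0" "q \<noteq> 1" and l: "l \<in> half_nats" and M: "M \<in> weights (spin up l)"
    and \<epsilon>: "\<epsilon> \<in> weights (1/2)" and ne: "up \<noteq> up'"
  shows "\<bar>raising q up up' l M \<epsilon>\<bar> \<le> 1 / qint q (2 * l + 1)"
proof -
  define a b where "a = l + M + 1/2" and "b = l - M + 1/2"
  have ab: "a \<ge> 0" "b \<ge> 0" "a + b \<ge> 1"
    using weights_spin[OF M] half_nats_ge[OF l] by (auto simp: a_def b_def weights_iff)
  have sum: "2 * l + 1 = a + b" by (simp add: a_def b_def)
  have nonneg: "0 \<le> 1 / qint q (a + b)" using qint_nonneg[OF q(1), of "a + b"] ab by simp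
  note sw = cgA_swap[OF q] cgB_swap[OF q]
  consider "\<epsilon> = 1/2" | "\<epsilon> = - (1/2)" using \<epsilon> by auto
  then show ?thesis
  proof cases
    case 1
    have r: "l + 1/2 + (M + 1/2) + 1/2 = a + 1" "l + 1/2 - (M + 1/2) + 1/2 = b" "l + M + 1/2 = a" "l - M + 1/2 = b"
      "l + (M - 1/2 + 1/2) + 1/2 = a" "l - (M - 1/2 + 1/2) + 1/2 = b"
      "l + (M - -1/2 + 1/2) + 1/2 = a + 1" "l - (M - -1/2 + 1/2) + 1/2 = b - 1"
      by (simp_all add: a_def b_def)
    have "raising q up up' l M \<epsilon> = (if up then - cgB q (a + 1) b * cgA q a b * cgB q b a + cgA q (a + 1) b * cgB q a b * cgB q (b - 1) (a + 1)
      else cgA q (a + 1) b * (- cgB q a b) * cgB q b a + cgB q (a + 1) b * cgA q a b * cgB q (b - 1) (a + 1))"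
      using ne unfolding raising_def sum_weights_half 1 cg_def r sw
      by (cases up; cases up') simp_all
    then show ?thesis
      using raising_plus[OF q ab] nonneg unfolding sum by (cases up) auto
  next
    case 2
    have r: "l + 1/2 + (M + - (1/2)) + 1/2 = a" "l + 1/2 - (M + - (1/2)) + 1/2 = b + 1" "l + M + 1/2 = a" "l - M + 1/2 = b"
      "l + (M - 1/2 + - (1/2)) + 1/2 = a - 1" "l - (M - 1/2 + - (1/2)) + 1/2 = b + 1"
      "l + (M - -1/2 + - (1/2)) + 1/2 = a" "l - (M - -1/2 + - (1/2)) + 1/2 = b"
      by (simp_all add: a_def b_def)
    have "raising q up up' l M \<epsilon> = (if up then - cgB q a (b + 1) * cgA q a b * cgA q (b + 1) (a - 1) + cgA q a (b + 1) * cgB q a b * cgA q b a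
      else cgA q a (b + 1) * (- cgB q a b) * cgA q (b + 1) (a - 1) + cgB q a (b + 1) * cgA q a b * cgA q b a)"
      using ne unfolding raising_def sum_weights_half 2 cg_def r sw
      by (cases up; cases up') simp_all
    then show ?thesis
      using raising_minus[OF q ab] nonneg unfolding sum by (cases up) auto
  qed
qed

context gns
begin

section \<open>Uncoupled and coupled orthonormal bases of H\<close>

subsection \<open>Bases of the Hilbert space\<close>

abbreviation J :: "nat \<Rightarrow> real" where "J N \<equiv> real N / 2"

lemma J_half_nats [simp]: "J N \<in> half_nats"
  by (auto simp: half_nats_def)

definition ev_idx :: "(real \<times> real \<times> real \<times> real) set" where
  "ev_idx = {(l, m, n, s). l \<in> half_nats \<and> m \<in> weights l \<and> n \<in> weights l \<and> s \<in> weights (1/2)}"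

definition ev_fam :: "real \<times> real \<times> real \<times> real \<Rightarrow> 'h" where
  "ev_fam = (\<lambda>(l, m, n, s). ev l m n s)"

sublocale evb: onb_family ev_fam ev_idx
proof
  show "cinner (ev_fam i) (ev_fam j) = (if i = j then 1 else 0)" if "i \<in> ev_idx" "j \<in> ev_idx" for i j
    using that by (cases i; cases j) (simp add: ev_idx_def ev_fam_def ev_ortho del: weights_half)
  have "ev_set = ev_fam ` ev_idx"
    by (force simp: ev_set_def ev_fam_def ev_idx_def)
  then show "closure (cspan (ev_fam ` ev_idx)) = UNIV" using ev_set_dense by simp
qed

text \<open>\<open>eb (N, up, n, M)\<close> spans, for \<open>M\<close> ranging over the weights of \<open>spin up (N/2)\<close>, a copy of that
  representation in \<open>W\<^sup>\<up>\<close> or \<open>W\<^sup>\<down>\<close>.\<close>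

definition idx :: "(nat \<times> bool \<times> real \<times> real) set" where
  "idx = {(N, up, n, M). n \<in> weights (J N) \<and> M \<in> weights (spin up (J N))}"

definition eb :: "nat \<times> bool \<times> real \<times> real \<Rightarrow> 'h" where
  "eb = (\<lambda>(N, up, n, M). \<Sum>s\<in>weights (1/2). of_real (cg q up (J N) M s) *\<^sub>C ev (J N) (M - s) n s)"

lemma cinner_ev_eb:
  assumes i: "(N, up, n, M) \<in> idx" and l: "l \<in> half_nats" and w: "m \<in> weights l" "n' \<in> weights l" and s: "s \<in> weights (1/2)"
  shows "cinner (ev l m n' s) (eb (N, up, n, M)) = (if l = J N \<and> n' = n \<and> m + s = M then of_real (cg q up (J N) M s) else 0)"
proof -
  have "cinner (ev l m n' s) (eb (N, up, n, M)) =
      (\<Sum>s2\<in>weights (1/2). of_real (cg q up (J N) M s2) * cinner (ev l m n' s) (ev (J N) (M - s2) n s2))"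
    by (simp only: eb_def prod.case cinner_sum_right cinner_scaleC_right)
  also have "\<dots> = (\<Sum>s2\<in>weights (1/2). if s = s2 then (if l = J N \<and> n' = n \<and> m + s = M then of_real (cg q up (J N) M s) else 0) else 0)"
  proof (intro sum.cong refl)
    fix s2 assume s2: "s2 \<in> weights (1/2)"
    show "of_real (cg q up (J N) M s2) * cinner (ev l m n' s) (ev (J N) (M - s2) n s2) =
        (if s = s2 then (if l = J N \<and> n' = n \<and> m + s = M then of_real (cg q up (J N) M s) else 0) else 0)"
    proof (cases "M - s2 \<in> weights (J N)")
      case True
      have "n \<in> weights (J N)" using i by (simp add: idx_def)
      then have "cinner (ev l m n' s) (ev (J N) (M - s2) n s2) = (if l = J N \<and> m = M - s2 \<and> n' = n \<and> s = s2 then 1 else 0)"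
        using True s s2 w l by (intro ev_ortho) auto
      then show ?thesis by auto
    next
      case False
      \<comment> \<open>Outside the weights nothing is known about \<open>ev\<close>; the vanishing
        coefficient removes the term.\<close>
      then have c: "cg q up (J N) M s2 = 0"
        using i s2 by (intro cg_nonweight_spin) (auto simp: idx_def)
      have "\<not> (s = s2 \<and> l = J N \<and> m + s = M)"
      proof
        assume a: "s = s2 \<and> l = J N \<and> m + s = M"
        then have "M - s2 = m" by auto
        then show False using False w(1) a by metis
      qed
      then show ?thesis using c by auto
    qed
  qed
  also have "\<dots> = (if l = J N \<and> n' = n \<and> m + s = M then of_real (cg q up (J N) M s) else 0)"
    using s by (subst sum.delta') simp_all
  finally show ?thesis .
qed

lemma eb_ortho:
  assumes i: "(N, up, n, M) \<in> idx" and i': "(N', up', n', M') \<in> idx"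
  shows "cinner (eb (N, up, n, M)) (eb (N', up', n', M')) = (if (N, up, n, M) = (N', up', n', M') then 1 else 0)"
proof -
  have M: "M \<in> weights (J N + 1/2)" using i weights_spin by (auto simp: idx_def)
  have "cinner (eb (N, up, n, M)) (eb (N', up', n', M')) =
      (\<Sum>s\<in>weights (1/2). of_real (cg q up (J N) M s) * cinner (ev (J N) (M - s) n s) (eb (N', up', n', M')))"
    unfolding eb_def[of] prod.case cinner_sum_left cinner_scaleC_left by simp
  also have "\<dots> = (\<Sum>s\<in>weights (1/2). of_real (cg q up (J N) M s) * (if N = N' \<and> n = n' \<and> M = M' then of_real (cg q up' (J N) M s) else 0))"
  proof (intro sum.cong refl)
    fix s assume s: "s \<in> weights (1/2)"
    show "of_real (cg q up (J N) M s) * cinner (ev (J N) (M - s) n s) (eb (N', up', n', M')) =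
      of_real (cg q up (J N) M s) * (if N = N' \<and> n = n' \<and> M = M' then of_real (cg q up' (J N) M s) else 0)"
    proof (cases "M - s \<in> weights (J N)")
      case True
      have "n \<in> weights (J N)" using i by (simp add: idx_def)
      from cinner_ev_eb[OF i' J_half_nats True this s] show ?thesis by auto
    next
      case False
      then have "cg q up (J N) M s = 0"
        using i s by (intro cg_nonweight_spin) (auto simp: idx_def)
      then show ?thesis by simp
    qed
  qed
  also have "\<dots> = (if N = N' \<and> n = n' \<and> M = M' then of_real (\<Sum>s\<in>weights (1/2). cg q up (J N) M s * cg q up' (J N) M s) else 0)"
    by (simp only: of_real_sum of_real_mult) auto
  also have "\<dots> = (if (N, up, n, M) = (N', up', n', M') then 1 else 0)"
    unfolding cg_rows[OF q half_nats_ge[OF J_half_nats] M] by auto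
  finally show ?thesis .
qed

text \<open>Inverse of the coupling, by completeness of the Clebsch-Gordan coefficients; it carries
  density of the span over to the coupled basis.\<close>

lemma ev_eq_eb:
  assumes w: "m \<in> weights (J N)" and s: "s \<in> weights (1/2)"
  shows "ev (J N) m n s = (\<Sum>up\<in>UNIV. of_real (cg q up (J N) (m + s) s) *\<^sub>C eb (N, up, n, m + s))"
proof -
  have "(\<Sum>up\<in>UNIV. of_real (cg q up (J N) (m + s) s) *\<^sub>C eb (N, up, n, m + s)) =
      (\<Sum>up\<in>UNIV. \<Sum>s'\<in>weights (1/2). of_real (cg q up (J N) (m + s) s * cg q up (J N) (m + s) s') *\<^sub>C ev (J N) (m + s - s') n s')"
    by (simp only: eb_def prod.case scaleC_sum_right scaleC_scaleC of_real_mult)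
  also have "\<dots> = (\<Sum>s'\<in>weights (1/2). of_real (\<Sum>up\<in>UNIV. cg q up (J N) (m + s) s * cg q up (J N) (m + s) s') *\<^sub>C ev (J N) (m + s - s') n s')"
    by (subst sum.swap) (simp only: of_real_sum complex_vector.scale_sum_left)
  also have "\<dots> = (\<Sum>s'\<in>weights (1/2). if s = s' then ev (J N) (m + s - s') n s' else 0)"
  proof (intro sum.cong refl)
    fix s' assume s': "s' \<in> weights (1/2)"
    have "(\<Sum>up\<in>UNIV. cg q up (J N) (m + s) s * cg q up (J N) (m + s) s') = (if s = s' then 1 else 0)"
      using cg_complete[OF q half_nats_ge[OF J_half_nats] w s s'] by (auto simp add: UNIV_bool mult.commute add.commute)
    then show "of_real (\<Sum>up\<in>UNIV. cg q up (J N) (m + s) s * cg q up (J N) (m + s) s') *\<^sub>C ev (J N) (m + s - s') n s' =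
        (if s = s' then ev (J N) (m + s - s') n s' else 0)"
      by (simp only:) (simp add: scaleC_one complex_vector.scale_zero_left)
  qed
  also have "\<dots> = ev (J N) m n s"
    using s by (subst sum.delta') simp_all
  finally show ?thesis ..
qed

lemma ev_in_span_eb:
  assumes w: "m \<in> weights (J N)" "n \<in> weights (J N)" and s: "s \<in> weights (1/2)"
  shows "ev (J N) m n s \<in> cspan (eb ` {i \<in> idx. \<exists>up. i = (N, up, n, m + s)})"
  unfolding ev_eq_eb[OF w(1) s]
proof (rule complex_vector.span_sum)
  fix up
  show "of_real (cg q up (J N) (m + s) s) *\<^sub>C eb (N, up, n, m + s) \<in> cspan (eb ` {i \<in> idx. \<exists>up. i = (N, up, n, m + s)})"
  proof (cases "m + s \<in> weights (spin up (J N))")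
    case True
    then show ?thesis using w
      by (intro complex_vector.span_scale complex_vector.span_base imageI) (auto simp: idx_def)
  next
    case False
    then have "cg q up (J N) (m + s) s = 0" using cg_nonweight[OF J_half_nats w(1) s] by simp
    then show ?thesis by (simp only: of_real_0 complex_vector.scale_zero_left complex_vector.span_zero)
  qed
qed

sublocale ebb: onb_family eb idx
proof
  show "cinner (eb i) (eb j) = (if i = j then 1 else 0)" if "i \<in> idx" "j \<in> idx" for i j
    using that by (cases i; cases j) (simp only: eb_ortho)
  have "ev_set \<subseteq> cspan (eb ` idx)"
  proof
    fix v assume "v \<in> ev_set"
    then obtain N m n s where v: "v = ev (J N) m n s" "m \<in> weights (J N)" "n \<in> weights (J N)" "s \<in> weights (1/2)"
      by (auto simp: ev_set_def half_nats_def)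
    show "v \<in> cspan (eb ` idx)"
      using ev_in_span_eb[OF v(2-4)] complex_vector.span_mono[of "eb ` {i \<in> idx. \<exists>up. i = (N, up, n, m + s)}" "eb ` idx"]
      unfolding v(1) by blast
  qed
  then have "cspan ev_set \<subseteq> cspan (eb ` idx)"
    by (rule complex_vector.span_minimal) (rule complex_vector.subspace_span)
  then have "closure (cspan ev_set) \<subseteq> closure (cspan (eb ` idx))" by (rule closure_mono)
  then show "closure (cspan (eb ` idx)) = UNIV" using ev_set_dense by auto
qed

section \<open>Coupled vectors as eigenvectors of D\<close>

subsection \<open>The isotypic components\<close>

lemma sum_list_scaleC_sum:
  "(\<Sum>(u, v)\<leftarrow>xs. \<Sum>m'\<in>X. \<Sum>s'\<in>Y. (f m' s' u v) *\<^sub>C b m' s') =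
   (\<Sum>m'\<in>X. \<Sum>s'\<in>Y. (\<Sum>(u, v)\<leftarrow>xs. f m' s' u v) *\<^sub>C (b m' s' :: 'h))"
  by (induction xs) (auto simp: scaleC_add_left sum.distrib complex_vector.scale_zero_left)

text \<open>Acting on the uncoupled expansion produces matrix elements of the tensor product
  contracted with a coupled vector, which \<open>cg_right\<close> turns into matrix elements of a
  single spin.\<close>

lemma uq_action_eb:
  assumes i: "(N, up, n, M) \<in> idx"
  shows "uq_action q h \<iota> (J N) x (eb (N, up, n, M)) =
    (\<Sum>M'\<in>weights (spin up (J N)). rep q (spin up (J N)) x M' M *\<^sub>C eb (N, up, n, M'))"
proof -
  define l where "l = J N"
  have l: "l \<in> half_nats" by (simp add: l_def)
  have n: "n \<in> weights l" and M: "M \<in> weights (spin up l)" using i by (auto simp: idx_def l_def)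
  define X where "X m n' s = (\<Sum>m'\<in>weights l. \<Sum>s'\<in>weights (1/2). dual_mult (t l m' m) (t (1/2) s' s) x *\<^sub>C ev l m' n' s')" for m n' s
  have inner: "(\<Sum>(x', x'')\<leftarrow>coproduct x. \<Sum>m'\<in>weights l. \<Sum>s'\<in>weights (1/2).
      (rep q l x' m' m * rep q (1/2) x'' s' s) *\<^sub>C basis_vector q h \<iota> l m' n' s') = X m n' s"
    if "n' \<in> weights l" for m n' s
    unfolding sum_list_scaleC_sum X_def
    by (intro sum.cong refl) (simp only: dual_mult_def matrix_element_def basis_vector_eq_ev[OF l _ that])
  have "uq_action q h \<iota> l x (eb (N, up, n, M)) =
      (\<Sum>m\<in>weights l. \<Sum>n'\<in>weights l. \<Sum>s\<in>weights (1/2). (if n' = n then (if m = M - s then of_real (cg q up l M s) else 0) else 0) *\<^sub>C X m n' s)"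
    unfolding uq_action_def
  proof (intro sum.cong refl)
    fix m n' s assume w: "m \<in> weights l" "n' \<in> weights l" "s \<in> weights (1/2)"
    have "cinner (basis_vector q h \<iota> l m n' s) (eb (N, up, n, M)) = (if n' = n then (if m = M - s then of_real (cg q up l M s) else 0) else 0)"
      unfolding basis_vector_eq_ev[OF l w] cinner_ev_eb[OF i l w] by (auto simp: l_def)
    then show "cinner (basis_vector q h \<iota> l m n' s) (eb (N, up, n, M)) *\<^sub>C
        (\<Sum>(x', x'')\<leftarrow>coproduct x. \<Sum>m'\<in>weights l. \<Sum>s'\<in>weights (1/2).
          (rep q l x' m' m * rep q (1/2) x'' s' s) *\<^sub>C basis_vector q h \<iota> l m' n' s') =
        (if n' = n then (if m = M - s then of_real (cg q up l M s) else 0) else 0) *\<^sub>C X m n' s"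
      by (simp only: inner[OF w(2)])
  qed
  also have "\<dots> = (\<Sum>s\<in>weights (1/2). \<Sum>m\<in>weights l. \<Sum>n'\<in>weights l. if n' = n then (if m = M - s then of_real (cg q up l M s) else 0) *\<^sub>C X m n' s else 0)"
  proof -
    have "(\<Sum>m\<in>weights l. \<Sum>n'\<in>weights l. \<Sum>s\<in>weights (1/2). f m n' s) = (\<Sum>s\<in>weights (1/2). \<Sum>m\<in>weights l. \<Sum>n'\<in>weights l. f m n' s)"
      for f :: "real \<Rightarrow> real \<Rightarrow> real \<Rightarrow> 'h"
    proof -
      have "(\<Sum>n'\<in>weights l. \<Sum>s\<in>weights (1/2). f m n' s) = (\<Sum>s\<in>weights (1/2). \<Sum>n'\<in>weights l. f m n' s)" for m
        by (rule sum.swap)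
      then show ?thesis by (simp only:) (rule sum.swap)
    qed
    then show ?thesis
      by (simp only:) (intro sum.cong refl, simp add: complex_vector.scale_zero_left)
  qed
  also have "\<dots> = (\<Sum>s\<in>weights (1/2). \<Sum>m\<in>weights l. if m = M - s then of_real (cg q up l M s) *\<^sub>C X m n s else 0)"
    using n by (intro sum.cong refl) (subst sum.delta, auto simp: complex_vector.scale_zero_left)
  also have "\<dots> = (\<Sum>s\<in>weights (1/2). of_real (cg q up l M s) *\<^sub>C X (M - s) n s)"
    by (intro sum.cong refl, subst sum.delta) (use cg_nonweight_spin[OF l M] in \<open>auto simp: complex_vector.scale_zero_left\<close>)
  also have "\<dots> = (\<Sum>s\<in>weights (1/2). \<Sum>m'\<in>weights l. \<Sum>s'\<in>weights (1/2).
      (of_real (cg q up l M s) * dual_mult (t l m' (M - s)) (t (1/2) s' s) x) *\<^sub>C ev l m' n s')"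
    by (simp only: X_def scaleC_sum_right scaleC_scaleC)
  also have "\<dots> = (\<Sum>m'\<in>weights l. \<Sum>s'\<in>weights (1/2). \<Sum>s\<in>weights (1/2).
      (of_real (cg q up l M s) * dual_mult (t l m' (M - s)) (t (1/2) s' s) x) *\<^sub>C ev l m' n s')"
  proof -
    have "(\<Sum>s\<in>B. \<Sum>m\<in>C. \<Sum>s'\<in>E. f s m s') = (\<Sum>m\<in>C. \<Sum>s'\<in>E. \<Sum>s\<in>B. f s m s')"
      for f :: "real \<Rightarrow> real \<Rightarrow> real \<Rightarrow> 'h" and B C E
    proof -
      have "(\<Sum>s'\<in>E. \<Sum>s\<in>B. f s m s') = (\<Sum>s\<in>B. \<Sum>s'\<in>E. f s m s')" for m
        by (rule sum.swap)
      then show ?thesis by (simp only:) (rule sum.swap)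
    qed
    then show ?thesis .
  qed
  also have "\<dots> = (\<Sum>m'\<in>weights l. \<Sum>s'\<in>weights (1/2).
      (of_real (cg q up l (m' + s') s') * rep q (spin up l) x (m' + s') M) *\<^sub>C ev l m' n s')"
    by (intro sum.cong refl) (simp only: complex_vector.scale_sum_left[symmetric] cg_right[OF q l])
  also have "\<dots> = (\<Sum>s'\<in>weights (1/2). \<Sum>m'\<in>weights l.
      (of_real (cg q up l (m' + s') s') * rep q (spin up l) x (m' + s') M) *\<^sub>C ev l (m' + s' - s') n s')"
    by (subst sum.swap) simp
  also have "\<dots> = (\<Sum>s'\<in>weights (1/2). \<Sum>M'\<in>weights (spin up l).
      (of_real (cg q up l M' s') * rep q (spin up l) x M' M) *\<^sub>C ev l (M' - s') n s')"
  proof (rule sum.cong[OF refl])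
    fix s' assume s': "s' \<in> weights (1/2)"
    define g where "g M' = (of_real (cg q up l M' s') * rep q (spin up l) x M' M) *\<^sub>C ev l (M' - s') n s'" for M'
    \<comment> \<open>The substitution M' = m' + s' need not match the two index sets. Both sums are
      extended to their union; the added terms vanish by \<open>cg_nonweight_spin\<close> on one
      side and \<open>cg_nonweight\<close> on the other.\<close>
    define U where "U = (\<lambda>m. m + s') ` weights l \<union> weights (spin up l)"
    have "(\<Sum>m'\<in>weights l. (of_real (cg q up l (m' + s') s') * rep q (spin up l) x (m' + s') M) *\<^sub>C ev l (m' + s' - s') n s') =
        (\<Sum>m'\<in>weights l. g (m' + s'))"
      by (simp only: g_def)
    also have "\<dots> = sum g ((\<lambda>m. m + s') ` weights l)"
      by (subst sum.reindex) (auto simp: inj_on_def)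
    also have "\<dots> = sum g U"
    proof (rule sum.mono_neutral_left)
      show "\<forall>M'\<in>U - (\<lambda>m. m + s') ` weights l. g M' = 0"
      proof
        fix M' assume M': "M' \<in> U - (\<lambda>m. m + s') ` weights l"
        then have "M' \<in> weights (spin up l)" by (auto simp: U_def)
        moreover have "M' - s' \<notin> weights l" using M' by force
        ultimately show "g M' = 0" using cg_nonweight_spin[OF l _ s'] by (simp add: g_def complex_vector.scale_zero_left)
      qed
    qed (auto simp: U_def)
    also have "\<dots> = sum g (weights (spin up l))"
    proof (rule sum.mono_neutral_right)
      show "\<forall>M'\<in>U - weights (spin up l). g M' = 0"
        using cg_nonweight[OF l _ s'] by (auto simp: U_def g_def complex_vector.scale_zero_left)
    qed (auto simp: U_def)
    also have "\<dots> = (\<Sum>M'\<in>weights (spin up l). (of_real (cg q up l M' s') * rep q (spin up l) x M' M) *\<^sub>C ev l (M' - s') n s')"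
      by (rule sum.cong[OF refl]) (rule g_def)
    finally show "(\<Sum>m'\<in>weights l. (of_real (cg q up l (m' + s') s') * rep q (spin up l) x (m' + s') M) *\<^sub>C ev l (m' + s' - s') n s') =
      (\<Sum>M'\<in>weights (spin up l). (of_real (cg q up l M' s') * rep q (spin up l) x M' M) *\<^sub>C ev l (M' - s') n s')" .
  qed
  also have "\<dots> = (\<Sum>M'\<in>weights (spin up l). rep q (spin up l) x M' M *\<^sub>C eb (N, up, n, M'))"
    by (subst sum.swap) (simp only: eb_def prod.case l_def scaleC_sum_right scaleC_scaleC mult.commute)
  finally show ?thesis unfolding l_def .
qed

lemma eb_in_spin_component:
  assumes i: "(N, up, n, M) \<in> idx"
  shows "eb (N, up, n, M) \<in> spin_component q h \<iota> (J N)"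
  unfolding spin_component_def eb_def prod.case
proof (rule complex_vector.span_sum)
  fix s assume s: "s \<in> weights (1/2)"
  have n: "n \<in> weights (J N)" using i by (simp add: idx_def)
  show "of_real (cg q up (J N) M s) *\<^sub>C ev (J N) (M - s) n s \<in>
      cspan {basis_vector q h \<iota> (J N) m n s |m n s. m \<in> weights (J N) \<and> n \<in> weights (J N) \<and> s \<in> weights (1/2)}"
  proof (cases "M - s \<in> weights (J N)")
    case True
    then have "ev (J N) (M - s) n s = basis_vector q h \<iota> (J N) (M - s) n s"
      using basis_vector_eq_ev[OF J_half_nats True n s] by simp
    then show ?thesis
      using True n s by (intro complex_vector.span_scale complex_vector.span_base) blast
  next
    case False
    then have "cg q up (J N) M s = 0" using i s by (intro cg_nonweight_spin) (auto simp: idx_def)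
    then show ?thesis by (simp only: of_real_0 complex_vector.scale_zero_left complex_vector.span_zero)
  qed
qed

text \<open>For fixed n the vectors \<open>eb (N, up, n, M)\<close> are themselves the image of an
  intertwiner from the representation of spin \<open>spin up (J N)\<close>.\<close>

lemma eb_in_isotypic_component:
  assumes i: "(N, up, n, M) \<in> idx"
  shows "eb (N, up, n, M) \<in> isotypic_component q h \<iota> (J N) (spin up (J N))"
  unfolding isotypic_component_def
proof (rule complex_vector.span_base, rule UnionI)
  have j: "(N, up, n, M') \<in> idx" if "M' \<in> weights (spin up (J N))" for M'
    using i that by (simp add: idx_def)
  show "(\<lambda>M. eb (N, up, n, M)) ` weights (spin up (J N)) \<in> {T ` weights (spin up (J N)) |T.
       (\<forall>M\<in>weights (spin up (J N)). T M \<in> spin_component q h \<iota> (J N)) \<and>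
       (\<forall>x. \<forall>M\<in>weights (spin up (J N)).
          uq_action q h \<iota> (J N) x (T M) = (\<Sum>M'\<in>weights (spin up (J N)). rep q (spin up (J N)) x M' M *\<^sub>C T M'))}"
    using eb_in_spin_component[OF j] uq_action_eb[OF j]
    by (intro CollectI exI[of _ "\<lambda>M. eb (N, up, n, M)"]) auto
  show "eb (N, up, n, M) \<in> (\<lambda>M. eb (N, up, n, M)) ` weights (spin up (J N))"
    using i by (auto simp: idx_def)
qed

definition eigenvalue :: "nat \<times> bool \<times> real \<times> real \<Rightarrow> real" where
  "eigenvalue = (\<lambda>(N, up, n, M). if up then qint q (real N) else - qint q (real N + 2))"

lemma eb_eigenvector:
  assumes D: "is_dirac_operator q h \<iota> D" and i: "i \<in> idx"
  shows "(eb i, eigenvalue i *\<^sub>R eb i) \<in> D"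
proof -
  obtain N up n M where i': "i = (N, up, n, M)" by (cases i)
  have mem: "eb i \<in> isotypic_component q h \<iota> (J N) (spin up (J N))"
    using eb_in_isotypic_component i unfolding i' by blast
  have two: "2 * J N = real N" by simp
  show ?thesis
  proof (cases up)
    case True
    then have "eb i \<in> W_up q h \<iota> (J N)" using mem by (simp add: W_up_def spin_def)
    then have "(eb i, qint q (2 * J N) *\<^sub>R eb i) \<in> D"
      using D J_half_nats unfolding is_dirac_operator_def by blast
    then show ?thesis using True by (simp add: eigenvalue_def i')
  next
    case False
    have "M \<in> weights (spin False (J N))" using i False by (simp add: idx_def i')
    \<comment> \<open>The formal spin -1/2 has no weights, so no index of the lower sign has N =
      0.\<close>
    then have "J N \<noteq> 0" by (auto simp: spin_def weights_iff)
    then have "J N \<in> half_nats - {0}" by simp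
    moreover have "eb i \<in> W_down q h \<iota> (J N)" using mem False by (simp add: W_down_def spin_def)
    ultimately have "(eb i, (- qint q (2 * J N + 2)) *\<^sub>R eb i) \<in> D"
      using D unfolding is_dirac_operator_def by blast
    then show ?thesis using False by (simp add: eigenvalue_def i')
  qed
qed

end

section \<open>Boundedness and adjoints of left multiplication\<close>

section \<open>The representation by left multiplication\<close>

lemma dual_mult_sum_right: "dual_mult a (\<lambda>x. \<Sum>k\<in>F. d k * f k x) = (\<lambda>x. \<Sum>k\<in>F. d k * dual_mult a (f k) x)"
proof
  fix x
  have "dual_mult a (\<lambda>x. \<Sum>k\<in>F. d k * f k x) x = cop x (\<lambda>u v. \<Sum>k\<in>F. d k * (a u * f k v))"
    by (simp add: dual_mult_cop sum_distrib_left mult.left_commute)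
  then show "dual_mult a (\<lambda>x. \<Sum>k\<in>F. d k * f k x) x = (\<Sum>k\<in>F. d k * dual_mult a (f k) x)"
    by (simp only: cop_sum cop_cmult dual_mult_cop)
qed

context gns
begin

text \<open>Summing star(t_nm b) t_nm b over n leaves star(b) b, by orthonormality of the columns of
  (t_nm).\<close>

lemma sum_h_left_mult_t:
  assumes l: "l \<in> half_nats" and m: "m \<in> weights l" and b: "b \<in> A"
  shows "(\<Sum>n\<in>weights l. h (dual_mult (dual_star q (dual_mult (t l n m) b)) (dual_mult (t l n m) b))) =
    h (dual_mult (dual_star q b) b)"
proof -
  define Y where "Y n = dual_mult (dual_star q (dual_mult (t l n m) b)) (dual_mult (t l n m) b)" for n
  have Y: "Y n \<in> A" if "n \<in> weights l" for n
    unfolding Y_def using l m b that q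
    by (intro coordinate_algebra_mult coordinate_algebra_star coordinate_algebra_matrix_element)
  have "(\<Sum>n\<in>weights l. Y n x) = dual_mult (dual_star q b) b x" for x
  proof -
    have "Y n = dual_mult (dual_star q b) (dual_mult (dual_mult (dual_star q (t l n m)) (t l n m)) b)" for n
      by (simp only: Y_def dual_star_mult dual_mult_assoc)
    then have "Y n x = cop x (\<lambda>u v. dual_star q b u * cop v (\<lambda>v1 v2. dual_mult (dual_star q (t l n m)) (t l n m) v1 * b v2))" for n
      by (simp only: dual_mult_cop[of "dual_star q b"] dual_mult_cop[of "dual_mult (dual_star q (t l n m)) (t l n m)"])
    then have "(\<Sum>n\<in>weights l. Y n x) = cop x (\<lambda>u v. dual_star q b u * cop v (\<lambda>v1 v2. (\<Sum>n\<in>weights l. dual_mult (dual_star q (t l n m)) (t l n m) v1) * b v2))"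
      by (simp only: cop_sum[symmetric] sum_distrib_left[symmetric] sum_distrib_right[symmetric])
    also have "\<dots> = dual_mult (dual_star q b) (dual_mult counit b) x"
      unfolding sum_star_mult_matrix_element[OF q l m m] by (simp add: dual_mult_cop)
    finally show ?thesis by (simp add: dual_mult_counit_left)
  qed
  then have "(\<lambda>x. \<Sum>n\<in>weights l. Y n x) = dual_mult (dual_star q b) b" by (simp add: fun_eq_iff)
  then show ?thesis
    using h_sum[of "weights l" Y] Y by (simp add: Y_def)
qed

lemma norm_iota: "a \<in> A \<Longrightarrow> s \<in> weights (1/2) \<Longrightarrow> (norm (\<iota> a s))\<^sup>2 = Re (h (dual_mult (dual_star q a) a))"
  by (simp add: power2_norm_eq_cinner iota_inner del: weights_half)

definition left_bounded :: "uq_functional \<Rightarrow> real \<Rightarrow> bool" where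
  "left_bounded a C \<longleftrightarrow> C \<ge> 0 \<and> (\<forall>b\<in>A. \<forall>s\<in>weights (1/2). norm (\<iota> (dual_mult a b) s) \<le> C * norm (\<iota> b s))"

text \<open>The squared norms of t_nm b over all n are nonnegative and add up to that of b, so each
  one is bounded by it. The constant 1 reappears in the bounds for matrix entries.\<close>

lemma left_bounded_t:
  assumes l: "l \<in> half_nats" and w: "n \<in> weights l" "m \<in> weights l"
  shows "left_bounded (t l n m) 1"
  unfolding left_bounded_def
proof (intro conjI ballI)
  fix b s assume b: "b \<in> A" and s: "s \<in> weights (1/2)"
  have mem: "dual_mult (t l n m) b \<in> A" if "n \<in> weights l" for n
    using l w b that q by (intro coordinate_algebra_mult coordinate_algebra_matrix_element)
  have "(norm (\<iota> (dual_mult (t l n m) b) s))\<^sup>2 = Re (h (dual_mult (dual_star q (dual_mult (t l n m) b)) (dual_mult (t l n m) b)))"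
    by (rule norm_iota[OF mem[OF w(1)] s])
  also have "\<dots> \<le> (\<Sum>n\<in>weights l. Re (h (dual_mult (dual_star q (dual_mult (t l n m) b)) (dual_mult (t l n m) b))))"
    using w(1) h_pos[OF mem] by (intro member_le_sum) auto
  also have "\<dots> = Re (h (dual_mult (dual_star q b) b))"
    unfolding Re_sum[symmetric] sum_h_left_mult_t[OF l w(2) b] ..
  also have "\<dots> = (norm (\<iota> b s))\<^sup>2"
    by (rule norm_iota[OF b s, symmetric])
  finally show "norm (\<iota> (dual_mult (t l n m) b) s) \<le> 1 * norm (\<iota> b s)"
    using power2_le_imp_le by fastforce
qed simp

lemma left_bounded_exists:
  assumes "a \<in> A"
  shows "\<exists>C. left_bounded a C"
  using assms
proof (induction rule: coordinate_algebra_induct)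
  case zero
  have "left_bounded (\<lambda>x. 0) 0"
    using iota_zero by (simp add: left_bounded_def dual_mult_zero_left del: weights_half)
  then show ?case ..
next
  case (add a b)
  then obtain C D where C: "left_bounded a C" and D: "left_bounded b D" by blast
  have "norm (\<iota> (dual_mult (dual_add a b) x) s) \<le> (C + D) * norm (\<iota> x s)" if "x \<in> A" "s \<in> weights (1/2)" for x s
  proof -
    have "\<iota> (dual_mult (dual_add a b) x) s = \<iota> (dual_mult a x) s + \<iota> (dual_mult b x) s"
      unfolding dual_mult_add_left using add that q by (intro iota_add coordinate_algebra_mult)
    also have "norm \<dots> \<le> norm (\<iota> (dual_mult a x) s) + norm (\<iota> (dual_mult b x) s)"
      by (rule norm_triangle_ineq)
    also have "\<dots> \<le> C * norm (\<iota> x s) + D * norm (\<iota> x s)"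
      using C D that unfolding left_bounded_def by (intro add_mono) blast+
    finally show ?thesis by (simp only: distrib_right)
  qed
  then have "left_bounded (dual_add a b) (C + D)"
    using C D unfolding left_bounded_def by simp
  then show ?case ..
next
  case (scale c a)
  then obtain C where C: "left_bounded a C" by blast
  have "norm (\<iota> (dual_mult (dual_scale c a) x) s) \<le> (cmod c * C) * norm (\<iota> x s)" if "x \<in> A" "s \<in> weights (1/2)" for x s
  proof -
    have "\<iota> (dual_mult (dual_scale c a) x) s = c *\<^sub>C \<iota> (dual_mult a x) s"
      unfolding dual_mult_scale_left using scale that q by (intro iota_scale coordinate_algebra_mult)
    then have "norm (\<iota> (dual_mult (dual_scale c a) x) s) = cmod c * norm (\<iota> (dual_mult a x) s)" by simp
    also have "\<dots> \<le> cmod c * (C * norm (\<iota> x s))"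
      using C that unfolding left_bounded_def by (intro mult_left_mono) (simp_all del: weights_half)
    finally show ?thesis by (simp only: mult.assoc)
  qed
  then have "left_bounded (dual_scale c a) (cmod c * C)"
    using C unfolding left_bounded_def by simp
  then show ?case ..
qed (blast intro: left_bounded_t)

lemma iota_sum:
  assumes "finite F" "\<And>k. k \<in> F \<Longrightarrow> f k \<in> A" and s: "s \<in> weights (1/2)"
  shows "(\<lambda>x. \<Sum>k\<in>F. d k * f k x) \<in> A \<and> \<iota> (\<lambda>x. \<Sum>k\<in>F. d k * f k x) s = (\<Sum>k\<in>F. d k *\<^sub>C \<iota> (f k) s)"
  using assms(1,2)
proof (induction F rule: finite_induct)
  case empty
  show ?case using coordinate_algebra_zero iota_zero[OF s] by simp
next
  case (insert k F)
  have "(\<lambda>x. \<Sum>k\<in>insert k F. d k * f k x) = dual_add (dual_scale (d k) (f k)) (\<lambda>x. \<Sum>k\<in>F. d k * f k x)"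
    using insert.hyps by (simp add: fun_eq_iff dual_add_def dual_scale_def)
  then show ?case
    using insert s by (simp add: iota_add iota_scale coordinate_algebra_add coordinate_algebra_scale del: weights_half)
qed

text \<open>Different spinor components are orthogonal, so Pythagoras applies.\<close>

lemma norm_iota_pair:
  assumes "\<And>s. s \<in> weights (1/2) \<Longrightarrow> X s \<in> A"
  shows "(norm (\<Sum>s\<in>weights (1/2). \<iota> (X s) s))\<^sup>2 = (\<Sum>s\<in>weights (1/2). (norm (\<iota> (X s) s))\<^sup>2)"
proof -
  have "cinner (\<Sum>s\<in>weights (1/2). \<iota> (X s) s) (\<Sum>s\<in>weights (1/2). \<iota> (X s) s) =
      (\<Sum>s\<in>weights (1/2). \<Sum>s'\<in>weights (1/2). cinner (\<iota> (X s) s) (\<iota> (X s') s'))"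
    by (simp only: cinner_sum_left) (simp only: cinner_sum_right)
  also have "\<dots> = (\<Sum>s\<in>weights (1/2). \<Sum>s'\<in>weights (1/2). if s = s' then cinner (\<iota> (X s) s) (\<iota> (X s) s) else 0)"
    using assms by (intro sum.cong refl) (simp add: iota_inner del: weights_half)
  also have "\<dots> = (\<Sum>s\<in>weights (1/2). cinner (\<iota> (X s) s) (\<iota> (X s) s))"
    by (intro sum.cong refl) (subst sum.delta', simp_all)
  finally show ?thesis by (simp add: power2_norm_eq_cinner Re_sum del: weights_half)
qed

text \<open>\<open>left_bounded\<close> concerns vectors with a single spinor component. A general
  combination splits into two orthogonal components, each of which left multiplication preserves, so
  the same constant serves.\<close>

lemma left_mult_operator:
  assumes a: "a \<in> A" and C: "left_bounded a C"
  shows "\<exists>T. bounded_clinear T \<and> (\<forall>b\<in>A. \<forall>s\<in>weights (1/2). T (\<iota> b s) = \<iota> (dual_mult a b) s) \<and>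
    (\<forall>v. norm (T v) \<le> C * norm v)"
proof -
  define tt where "tt = (\<lambda>(l, m, n, s :: real). t l n m)"
  define sk where "sk = (\<lambda>(l :: real, m :: real, n :: real, s :: real). s)"
  define r where "r = (\<lambda>(l, m :: real, n, s :: real). complex_of_real (1 / t_norm l n))"
  have tt: "tt k \<in> A" and sk: "sk k \<in> weights (1/2)" and ev_k: "ev_fam k = r k *\<^sub>C \<iota> (tt k) (sk k)" if "k \<in> ev_idx" for k
    using that by (auto simp: ev_idx_def tt_def sk_def r_def ev_fam_def ev_def simp del: weights_half intro: coordinate_algebra_matrix_element)
  have C0: "C \<ge> 0" using C by (simp add: left_bounded_def)
  have bound: "norm (\<Sum>k\<in>F. c k *\<^sub>C (r k *\<^sub>C \<iota> (dual_mult a (tt k)) (sk k))) \<le> C * norm (\<Sum>k\<in>F. c k *\<^sub>C ev_fam k)"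
    if F: "finite F" "F \<subseteq> ev_idx" for F c
  proof -
    \<comment> \<open>\<open>d s\<close> selects the coefficients belonging to spinor component s,
      and \<open>B s\<close> is the resulting algebra element.\<close>
    define d where "d s k = (if sk k = s then c k * r k else 0)" for s k
    define B where "B s = (\<lambda>x. \<Sum>k\<in>F. d s k * tt k x)" for s
    have *: "(\<Sum>k\<in>F. c k *\<^sub>C (r k *\<^sub>C \<iota> (f k) (sk k))) = (\<Sum>s\<in>weights (1/2). \<Sum>k\<in>F. d s k *\<^sub>C \<iota> (f k) s)" for f
    proof -
      have "(\<Sum>s\<in>weights (1/2). \<Sum>k\<in>F. d s k *\<^sub>C \<iota> (f k) s) = (\<Sum>k\<in>F. \<Sum>s\<in>weights (1/2). if sk k = s then c k *\<^sub>C (r k *\<^sub>C \<iota> (f k) s) else 0)"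
        by (subst sum.swap) (intro sum.cong refl, simp add: d_def scaleC_scaleC complex_vector.scale_zero_left)
      also have "\<dots> = (\<Sum>k\<in>F. c k *\<^sub>C (r k *\<^sub>C \<iota> (f k) (sk k)))"
        using F sk by (intro sum.cong refl) (subst sum.delta', auto simp del: weights_half)
      finally show ?thesis ..
    qed
    have mem: "tt k \<in> A" if "k \<in> F" for k using tt F that by blast
    have B: "B s \<in> A" "\<iota> (B s) s = (\<Sum>k\<in>F. d s k *\<^sub>C \<iota> (tt k) s)" if "s \<in> weights (1/2)" for s
      unfolding B_def using iota_sum[where f=tt and d="d s", OF F(1) mem that] by blast+
    have aB: "dual_mult a (B s) \<in> A" "\<iota> (dual_mult a (B s)) s = (\<Sum>k\<in>F. d s k *\<^sub>C \<iota> (dual_mult a (tt k)) s)" if "s \<in> weights (1/2)" for s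
      unfolding B_def dual_mult_sum_right
      using iota_sum[where f="\<lambda>k. dual_mult a (tt k)" and d="d s", OF F(1) coordinate_algebra_mult[OF q a mem] that] by blast+
    have "(norm (\<Sum>k\<in>F. c k *\<^sub>C (r k *\<^sub>C \<iota> (dual_mult a (tt k)) (sk k))))\<^sup>2 = (norm (\<Sum>s\<in>weights (1/2). \<iota> (dual_mult a (B s)) s))\<^sup>2"
      unfolding * by (simp only: aB cong: sum.cong)
    also have "\<dots> = (\<Sum>s\<in>weights (1/2). (norm (\<iota> (dual_mult a (B s)) s))\<^sup>2)"
      by (rule norm_iota_pair[of "\<lambda>s. dual_mult a (B s)", OF aB(1)])
    also have "\<dots> \<le> (\<Sum>s\<in>weights (1/2). (C * norm (\<iota> (B s) s))\<^sup>2)"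
      using C B(1) unfolding left_bounded_def by (intro sum_mono power_mono) (simp_all del: weights_half)
    also have "\<dots> = C\<^sup>2 * (norm (\<Sum>s\<in>weights (1/2). \<iota> (B s) s))\<^sup>2"
    proof -
      have "(norm (\<Sum>s\<in>weights (1/2). \<iota> (B s) s))\<^sup>2 = (\<Sum>s\<in>weights (1/2). (norm (\<iota> (B s) s))\<^sup>2)"
        by (rule norm_iota_pair) (rule B(1))
      then show ?thesis by (simp only: power_mult_distrib sum_distrib_left)
    qed
    also have "(\<Sum>s\<in>weights (1/2). \<iota> (B s) s) = (\<Sum>k\<in>F. c k *\<^sub>C (r k *\<^sub>C \<iota> (tt k) (sk k)))"
      unfolding * by (simp only: B cong: sum.cong)
    also have "\<dots> = (\<Sum>k\<in>F. c k *\<^sub>C ev_fam k)"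
      using F ev_k by (intro sum.cong refl) auto
    finally have "(norm (\<Sum>k\<in>F. c k *\<^sub>C (r k *\<^sub>C \<iota> (dual_mult a (tt k)) (sk k))))\<^sup>2 \<le> (C * norm (\<Sum>k\<in>F. c k *\<^sub>C ev_fam k))\<^sup>2"
      by (simp only: power_mult_distrib)
    then show ?thesis
      by (rule power2_le_imp_le) (use C0 in simp)
  qed
  obtain T where T: "bounded_clinear T" "\<And>k. k \<in> ev_idx \<Longrightarrow> T (ev_fam k) = r k *\<^sub>C \<iota> (dual_mult a (tt k)) (sk k)"
    "\<And>v. norm (T v) \<le> C * norm v"
    using evb.operator_extension[OF C0 bound] by blast
  have "T (\<iota> b s) = \<iota> (dual_mult a b) s" if b: "b \<in> A" and s: "s \<in> weights (1/2)" for b s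
    using b
  proof (induction rule: coordinate_algebra_induct)
    case zero
    then show ?case by (simp only: iota_zero[OF s] bounded_clinear_0[OF T(1)] dual_mult_zero_right)
  next
    case (add b b')
    then show ?case
      using a s q by (simp add: iota_add bounded_clinear_add[OF T(1)] dual_mult_add_right coordinate_algebra_mult del: weights_half)
  next
    case (scale c b)
    then show ?case
      using a s q by (simp add: iota_scale bounded_clinear_scaleC[OF T(1)] dual_mult_scale_right coordinate_algebra_mult del: weights_half)
  next
    case (matrix_element l n m)
    have k: "(l, m, n, s) \<in> ev_idx" using matrix_element s by (simp add: ev_idx_def)
    have pos: "t_norm l n > 0" by (rule t_norm(1)[OF matrix_element])
    have "T (\<iota> (t l n m) s) = of_real (t_norm l n) *\<^sub>C T (ev_fam (l, m, n, s))"
      using iota_t_eq[OF matrix_element(1,3,2), of s] by (simp add: ev_fam_def bounded_clinear_scaleC[OF T(1)])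
    also have "\<dots> = (of_real (t_norm l n) * of_real (1 / t_norm l n)) *\<^sub>C \<iota> (dual_mult a (t l n m)) s"
      unfolding T(2)[OF k] by (simp only: r_def tt_def sk_def prod.case scaleC_scaleC)
    also have "complex_of_real (t_norm l n) * of_real (1 / t_norm l n) = 1"
      using pos by simp
    finally show ?case by (simp only: scaleC_one)
  qed
  then show ?thesis using T(1,3) by (intro exI[of _ T] conjI ballI allI)
qed

abbreviation \<eta> :: "uq_functional \<Rightarrow> 'h \<Rightarrow> 'h" where "\<eta> \<equiv> gns_representation q \<iota>"

abbreviation iota_set :: "'h set" where "iota_set \<equiv> {\<iota> a s |a s. a \<in> A \<and> s \<in> weights (1/2)}"

lemma eq_on_iota:
  assumes "bounded_clinear S" "bounded_clinear T" "\<And>b s. b \<in> A \<Longrightarrow> s \<in> weights (1/2) \<Longrightarrow> S (\<iota> b s) = T (\<iota> b s)"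
  shows "S = T"
  by (rule bounded_clinear_eq_on_dense[OF assms(1,2) _ iota_dense]) (use assms(3) in blast)

text \<open>Density makes a bounded operator with the prescribed values unique, which resolves the
  definite description in \<open>gns_representation\<close>.\<close>

lemma eta_eqI:
  assumes "bounded_clinear T" "\<And>b s. b \<in> A \<Longrightarrow> s \<in> weights (1/2) \<Longrightarrow> T (\<iota> b s) = \<iota> (dual_mult a b) s"
  shows "\<eta> a = T"
  unfolding gns_representation_def
proof (rule the_equality)
  fix S assume "bounded_clinear S \<and> (\<forall>b\<in>A. \<forall>s\<in>weights (1/2). S (\<iota> b s) = \<iota> (dual_mult a b) s)"
  then show "S = T" using assms by (intro eq_on_iota) (simp_all del: weights_half)
qed (use assms in blast)

lemma eta:
  assumes a: "a \<in> A"
  shows "bounded_clinear (\<eta> a)" and eta_iota: "b \<in> A \<Longrightarrow> s \<in> weights (1/2) \<Longrightarrow> \<eta> a (\<iota> b s) = \<iota> (dual_mult a b) s"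
proof -
  obtain C where C: "left_bounded a C" using left_bounded_exists[OF a] ..
  from left_mult_operator[OF a C] obtain T where T: "bounded_clinear T"
    "\<forall>b\<in>A. \<forall>s\<in>weights (1/2). T (\<iota> b s) = \<iota> (dual_mult a b) s" by (elim exE conjE)
  have "\<eta> a = T" by (rule eta_eqI[OF T(1)]) (use T(2) in blast)
  then show "bounded_clinear (\<eta> a)" "b \<in> A \<Longrightarrow> s \<in> weights (1/2) \<Longrightarrow> \<eta> a (\<iota> b s) = \<iota> (dual_mult a b) s"
    using T by blast+
qed

lemma norm_eta_le:
  assumes a: "a \<in> A" and C: "left_bounded a C"
  shows "norm (\<eta> a v) \<le> C * norm v"
proof -
  from left_mult_operator[OF a C] obtain T where T: "bounded_clinear T"
    "\<forall>b\<in>A. \<forall>s\<in>weights (1/2). T (\<iota> b s) = \<iota> (dual_mult a b) s" "\<forall>v. norm (T v) \<le> C * norm v" by (elim exE conjE)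
  have "\<eta> a = T" by (rule eta_eqI[OF T(1)]) (use T(2) in blast)
  then show ?thesis using T(3) by blast
qed

lemma eta_add:
  assumes a: "a \<in> A" and b: "b \<in> A"
  shows "\<eta> (dual_add a b) = (\<lambda>v. \<eta> a v + \<eta> b v)"
  by (rule eta_eqI[OF bounded_clinear_add_op[OF eta(1)[OF a] eta(1)[OF b]]])
     (use a b q in \<open>simp add: eta_iota dual_mult_add_left iota_add coordinate_algebra_mult del: weights_half\<close>)

lemma eta_scale:
  assumes a: "a \<in> A"
  shows "\<eta> (dual_scale c a) = (\<lambda>v. c *\<^sub>C \<eta> a v)"
  by (rule eta_eqI[OF bounded_clinear_scaleC_op[OF eta(1)[OF a]]])
     (use a q in \<open>simp add: eta_iota dual_mult_scale_left iota_scale coordinate_algebra_mult del: weights_half\<close>)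

lemma eta_mult:
  assumes a: "a \<in> A" and b: "b \<in> A"
  shows "\<eta> (dual_mult a b) = (\<lambda>v. \<eta> a (\<eta> b v))"
  by (rule eta_eqI[OF bounded_clinear_compose[OF eta(1)[OF a] eta(1)[OF b]]])
     (use a b q in \<open>simp add: eta_iota dual_mult_assoc coordinate_algebra_mult del: weights_half\<close>)

lemma eta_counit: "\<eta> counit = (\<lambda>v. v)"
  by (rule eta_eqI) (simp_all add: bounded_clinear_id dual_mult_counit_left)

text \<open>On the generating vectors the claim is star(a b) c = star(b) (star(a) c) under h.
  Continuity and density extend it to all x first, and then to all y.\<close>

lemma eta_adjoint:
  assumes a: "a \<in> A"
  shows "is_adjoint (\<eta> a) (\<eta> (dual_star q a))"
  unfolding is_adjoint_def
proof (intro allI)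
  fix x y
  have as: "dual_star q a \<in> A" by (rule coordinate_algebra_star[OF q(1) a])
  note lin = eta(1)[OF a] eta(1)[OF as]
  have base: "cinner (\<eta> a x) y = cinner x (\<eta> (dual_star q a) y)" if xy: "x \<in> iota_set" "y \<in> iota_set" for x y
  proof -
    obtain b s c s' where x: "x = \<iota> b s" "b \<in> A" "s \<in> weights (1/2)" and y: "y = \<iota> c s'" "c \<in> A" "s' \<in> weights (1/2)"
      using xy by blast
    then show ?thesis
      using a as q by (simp add: eta_iota iota_inner coordinate_algebra_mult dual_star_mult dual_mult_assoc del: weights_half)
  qed
  have dense: "P x" if P: "complex_vector.subspace {x. P x}" "closed {x. P x}" "\<And>x. x \<in> iota_set \<Longrightarrow> P x" for P and x :: 'h
  proof -
    have "cspan iota_set \<subseteq> {x. P x}" using P(1,3) by (intro complex_vector.span_minimal) auto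
    then have "closure (cspan iota_set) \<subseteq> {x. P x}" using P(2) by (rule closure_minimal)
    then show ?thesis using iota_dense by auto
  qed
  have "cinner (\<eta> a x) y = cinner x (\<eta> (dual_star q a) y)" if y: "y \<in> iota_set" for x y
  proof (rule dense[where P="\<lambda>x. cinner (\<eta> a x) y = cinner x (\<eta> (dual_star q a) y)"])
    show "complex_vector.subspace {x. cinner (\<eta> a x) y = cinner x (\<eta> (dual_star q a) y)}"
      unfolding complex_vector.subspace_def
      by (simp add: bounded_clinear_0[OF lin(1)] bounded_clinear_add[OF lin(1)] bounded_clinear_scaleC[OF lin(1)]
          cinner_add_left cinner_scaleC_left)
    show "closed {x. cinner (\<eta> a x) y = cinner x (\<eta> (dual_star q a) y)}"
      by (rule closed_Collect_eq[OF linear_continuous_on[OF bounded_linear_compose[OF bounded_linear_cinner_left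
          bounded_clinear_bounded_linear[OF lin(1)]]] linear_continuous_on[OF bounded_linear_cinner_left]])
  qed (rule base[OF _ y])
  note half = this
  show "cinner (\<eta> a x) y = cinner x (\<eta> (dual_star q a) y)"
  proof (rule dense[where P="\<lambda>y. cinner (\<eta> a x) y = cinner x (\<eta> (dual_star q a) y)"])
    show "complex_vector.subspace {y. cinner (\<eta> a x) y = cinner x (\<eta> (dual_star q a) y)}"
      unfolding complex_vector.subspace_def
      by (simp add: bounded_clinear_0[OF lin(2)] bounded_clinear_add[OF lin(2)] bounded_clinear_scaleC[OF lin(2)]
          cinner_add_right cinner_scaleC_right)
    show "closed {y. cinner (\<eta> a x) y = cinner x (\<eta> (dual_star q a) y)}"
      by (rule closed_Collect_eq[OF linear_continuous_on[OF bounded_linear_cinner_right]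
          linear_continuous_on[OF bounded_linear_compose[OF bounded_linear_cinner_right bounded_clinear_bounded_linear[OF lin(2)]]]])
  qed (rule half)
qed

lemma is_star_representation_eta: "is_star_representation q A \<eta>"
  unfolding is_star_representation_def
  by (intro conjI ballI allI) (simp_all add: eta(1) eta_adjoint eta_add eta_scale eta_mult eta_counit id_def)

end

section \<open>Estimates for the eigenvalues of F and for q-integers\<close>

section \<open>Commutators\<close>

text \<open>For y = x / sqrt(1 + x^2) in [0, 1] one has 1 - y \<le> 1 - y^2 = 1 / (1 + x^2).\<close>

lemma one_minus_sqrt_le:
  assumes "x \<ge> 0"
  shows "\<bar>x / sqrt (1 + x\<^sup>2) - 1\<bar> \<le> 1 / (1 + x\<^sup>2)" "\<bar>x / sqrt (1 + x\<^sup>2)\<bar> \<le> 1"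
proof -
  define y where "y = x / sqrt (1 + x\<^sup>2)"
  have pos: "1 + x\<^sup>2 > 0" by (simp add: add_pos_nonneg)
  have y2: "y\<^sup>2 = 1 - 1 / (1 + x\<^sup>2)"
    using pos by (simp add: y_def power_divide field_simps)
  have y0: "y \<ge> 0" using assms by (simp add: y_def)
  have "y\<^sup>2 \<le> 1\<^sup>2" using y2 pos by simp
  then have y1: "y \<le> 1" by (rule power2_le_imp_le) simp
  have "y\<^sup>2 \<le> y" using y0 y1 mult_left_le[of y y] by (simp add: power2_eq_square)
  then show "\<bar>x / sqrt (1 + x\<^sup>2) - 1\<bar> \<le> 1 / (1 + x\<^sup>2)" "\<bar>x / sqrt (1 + x\<^sup>2)\<bar> \<le> 1"
    using y0 y1 y2 by (simp_all add: y_def[symmetric])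
qed

lemma summable_quadratic_geometric:
  assumes "0 \<le> r" "r < (1::real)"
  shows "summable (\<lambda>n. real ((n + 1) * (n + 2)) * r ^ n)"
proof -
  \<comment> \<open>The ratio of consecutive terms is r (n+3)/(n+1), which tends to r; any number
    strictly between r and 1 eventually dominates it.\<close>
  define c where "c = (1 + r) / 2"
  have c: "c < 1" "c > r" using assms by (auto simp: c_def)
  obtain N :: nat where N: "real N \<ge> (3 * r) / (c - r)" using real_arch_simple by blast
  show ?thesis
  proof (rule summable_ratio_test[OF c(1), of N])
    fix n assume "N \<le> n"
    then have "(3 * r) / (c - r) \<le> real n" using N by (meson le_trans of_nat_le_iff order_trans)
    then have "3 * r \<le> real n * (c - r)" using c by (simp add: pos_divide_le_eq)
    then have "(real n + 3) * r \<le> c * (real n + 1)" using c assms by (simp add: algebra_simps)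
    then have "((real n + 3) * r) * ((real n + 2) * r ^ n) \<le> (c * (real n + 1)) * ((real n + 2) * r ^ n)"
      using assms by (intro mult_right_mono) auto
    then show "norm (real ((Suc n + 1) * (Suc n + 2)) * r ^ Suc n) \<le> c * norm (real ((n + 1) * (n + 2)) * r ^ n)"
      using assms by (simp add: abs_mult algebra_simps)
  qed
qed

lemma finite_card_weights: "card (weights (real N / 2)) \<le> N + 1"
proof -
  have "weights (real N / 2) \<subseteq> (\<lambda>k. real k - real N / 2) ` {..N}" by (auto simp: weights_def)
  then have "card (weights (real N / 2)) \<le> card ((\<lambda>k. real k - real N / 2) ` {..N})" by (rule card_mono[rotated]) simp
  also have "\<dots> \<le> card {..N}" by (rule card_image_le) simp
  finally show ?thesis by simp
qed

context gns
begin

text \<open>q-integers are invariant under inverting q, so the larger of q and 1/q governs their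
  growth and the cases q < 1 and q > 1 need no separate treatment.\<close>

definition R :: real where "R = max q (inverse q)"
definition r :: real where "r = inverse R"

lemma R_r: "R > 1" "r > 0" "r < 1" "R * r = 1"
proof -
  show "R > 1" unfolding R_def less_max_iff_disj using q by (auto simp: one_less_inverse_iff)
  then show "r > 0" "r < 1" "R * r = 1" by (simp_all add: r_def inverse_less_1_iff)
qed

lemma qint_ge: "R ^ N \<le> qint q (real N + 1)"
proof -
  have R: "R > 0" "R \<noteq> 1" using R_r by auto
  have eq: "qint q x = qint R x" for x
    using qint_inverse[OF q] by (auto simp: R_def max_def)
  have "R ^ N \<le> qint R (real N + 1)"
  proof (induction N)
    case (Suc N)
    have "R * R ^ N \<le> R * qint R (real N + 1)" using Suc R by simp
    also have "\<dots> \<le> R * qint R (real N + 1) + R powr (- (real N + 1)) * qint R 1"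
      using R by simp
    also have "\<dots> = qint R (real N + 1 + 1)"
      using qint_add[OF R(1), of "real N + 1" 1] R by simp
    finally show ?case by (simp add: add_ac)
  qed (use R in simp)
  then show ?thesis by (simp add: eq)
qed

lemma inverse_qint_le: "1 / qint q (real N + 1) \<le> r ^ N"
proof -
  have "0 < R ^ N" using R_r by simp
  then have "1 / qint q (real N + 1) \<le> 1 / R ^ N"
    using qint_ge[of N] by (intro divide_left_mono) auto
  then show ?thesis by (simp add: r_def power_inverse inverse_eq_divide power_divide)
qed

section \<open>Entries of the spin 1/2 generators in the eigenbasis\<close>

subsection \<open>Matrix entries of the generators\<close>

lemma spin_J: "spin True (J N) = J (Suc N)" "spin False (J (Suc N)) = J N"
  by (simp_all add: spin_def field_simps)

lemma half_in_A: "s1 \<in> weights (1/2) \<Longrightarrow> \<epsilon> \<in> weights (1/2) \<Longrightarrow> t (1/2) s1 \<epsilon> \<in> A"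
  by (intro coordinate_algebra_matrix_element half_half_nats)

text \<open>The factor of an entry that involves the row index only. It separates from the column
  part because the Haar norms do not depend on the column.\<close>

definition kappa :: "bool \<Rightarrow> nat \<Rightarrow> real \<Rightarrow> real \<Rightarrow> real" where
  "kappa up N n s1 = cg (inverse q) up (J N) (n + s1) s1 * t_norm (spin up (J N)) (n + s1) / t_norm (J N) n"

lemma kappa_cg_nonweight:
  assumes n: "n \<in> weights (J N)" "s1 \<in> weights (1/2)" and m: "m \<in> weights (J N)" "\<epsilon> \<in> weights (1/2)"
    and nw: "\<not> (n + s1 \<in> weights (spin up (J N)) \<and> m + \<epsilon> \<in> weights (spin up (J N)))"
  shows "kappa up N n s1 * cg (inverse q) up (J N) (m + \<epsilon>) \<epsilon> = 0"
  using nw cg_nonweight[OF J_half_nats n] cg_nonweight[OF J_half_nats m] by (auto simp: kappa_def)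

lemma eta_half_ev:
  assumes n: "n \<in> weights (J N)" "s1 \<in> weights (1/2)" and m: "m \<in> weights (J N)" "\<epsilon> \<in> weights (1/2)" and s: "s \<in> weights (1/2)"
  shows "\<eta> (t (1/2) s1 \<epsilon>) (ev (J N) m n s) =
    (\<Sum>up\<in>UNIV. of_real (kappa up N n s1 * cg (inverse q) up (J N) (m + \<epsilon>) \<epsilon>) *\<^sub>C ev (spin up (J N)) (m + \<epsilon>) (n + s1) s)"
proof -
  define c where "c up = complex_of_real (cg (inverse q) up (J N) (n + s1) s1 * cg (inverse q) up (J N) (m + \<epsilon>) \<epsilon>)" for up
  define T where "T up = t (spin up (J N)) (n + s1) (m + \<epsilon>)" for up
  have b: "t (1/2) s1 \<epsilon> \<in> A" and mem: "t (J N) n m \<in> A"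
    using n m by (auto intro: half_in_A coordinate_algebra_matrix_element simp del: weights_half)
  have cT: "dual_scale (c up) (T up) \<in> A" for up
    unfolding c_def T_def by (rule coordinate_algebra_cg_term[OF J_half_nats n m])
  have term_up: "of_real (1 / t_norm (J N) n) *\<^sub>C \<iota> (dual_scale (c up) (T up)) s =
      of_real (kappa up N n s1 * cg (inverse q) up (J N) (m + \<epsilon>) \<epsilon>) *\<^sub>C ev (spin up (J N)) (m + \<epsilon>) (n + s1) s" for up
  proof (cases "n + s1 \<in> weights (spin up (J N)) \<and> m + \<epsilon> \<in> weights (spin up (J N))")
    case True
    then have w: "n + s1 \<in> weights (spin up (J N))" "m + \<epsilon> \<in> weights (spin up (J N))" by auto
    have h: "spin up (J N) \<in> half_nats" by (rule spin_half_nats[OF J_half_nats w(1)])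
    have "\<iota> (dual_scale (c up) (T up)) s = c up *\<^sub>C \<iota> (T up) s"
      unfolding T_def by (intro iota_scale coordinate_algebra_matrix_element h w s)
    also have "\<iota> (T up) s = of_real (t_norm (spin up (J N)) (n + s1)) *\<^sub>C ev (spin up (J N)) (m + \<epsilon>) (n + s1) s"
      unfolding T_def by (rule iota_t_eq[OF h w(2,1)])
    finally show ?thesis
      by (simp add: scaleC_scaleC c_def kappa_def mult_ac)
  next
    case False
    have z: "kappa up N n s1 * cg (inverse q) up (J N) (m + \<epsilon>) \<epsilon> = 0" by (rule kappa_cg_nonweight[OF n m False])
    have "c up = 0" unfolding c_def
      using False cg_nonweight[OF J_half_nats n] cg_nonweight[OF J_half_nats m] by auto
    then have "\<iota> (dual_scale (c up) (T up)) s = 0" using iota_zero[OF s] by (simp only: dual_scale_zero)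
    then show ?thesis unfolding z by (simp add: complex_vector.scale_zero_left)
  qed
  have "\<eta> (t (1/2) s1 \<epsilon>) (ev (J N) m n s) = of_real (1 / t_norm (J N) n) *\<^sub>C \<iota> (dual_mult (t (1/2) s1 \<epsilon>) (t (J N) n m)) s"
    by (simp only: ev_def bounded_clinear_scaleC[OF eta(1)[OF b]] eta_iota[OF b mem s])
  also have "dual_mult (t (1/2) s1 \<epsilon>) (t (J N) n m) = dual_add (dual_scale (c True) (T True)) (dual_scale (c False) (T False))"
    unfolding c_def T_def by (rule matrix_element_half_mult'[OF q J_half_nats n m])
  also have "\<iota> \<dots> s = \<iota> (dual_scale (c True) (T True)) s + \<iota> (dual_scale (c False) (T False)) s"
    by (rule iota_add[OF cT cT s])
  finally show ?thesis
    by (simp only: scaleC_add_right term_up UNIV_bool sum.insert finite.intros sum.empty) (simp add: add.commute)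
qed

text \<open>The possible support of the image of \<open>eb i\<close> under a generator. Writing
  \<open>Suc N' = N\<close> avoids truncated subtraction at N = 0.\<close>

definition nbrs :: "nat \<times> bool \<times> real \<times> real \<Rightarrow> real \<Rightarrow> real \<Rightarrow> (nat \<times> bool \<times> real \<times> real) set" where
  "nbrs i s1 \<epsilon> = {i' \<in> idx. case i of (N, up, n, M) \<Rightarrow> \<exists>N' up'. i' = (N', up', n + s1, M + \<epsilon>) \<and> (N' = Suc N \<or> Suc N' = N)}"

lemma nbrs_idx: "nbrs i s1 \<epsilon> \<subseteq> idx"
  by (auto simp: nbrs_def)

lemma finite_nbrs: "finite (nbrs i s1 \<epsilon>)" and card_nbrs: "card (nbrs i s1 \<epsilon>) \<le> 4"
proof -
  obtain N up n M where i: "i = (N, up, n, M)" by (cases i)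
  \<comment> \<open>At N = 0 the truncated \<open>N - 1\<close> is 0, which only enlarges this
    superset.\<close>
  define X where "X = (\<lambda>(N', up'). (N', up' :: bool, n + s1, M + \<epsilon>)) ` ({Suc N, N - 1} \<times> UNIV)"
  have sub: "nbrs i s1 \<epsilon> \<subseteq> X" by (auto simp: nbrs_def i X_def)
  have fX: "finite X" by (simp add: X_def)
  then show "finite (nbrs i s1 \<epsilon>)" using sub finite_subset by blast
  have "card (nbrs i s1 \<epsilon>) \<le> card X" by (rule card_mono[OF fX sub])
  also have "\<dots> \<le> card ({Suc N, N - 1} \<times> (UNIV :: bool set))" unfolding X_def by (rule card_image_le) simp
  also have "\<dots> \<le> 4" by (simp add: card_insert_if)
  finally show "card (nbrs i s1 \<epsilon>) \<le> 4" .
qed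

context
  fixes s1 \<epsilon> :: real
  assumes s1: "s1 \<in> weights (1/2)" and \<epsilon>: "\<epsilon> \<in> weights (1/2)"
begin

abbreviation gen :: uq_functional where "gen \<equiv> t (1/2) s1 \<epsilon>"

lemma eta_eb:
  "\<eta> gen (eb (N, up, n, M)) = (\<Sum>s\<in>weights (1/2). of_real (cg q up (J N) M s) *\<^sub>C \<eta> gen (ev (J N) (M - s) n s))"
  by (simp only: eb_def prod.case bounded_clinear_sum[OF eta(1)[OF half_in_A[OF s1 \<epsilon>]]] bounded_clinear_scaleC[OF eta(1)[OF half_in_A[OF s1 \<epsilon>]]])

lemma eta_eb_in_span:
  assumes i: "i \<in> idx"
  shows "\<eta> gen (eb i) \<in> cspan (eb ` nbrs i s1 \<epsilon>)"
proof -
  obtain N up n M where i': "i = (N, up, n, M)" by (cases i)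
  have n: "n \<in> weights (J N)" and M: "M \<in> weights (spin up (J N))" using i by (auto simp: i' idx_def)
  show ?thesis
    unfolding i' eta_eb
  proof (rule complex_vector.span_sum)
    fix s assume s: "s \<in> weights (1/2)"
    show "of_real (cg q up (J N) M s) *\<^sub>C \<eta> gen (ev (J N) (M - s) n s) \<in> cspan (eb ` nbrs (N, up, n, M) s1 \<epsilon>)"
    proof (cases "M - s \<in> weights (J N)")
      case m: True
      have term_in: "of_real (kappa up' N n s1 * cg (inverse q) up' (J N) (M - s + \<epsilon>) \<epsilon>) *\<^sub>C ev (spin up' (J N)) (M - s + \<epsilon>) (n + s1) s
          \<in> cspan (eb ` nbrs (N, up, n, M) s1 \<epsilon>)" for up'
      proof (cases "n + s1 \<in> weights (spin up' (J N)) \<and> M - s + \<epsilon> \<in> weights (spin up' (J N))")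
        case True
        obtain N' where N': "spin up' (J N) = J N'" "N' = Suc N \<or> Suc N' = N"
        proof (cases up')
          case up': True
          have "spin up' (J N) = J (Suc N)" using spin_J(1)[of N] up' by metis
          then show ?thesis by (rule that) simp
        next
          case False
          have "N \<noteq> 0" using True False by (auto simp: spin_def weights_iff)
          then obtain N'' where "N = Suc N''" by (cases N) auto
          have "spin up' (J N) = J N''" using False spin_J(2)[of N''] \<open>N = Suc N''\<close> by simp
          then show ?thesis by (rule that) (simp add: \<open>N = Suc N''\<close>)
        qed
        have w: "M - s + \<epsilon> \<in> weights (J N')" "n + s1 \<in> weights (J N')" using True N' by auto
        have Ms: "M - s + \<epsilon> + s = M + \<epsilon>" by simp
        have "{i \<in> idx. \<exists>up. i = (N', up, n + s1, M - s + \<epsilon> + s)} \<subseteq> nbrs (N, up, n, M) s1 \<epsilon>"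
          unfolding Ms nbrs_def using N'(2) by auto
        then have "cspan (eb ` {i \<in> idx. \<exists>up. i = (N', up, n + s1, M - s + \<epsilon> + s)}) \<subseteq> cspan (eb ` nbrs (N, up, n, M) s1 \<epsilon>)"
          by (intro complex_vector.span_mono image_mono)
        then show ?thesis
          unfolding N'(1) using ev_in_span_eb[OF w s] by (intro complex_vector.span_scale) blast
      next
        case False
        then have "kappa up' N n s1 * cg (inverse q) up' (J N) (M - s + \<epsilon>) \<epsilon> = 0"
          by (rule kappa_cg_nonweight[OF n s1 m \<epsilon>])
        then show ?thesis by (simp only: of_real_0 complex_vector.scale_zero_left complex_vector.span_zero)
      qed
      show ?thesis
        unfolding eta_half_ev[OF n s1 m \<epsilon> s]
        by (rule complex_vector.span_scale, rule complex_vector.span_sum, rule term_in)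
    next
      case False
      have "cg q up (J N) M s = 0" by (rule cg_nonweight_spin[OF J_half_nats M s False])
      then show ?thesis by (simp only: of_real_0 complex_vector.scale_zero_left complex_vector.span_zero)
    qed
  qed
qed

definition entry :: "nat \<times> bool \<times> real \<times> real \<Rightarrow> nat \<times> bool \<times> real \<times> real \<Rightarrow> complex" where
  "entry i' i = cinner (eb i') (\<eta> gen (eb i))"

lemma eta_eb_expansion:
  assumes i: "i \<in> idx"
  shows "\<eta> gen (eb i) = (\<Sum>i'\<in>nbrs i s1 \<epsilon>. entry i' i *\<^sub>C eb i')"
  unfolding entry_def by (rule ebb.expansion_finite[OF finite_nbrs nbrs_idx eta_eb_in_span[OF i], symmetric])

lemma norm_eta_gen_le: "norm (\<eta> gen v) \<le> norm v"
  using norm_eta_le[OF half_in_A[OF s1 \<epsilon>] left_bounded_t[OF half_half_nats s1 \<epsilon>]] by simp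

lemma cmod_entry_le:
  assumes "i \<in> idx" "i' \<in> idx"
  shows "cmod (entry i' i) \<le> 1"
proof -
  have "cmod (entry i' i) \<le> norm (eb i') * norm (\<eta> gen (eb i))"
    unfolding entry_def by (rule norm_cinner_le)
  also have "\<dots> \<le> 1"
    using norm_eta_gen_le[of "eb i"] ebb.norm_e assms by simp
  finally show ?thesis .
qed

text \<open>Coupling acts on the column weight and the spinor, so \<open>kappa\<close> comes out of
  the sum over s and leaves the universal quantity \<open>raising\<close>.\<close>

lemma entry_raising:
  assumes i: "(N, up, n, M) \<in> idx" and i': "(Suc N, up', n + s1, M + \<epsilon>) \<in> idx"
  shows "entry (Suc N, up', n + s1, M + \<epsilon>) (N, up, n, M) = of_real (kappa True N n s1 * raising q up up' (J N) M \<epsilon>)"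
proof -
  have n: "n \<in> weights (J N)" and M: "M \<in> weights (spin up (J N))" using i by (auto simp: idx_def)
  have JS: "J (Suc N) = J N + 1/2" by (simp add: field_simps)
  have "entry (Suc N, up', n + s1, M + \<epsilon>) (N, up, n, M) =
      (\<Sum>s\<in>weights (1/2). of_real (cg q up (J N) M s) * cinner (eb (Suc N, up', n + s1, M + \<epsilon>)) (\<eta> gen (ev (J N) (M - s) n s)))"
    by (simp only: entry_def eta_eb cinner_sum_right cinner_scaleC_right)
  also have "\<dots> = (\<Sum>s\<in>weights (1/2). of_real (kappa True N n s1 *
      (cg q up' (J N + 1/2) (M + \<epsilon>) s * cg q up (J N) M s * cg (inverse q) True (J N) (M - s + \<epsilon>) \<epsilon>)))"
  proof (rule sum.cong[OF refl])
    fix s assume s: "s \<in> weights (1/2)"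
    show "of_real (cg q up (J N) M s) * cinner (eb (Suc N, up', n + s1, M + \<epsilon>)) (\<eta> gen (ev (J N) (M - s) n s)) =
      complex_of_real (kappa True N n s1 * (cg q up' (J N + 1/2) (M + \<epsilon>) s * cg q up (J N) M s * cg (inverse q) True (J N) (M - s + \<epsilon>) \<epsilon>))"
    proof (cases "M - s \<in> weights (J N)")
      case m: True
      define cc where "cc up2 = complex_of_real (kappa up2 N n s1 * cg (inverse q) up2 (J N) (M - s + \<epsilon>) \<epsilon>) *
          cinner (eb (Suc N, up', n + s1, M + \<epsilon>)) (ev (spin up2 (J N)) (M - s + \<epsilon>) (n + s1) s)" for up2
      have inner: "cinner (eb (Suc N, up', n + s1, M + \<epsilon>)) (ev l m n' s) =
          (if l = J (Suc N) \<and> n' = n + s1 \<and> m + s = M + \<epsilon> then of_real (cg q up' (J (Suc N)) (M + \<epsilon>) s) else 0)"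
        if "l \<in> half_nats" "m \<in> weights l" "n' \<in> weights l" for l m n'
        using cinner_ev_eb[OF i' that s] cinner_commute[of "eb (Suc N, up', n + s1, M + \<epsilon>)" "ev l m n' s"] by auto
      \<comment> \<open>The component of spin l - 1/2 is orthogonal to the target, whose label
        belongs to spin l + 1/2.\<close>
      have "cc False = 0"
      proof (cases "n + s1 \<in> weights (spin False (J N)) \<and> M - s + \<epsilon> \<in> weights (spin False (J N))")
        case True
        have "spin False (J N) \<in> half_nats" using True spin_half_nats[OF J_half_nats] by blast
        moreover have "spin False (J N) \<noteq> J (Suc N)" by (simp add: spin_def JS)
        ultimately show ?thesis using True inner by (simp add: cc_def)
      next
        case False
        from kappa_cg_nonweight[OF n s1 m \<epsilon> False] show ?thesis unfolding cc_def by (simp only: of_real_0 mult_zero_left)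
      qed
      moreover have "cc True = of_real (kappa True N n s1 * cg (inverse q) True (J N) (M - s + \<epsilon>) \<epsilon> * cg q up' (J N + 1/2) (M + \<epsilon>) s)"
      proof -
        have "n + s1 \<in> weights (J (Suc N))" "M - s + \<epsilon> \<in> weights (J (Suc N))"
          using weights_add_half[OF n s1] weights_add_half[OF m \<epsilon>] by (simp_all only: JS)
        then have "cinner (eb (Suc N, up', n + s1, M + \<epsilon>)) (ev (J (Suc N)) (M - s + \<epsilon>) (n + s1) s) =
            of_real (cg q up' (J (Suc N)) (M + \<epsilon>) s)"
          using inner[OF J_half_nats, of "M - s + \<epsilon>" "Suc N" "n + s1"] by simp
        then show ?thesis unfolding cc_def spin_J of_real_mult JS[symmetric] by (simp only:)
      qed
      moreover have "cinner (eb (Suc N, up', n + s1, M + \<epsilon>)) (\<eta> gen (ev (J N) (M - s) n s)) = cc True + cc False"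
      proof -
        have "(\<Sum>up\<in>UNIV. cc up) = cc True + cc False" by (simp add: UNIV_bool add.commute)
        then show ?thesis
          unfolding eta_half_ev[OF n s1 m \<epsilon> s] cinner_sum_right cinner_scaleC_right cc_def .
      qed
      ultimately show ?thesis by (simp add: mult_ac)
    next
      case False
      have "cg q up (J N) M s = 0" by (rule cg_nonweight_spin[OF J_half_nats M s False])
      then show ?thesis by simp
    qed
  qed
  also have "\<dots> = of_real (kappa True N n s1 * raising q up up' (J N) M \<epsilon>)"
    unfolding raising_def sum_distrib_left of_real_sum ..
  finally show ?thesis .
qed

end

text \<open>At the highest column weight with \<epsilon> = 1/2 the Clebsch-Gordan coefficients are 1
  and 0, so the generator maps a unit vector to \<open>kappa\<close> times a unit vector.
  Contractivity gives the bound without evaluating any Haar norm.\<close>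

lemma kappa_le:
  assumes n: "n \<in> weights (J N)" and s1: "s1 \<in> weights (1/2)"
  shows "\<bar>kappa True N n s1\<bar> \<le> 1"
proof -
  have h: "(1/2::real) \<in> weights (1/2)" by simp
  have m: "J N \<in> weights (J N)" by (simp add: weights_iff)
  have JS: "J N + 1/2 = J (Suc N)" by (simp add: field_simps)
  have e: "J N + (J N + 1/2) + 1/2 = real N + 1" "J N - (J N + 1/2) + 1/2 = 0" "2 * J N + 1 = real N + 1" by simp_all
  have one: "cg (inverse q) True (J N) (J N + 1/2) (1/2) = 1" and zero: "cg (inverse q) False (J N) (J N + 1/2) (1/2) = 0"
    using qint_pos[of "inverse q" "1 + real N"] q e by (simp_all add: cg_def cgA_def cgB_def add.commute)
  have "\<eta> (t (1/2) s1 (1/2)) (ev (J N) (J N) n (1/2)) = of_real (kappa True N n s1) *\<^sub>C ev (J (Suc N)) (J (Suc N)) (n + s1) (1/2)"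
    unfolding eta_half_ev[OF n s1 m h h] UNIV_bool spin_J(1)[symmetric]
    by (simp only: sum.insert finite.intros sum.empty insert_iff empty_iff simp_thms one[unfolded JS] zero[unfolded JS] spin_J(1) JS
        mult_zero_right mult_1_right of_real_0 complex_vector.scale_zero_left add_0_left add_0_right)
  then have "norm (of_real (kappa True N n s1) *\<^sub>C ev (J (Suc N)) (J (Suc N)) (n + s1) (1/2)) \<le> norm (ev (J N) (J N) n (1/2))"
    using norm_eta_gen_le[OF s1 h, of "ev (J N) (J N) n (1/2)"] by metis
  moreover have "norm (ev l m n s) = 1" if "(l, m, n, s) \<in> ev_idx" for l m n s
    using evb.norm_e[OF that] by (simp add: ev_fam_def)
  moreover have "(J N, J N, n, 1/2) \<in> ev_idx" using n m by (simp add: ev_idx_def)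
  moreover have "(J (Suc N), J (Suc N), n + s1, 1/2) \<in> ev_idx"
    using weights_add_half[OF n s1] weights_add_half[OF m h] unfolding JS by (simp add: ev_idx_def del: of_nat_Suc)
  ultimately show ?thesis by (simp add: norm_scaleC)
qed


text \<open>The eigenvalue of F on \<open>eb i\<close>.\<close>

definition phase :: "nat \<times> bool \<times> real \<times> real \<Rightarrow> real" where
  "phase i = eigenvalue i / sqrt (1 + (eigenvalue i)\<^sup>2)"

text \<open>The crude inequality x \<le> 1 + x^2 already gives decay. The factor R compensates for
  the exponent N - 1 and covers N = 0, where x may be 0.\<close>

lemma inverse_one_plus_square_le:
  assumes x: "x \<ge> 0" "N > 0 \<Longrightarrow> R ^ (N - 1) \<le> x"
  shows "1 / (1 + x\<^sup>2) \<le> R * r ^ N"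
proof -
  have R0: "R > 0" "R \<ge> 1" using R_r by auto
  have pos: "1 + x\<^sup>2 > 0" by (simp add: add_pos_nonneg)
  have "x * 1 \<le> 1 + x\<^sup>2"
  proof -
    have "0 \<le> (x - 1)\<^sup>2" by simp
    then have "2 * x \<le> 1 + x\<^sup>2" by (simp add: power2_eq_square algebra_simps)
    then show ?thesis using x(1) by linarith
  qed
  have "R ^ N \<le> R * (1 + x\<^sup>2)"
  proof (cases N)
    case 0
    have "1 * 1 \<le> R * (1 + x\<^sup>2)" using R0 by (intro mult_mono) auto
    then show ?thesis by (simp add: 0)
  next
    case (Suc k)
    then have "R ^ k \<le> 1 + x\<^sup>2" using x(2) \<open>x * 1 \<le> 1 + x\<^sup>2\<close> by simp
    then show ?thesis using R0 by (simp add: Suc)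
  qed
  then have "1 / (R * (1 + x\<^sup>2)) \<le> 1 / R ^ N"
    using R0 pos by (intro divide_left_mono mult_pos_pos zero_less_power) auto
  then have "R * (1 / (R * (1 + x\<^sup>2))) \<le> R * (1 / R ^ N)"
    using R0 by (intro mult_left_mono) auto
  then show ?thesis using R0 by (simp add: r_def power_inverse inverse_eq_divide power_divide)
qed

lemma eigenvalue_decay:
  "1 / (1 + (eigenvalue (N, up, n, M))\<^sup>2) \<le> R * r ^ N"
  "\<bar>phase (N, up, n, M) - (if up then 1 else -1)\<bar> \<le> R * r ^ N"
  "\<bar>phase (N, up, n, M)\<bar> \<le> 1"
proof -
  define x where "x = (if up then qint q (real N) else qint q (real N + 2))"
  have ev: "eigenvalue (N, up, n, M) = (if up then x else - x)" by (simp add: eigenvalue_def x_def)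
  have x0: "x \<ge> 0"
    using qint_pos[OF q, of "real N"] qint_pos[OF q, of "real N + 2"]
    by (cases "N = 0") (auto simp: x_def qint_def)
  have xN: "R ^ (N - 1) \<le> x" if "N > 0"
  proof (cases up)
    case True
    then show ?thesis using qint_ge[of "N - 1"] that by (simp add: x_def of_nat_diff)
  next
    case False
    have "R ^ (N - 1) \<le> R ^ (N + 1)" using R_r by (intro power_increasing) auto
    also have "\<dots> \<le> qint q (real (N + 1) + 1)" by (rule qint_ge)
    finally show ?thesis using False by (simp add: x_def add_ac)
  qed
  have le: "1 / (1 + x\<^sup>2) \<le> R * r ^ N" by (rule inverse_one_plus_square_le[OF x0 xN])
  then show "1 / (1 + (eigenvalue (N, up, n, M))\<^sup>2) \<le> R * r ^ N" by (simp add: ev)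
  have ph: "phase (N, up, n, M) = (if up then x / sqrt (1 + x\<^sup>2) else - (x / sqrt (1 + x\<^sup>2)))"
    by (simp add: phase_def ev)
  show "\<bar>phase (N, up, n, M)\<bar> \<le> 1" unfolding ph using one_minus_sqrt_le(2)[OF x0] by (cases up) (simp_all only: if_True if_False abs_minus_cancel)
  have "\<bar>phase (N, up, n, M) - (if up then 1 else -1)\<bar> = \<bar>x / sqrt (1 + x\<^sup>2) - 1\<bar>"
  proof -
    have "\<bar>- y - - 1\<bar> = \<bar>y - 1\<bar>" for y :: real by arith
    then show ?thesis unfolding ph by (cases up) (simp_all only: if_True if_False)
  qed
  then show "\<bar>phase (N, up, n, M) - (if up then 1 else -1)\<bar> \<le> R * r ^ N"
    using one_minus_sqrt_le(1)[OF x0] le by linarith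
qed

lemma cmod_entry_raising_le:
  assumes s1: "s1 \<in> weights (1/2)" and \<epsilon>: "\<epsilon> \<in> weights (1/2)"
    and i: "(N, up, n, M) \<in> idx" and i': "(Suc N, up', n + s1, M + \<epsilon>) \<in> idx" and ne: "up \<noteq> up'"
  shows "cmod (entry s1 \<epsilon> (Suc N, up', n + s1, M + \<epsilon>) (N, up, n, M)) \<le> r ^ N"
proof -
  have n: "n \<in> weights (J N)" and M: "M \<in> weights (spin up (J N))" using i by (auto simp: idx_def)
  have "\<bar>raising q up up' (J N) M \<epsilon>\<bar> \<le> 1 / qint q (real N + 1)"
    using raising_bound[OF q J_half_nats M \<epsilon> ne] by simp
  then have "\<bar>raising q up up' (J N) M \<epsilon>\<bar> \<le> r ^ N" using inverse_qint_le[of N] by linarith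
  then have "\<bar>kappa True N n s1\<bar> * \<bar>raising q up up' (J N) M \<epsilon>\<bar> \<le> 1 * r ^ N"
    using kappa_le[OF n s1] by (intro mult_mono) auto
  then show ?thesis unfolding entry_raising[OF s1 \<epsilon> i i'] norm_of_real abs_mult by simp
qed

text \<open>The two weights differ by at most 1, so the modulus is 1, q or 1/q.\<close>

lemma star_phase_quotient_le:
  assumes "s1 \<in> weights (1/2)" "\<epsilon> \<in> weights (1/2)"
  shows "cmod (of_real (star_phase q (1/2) s1 / star_phase q (1/2) \<epsilon>)) \<le> R"
proof -
  have "\<bar>star_phase q (1/2) x\<bar> = q powr (- x)" for x
    using q by (simp add: star_phase_def abs_mult power_abs)
  then have eq: "cmod (of_real (star_phase q (1/2) s1 / star_phase q (1/2) \<epsilon>)) = q powr (- s1) / q powr (- \<epsilon>)"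
    by (simp only: norm_of_real abs_divide)
  also have "\<dots> = q powr (- s1 - - \<epsilon>)" by (rule powr_diff[symmetric])
  also have "\<dots> \<le> R"
  proof -
    have "- s1 - - \<epsilon> = 0 \<or> - s1 - - \<epsilon> = 1 \<or> - s1 - - \<epsilon> = -1" using assms by auto
    then show ?thesis
    proof (elim disjE)
      assume "- s1 - - \<epsilon> = 0"
      then show ?thesis using q R_r(1) by simp
    next
      assume "- s1 - - \<epsilon> = 1"
      then show ?thesis using q by (simp add: R_def)
    next
      assume "- s1 - - \<epsilon> = -1"
      then show ?thesis using q by (simp only: powr_minus powr_one less_imp_le) (simp add: R_def)
    qed
  qed
  finally show ?thesis .
qed

text \<open>The star of a generator is a multiple of the generator with negated indices, so an entry
  lowering N is, up to a bounded factor, the conjugate of one raising it.\<close>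

lemma entry_adjoint:
  assumes s1: "s1 \<in> weights (1/2)" and \<epsilon>: "\<epsilon> \<in> weights (1/2)"
  shows "entry s1 \<epsilon> i' i = cnj (of_real (star_phase q (1/2) s1 / star_phase q (1/2) \<epsilon>) * entry (- s1) (- \<epsilon>) i i')"
proof -
  have w: "- s1 \<in> weights (1/2)" "- \<epsilon> \<in> weights (1/2)" using s1 \<epsilon> by auto
  have "entry s1 \<epsilon> i' i = cnj (cinner (\<eta> (t (1/2) s1 \<epsilon>) (eb i)) (eb i'))"
    unfolding entry_def[OF s1 \<epsilon>] by (rule cinner_commute)
  also have "cinner (\<eta> (t (1/2) s1 \<epsilon>) (eb i)) (eb i') = cinner (eb i) (\<eta> (dual_star q (t (1/2) s1 \<epsilon>)) (eb i'))"
    using eta_adjoint[OF half_in_A[OF s1 \<epsilon>]] by (simp only: is_adjoint_def)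
  also have "\<eta> (dual_star q (t (1/2) s1 \<epsilon>)) (eb i') =
      of_real (star_phase q (1/2) s1 / star_phase q (1/2) \<epsilon>) *\<^sub>C \<eta> (t (1/2) (- s1) (- \<epsilon>)) (eb i')"
    unfolding dual_star_matrix_element[OF q(1) half_half_nats s1 \<epsilon>] eta_scale[OF half_in_A[OF w]] ..
  finally show ?thesis by (simp only: cinner_scaleC_right entry_def[OF w])
qed

lemma cmod_entry_off_diagonal_le:
  assumes s1: "s1 \<in> weights (1/2)" and \<epsilon>: "\<epsilon> \<in> weights (1/2)"
    and i: "(N, up, n, M) \<in> idx" and i': "(N', up', n + s1, M + \<epsilon>) \<in> idx" and ne: "up \<noteq> up'"
    and N': "N' = Suc N \<or> Suc N' = N"
  shows "cmod (entry s1 \<epsilon> (N', up', n + s1, M + \<epsilon>) (N, up, n, M)) \<le> R\<^sup>2 * r ^ N"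
  using N'
proof
  assume [simp]: "N' = Suc N"
  have "1 * r ^ N \<le> R\<^sup>2 * r ^ N" using R_r by (intro mult_right_mono) (auto intro: one_le_power)
  then show ?thesis using cmod_entry_raising_le[OF s1 \<epsilon> i, of up'] i' ne by simp
next
  assume N: "Suc N' = N"
  have w: "- s1 \<in> weights (1/2)" "- \<epsilon> \<in> weights (1/2)" using s1 \<epsilon> by auto
  have return: "(Suc N', up, (n + s1) + - s1, (M + \<epsilon>) + - \<epsilon>) = (N, up, n, M)" using N by simp
  have "cmod (entry (- s1) (- \<epsilon>) (N, up, n, M) (N', up', n + s1, M + \<epsilon>)) \<le> r ^ N'"
    using cmod_entry_raising_le[OF w i', of up, unfolded return] i ne by simp
  then have "cmod (entry s1 \<epsilon> (N', up', n + s1, M + \<epsilon>) (N, up, n, M)) \<le> R * r ^ N'"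
    unfolding entry_adjoint[OF s1 \<epsilon>] complex_mod_cnj norm_mult
    using star_phase_quotient_le[OF s1 \<epsilon>] R_r by (intro mult_mono) auto
  \<comment> \<open>Inserting R r = 1 converts the exponent N' = N - 1 of the raising estimate into
    N at the price of one factor R.\<close>
  also have "R * r ^ N' = R * (R * r) * r ^ N'" using R_r by simp
  also have "\<dots> = R\<^sup>2 * r ^ N" unfolding N[symmetric] by (simp add: power2_eq_square)
  finally show ?thesis .
qed

lemma power_r_neighbour:
  assumes "N' = Suc N \<or> Suc N' = N"
  shows "r ^ N' \<le> R * r ^ N"
  using assms
proof
  assume [simp]: "N' = Suc N"
  have "r * r ^ N \<le> R * r ^ N" using R_r by (intro mult_right_mono) auto
  then show ?thesis by simp
next
  assume N: "Suc N' = N"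
  have "R * r ^ N = (R * r) * r ^ N'" unfolding N[symmetric] by simp
  then show ?thesis using R_r by simp
qed

text \<open>Either the two eigenvalues have the same sign, so that the phases differ by a decaying amount,
  or the matrix entry itself decays.\<close>

lemma commutator_entry_le:
  assumes s1: "s1 \<in> weights (1/2)" and \<epsilon>: "\<epsilon> \<in> weights (1/2)" and i: "i \<in> idx" and i': "i' \<in> nbrs i s1 \<epsilon>"
  shows "\<bar>phase i' - phase i\<bar> * cmod (entry s1 \<epsilon> i' i) \<le> 2 * R\<^sup>2 * r ^ fst i"
proof -
  obtain N up n M where ii: "i = (N, up, n, M)" by (cases i)
  obtain N' up' where ii': "i' = (N', up', n + s1, M + \<epsilon>)" and N': "N' = Suc N \<or> Suc N' = N" and i'x: "i' \<in> idx"
    using i' by (auto simp: nbrs_def ii)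
  show ?thesis
  proof (cases "up' = up")
    case True
    have a: "\<bar>phase i' - (if up then 1 else -1)\<bar> \<le> R * r ^ N'" "\<bar>phase i - (if up then 1 else -1)\<bar> \<le> R * r ^ N"
      unfolding ii ii' True by (rule eigenvalue_decay(2))+
    have "R * r ^ N' \<le> R * (R * r ^ N)" using power_r_neighbour[OF N'] R_r by simp
    moreover have "1 * (R * r ^ N) \<le> R * (R * r ^ N)" using R_r by (intro mult_right_mono) auto
    ultimately have "\<bar>phase i' - phase i\<bar> \<le> R * (R * r ^ N) + R * (R * r ^ N)" using a by linarith
    also have "\<dots> = 2 * R\<^sup>2 * r ^ N" by (simp add: power2_eq_square)
    finally have "\<bar>phase i' - phase i\<bar> * cmod (entry s1 \<epsilon> i' i) \<le> (2 * R\<^sup>2 * r ^ N) * 1"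
      using cmod_entry_le[OF s1 \<epsilon> i i'x] R_r by (intro mult_mono) auto
    then show ?thesis by (simp add: ii)
  next
    case False
    have "\<bar>phase i' - phase i\<bar> \<le> 2"
      using eigenvalue_decay(3)[of N up n M] eigenvalue_decay(3)[of N' up' "n + s1" "M + \<epsilon>"] unfolding ii ii' by linarith
    moreover have "cmod (entry s1 \<epsilon> i' i) \<le> R\<^sup>2 * r ^ N"
      unfolding ii ii' using i i'x False N' by (intro cmod_entry_off_diagonal_le[OF s1 \<epsilon>]) (auto simp: ii ii')
    ultimately have "\<bar>phase i' - phase i\<bar> * cmod (entry s1 \<epsilon> i' i) \<le> 2 * (R\<^sup>2 * r ^ N)"
      by (intro mult_mono) auto
    then show ?thesis by (simp add: ii)
  qed
qed

section \<open>Operators whose columns decay geometrically\<close>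

lemma sum_nbrs_le:
  assumes "\<And>i'. i' \<in> nbrs i s1 \<epsilon> \<Longrightarrow> norm (g i') \<le> B" "B \<ge> 0"
  shows "norm (\<Sum>i'\<in>nbrs i s1 \<epsilon>. g i') \<le> 4 * B"
proof -
  have "norm (\<Sum>i'\<in>nbrs i s1 \<epsilon>. g i') \<le> (\<Sum>i'\<in>nbrs i s1 \<epsilon>. B)"
    using assms(1) by (rule sum_norm_le)
  also have "\<dots> = real (card (nbrs i s1 \<epsilon>)) * B" by simp
  also have "\<dots> \<le> 4 * B" using card_nbrs[of i s1 \<epsilon>] assms(2) by (intro mult_right_mono) auto
  finally show ?thesis .
qed

text \<open>These column norms are what \<open>trace_classI\<close> sums. The property is stable
  under sums, under bounded operators on the left and under the algebra on the right, so the Leibniz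
  rule can be run without ideal properties of the trace class.\<close>

definition decaying :: "('h \<Rightarrow> 'h) \<Rightarrow> bool" where
  "decaying T \<longleftrightarrow> bounded_clinear T \<and> (\<exists>C\<ge>0. \<forall>i\<in>idx. norm (T (eb i)) \<le> C * r ^ fst i)"

lemma decayingI:
  "bounded_clinear T \<Longrightarrow> C \<ge> 0 \<Longrightarrow> (\<And>i. i \<in> idx \<Longrightarrow> norm (T (eb i)) \<le> C * r ^ fst i) \<Longrightarrow> decaying T"
  unfolding decaying_def by blast

lemma decayingD:
  assumes "decaying T"
  shows "bounded_clinear T" "\<exists>C\<ge>0. \<forall>i\<in>idx. norm (T (eb i)) \<le> C * r ^ fst i"
  using assms by (auto simp: decaying_def)

lemma decaying_add:
  assumes "decaying S" "decaying T"
  shows "decaying (\<lambda>v. S v + T v)"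
proof -
  obtain C C' where C: "C \<ge> 0" "\<forall>i\<in>idx. norm (S (eb i)) \<le> C * r ^ fst i"
    and C': "C' \<ge> 0" "\<forall>i\<in>idx. norm (T (eb i)) \<le> C' * r ^ fst i"
    using assms by (auto simp: decaying_def)
  show ?thesis
  proof (rule decayingI[OF bounded_clinear_add_op[OF assms[THEN decayingD(1)]], of "C + C'"])
    fix i assume "i \<in> idx"
    then have "norm (S (eb i)) \<le> C * r ^ fst i" "norm (T (eb i)) \<le> C' * r ^ fst i" using C C' by auto
    then show "norm (S (eb i) + T (eb i)) \<le> (C + C') * r ^ fst i"
      using norm_triangle_ineq[of "S (eb i)" "T (eb i)"] unfolding distrib_right by linarith
  qed (use C C' in simp)
qed

lemma decaying_compose_left:
  assumes S: "bounded_clinear S" and T: "decaying T"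
  shows "decaying (\<lambda>v. S (T v))"
proof -
  obtain K where K: "K \<ge> 0" "\<And>x. norm (S x) \<le> K * norm x" using bounded_clinear_norm_bound[OF S] by metis
  obtain C where C: "C \<ge> 0" "\<forall>i\<in>idx. norm (T (eb i)) \<le> C * r ^ fst i" using T by (auto simp: decaying_def)
  show ?thesis
  proof (rule decayingI[OF bounded_clinear_compose[OF S decayingD(1)[OF T]], of "K * C"])
    fix i assume "i \<in> idx"
    then have "K * norm (T (eb i)) \<le> K * (C * r ^ fst i)" using C K by (intro mult_left_mono) auto
    then show "norm (S (T (eb i))) \<le> K * C * r ^ fst i" using K(2)[of "T (eb i)"] unfolding mult.assoc by linarith
  qed (use K C in simp)
qed

lemma decaying_scaleC: "decaying T \<Longrightarrow> decaying (\<lambda>v. c *\<^sub>C T v)"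
  by (rule decaying_compose_left[OF bounded_clinear_scaleC_op[OF bounded_clinear_id]])

text \<open>A generator sends \<open>eb i\<close> to at most four basis vectors with label N + 1 or
  N - 1 and entries of modulus at most 1, so the constant grows by at most 4 R.\<close>

lemma decaying_compose_generator:
  assumes s1: "s1 \<in> weights (1/2)" and \<epsilon>: "\<epsilon> \<in> weights (1/2)" and T: "decaying T"
  shows "decaying (\<lambda>v. T (\<eta> (t (1/2) s1 \<epsilon>) v))"
proof -
  obtain C where C: "C \<ge> 0" "\<forall>i\<in>idx. norm (T (eb i)) \<le> C * r ^ fst i" using T by (auto simp: decaying_def)
  have T': "bounded_clinear T" by (rule decayingD(1)[OF T])
  show ?thesis
  proof (rule decayingI[OF bounded_clinear_compose[OF T' eta(1)[OF half_in_A[OF s1 \<epsilon>]]], of "4 * (C * R)"])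
    fix i assume i: "i \<in> idx"
    have "norm (\<Sum>i'\<in>nbrs i s1 \<epsilon>. entry s1 \<epsilon> i' i *\<^sub>C T (eb i')) \<le> 4 * (C * R * r ^ fst i)"
    proof (rule sum_nbrs_le)
      fix i' assume i': "i' \<in> nbrs i s1 \<epsilon>"
      then have i'x: "i' \<in> idx" using nbrs_idx by blast
      have "fst i' = Suc (fst i) \<or> Suc (fst i') = fst i" using i' by (cases i) (auto simp: nbrs_def)
      then have "C * r ^ fst i' \<le> C * (R * r ^ fst i)" using C power_r_neighbour by (intro mult_left_mono) auto
      then have "norm (T (eb i')) \<le> C * R * r ^ fst i" using C(2) i'x by (simp add: mult.assoc) (meson order_trans)
      then have "cmod (entry s1 \<epsilon> i' i) * norm (T (eb i')) \<le> 1 * (C * R * r ^ fst i)"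
        using cmod_entry_le[OF s1 \<epsilon> i i'x] by (intro mult_mono) auto
      then show "norm (entry s1 \<epsilon> i' i *\<^sub>C T (eb i')) \<le> C * R * r ^ fst i" by (simp add: norm_scaleC)
    qed (use C R_r in simp)
    then show "norm (T (\<eta> (t (1/2) s1 \<epsilon>) (eb i))) \<le> 4 * (C * R) * r ^ fst i"
      unfolding eta_eb_expansion[OF s1 \<epsilon> i] bounded_clinear_sum[OF T'] bounded_clinear_scaleC[OF T'] by simp
  qed (use C R_r in simp)
qed

lemma decaying_compose_eta:
  assumes a: "a \<in> A" and T: "decaying T"
  shows "decaying (\<lambda>v. T (\<eta> a v))"
  using q a T
\<comment> \<open>T is generalised because the product case passes to T composed with a
  generator.\<close>
proof (induction a arbitrary: T rule: coordinate_algebra_generator_induct)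
  case counit
  then show ?case by (simp add: eta_counit)
next
  case (add a b)
  show ?case
    unfolding eta_add[OF add.hyps(1,2)] bounded_clinear_add[OF decayingD(1)[OF add.prems]]
    by (rule decaying_add[OF add.IH(1)[OF add.prems] add.IH(2)[OF add.prems]])
next
  case (scale c a)
  show ?case
    unfolding eta_scale[OF scale.hyps(1)] bounded_clinear_scaleC[OF decayingD(1)[OF scale.prems]]
    by (rule decaying_scaleC[OF scale.IH[OF scale.prems]])
next
  case (mult s s0 a)
  show ?case
    unfolding eta_mult[OF half_in_A[OF mult.hyps(1,2)] mult.hyps(3)]
    by (rule mult.IH[OF decaying_compose_generator[OF mult.hyps(1,2) mult.prems]])
qed

context
  fixes F :: "'h \<Rightarrow> 'h"
  assumes F: "bounded_clinear F" and F_eb: "\<And>i. i \<in> idx \<Longrightarrow> F (eb i) = phase i *\<^sub>R eb i"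
begin

lemma decaying_commutator_generator:
  assumes s1: "s1 \<in> weights (1/2)" and \<epsilon>: "\<epsilon> \<in> weights (1/2)"
  shows "decaying (\<lambda>v. F (\<eta> (t (1/2) s1 \<epsilon>) v) - \<eta> (t (1/2) s1 \<epsilon>) (F v))"
proof -
  have b: "bounded_clinear (\<eta> (t (1/2) s1 \<epsilon>))" by (rule eta(1)[OF half_in_A[OF s1 \<epsilon>]])
  show ?thesis
  proof (rule decayingI[OF bounded_clinear_diff_op[OF bounded_clinear_compose[OF F b] bounded_clinear_compose[OF b F]], of "4 * (2 * R\<^sup>2)"])
    fix i assume i: "i \<in> idx"
    have "F (\<eta> (t (1/2) s1 \<epsilon>) (eb i)) = (\<Sum>i'\<in>nbrs i s1 \<epsilon>. entry s1 \<epsilon> i' i *\<^sub>C F (eb i'))"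
      unfolding eta_eb_expansion[OF s1 \<epsilon> i] bounded_clinear_sum[OF F] bounded_clinear_scaleC[OF F] ..
    also have "\<dots> = (\<Sum>i'\<in>nbrs i s1 \<epsilon>. (of_real (phase i') * entry s1 \<epsilon> i' i) *\<^sub>C eb i')"
    proof (rule sum.cong[OF refl])
      fix i' assume "i' \<in> nbrs i s1 \<epsilon>"
      then have "i' \<in> idx" using nbrs_idx by blast
      then show "entry s1 \<epsilon> i' i *\<^sub>C F (eb i') = (of_real (phase i') * entry s1 \<epsilon> i' i) *\<^sub>C eb i'"
        by (simp add: F_eb scaleR_scaleC scaleC_scaleC mult.commute)
    qed
    finally have 1: "F (\<eta> (t (1/2) s1 \<epsilon>) (eb i)) = (\<Sum>i'\<in>nbrs i s1 \<epsilon>. (of_real (phase i') * entry s1 \<epsilon> i' i) *\<^sub>C eb i')" .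
    have "\<eta> (t (1/2) s1 \<epsilon>) (F (eb i)) = of_real (phase i) *\<^sub>C \<eta> (t (1/2) s1 \<epsilon>) (eb i)"
      by (simp only: F_eb[OF i] scaleR_scaleC bounded_clinear_scaleC[OF b])
    also have "\<dots> = (\<Sum>i'\<in>nbrs i s1 \<epsilon>. (of_real (phase i) * entry s1 \<epsilon> i' i) *\<^sub>C eb i')"
      unfolding eta_eb_expansion[OF s1 \<epsilon> i] scaleC_sum_right scaleC_scaleC ..
    finally have "F (\<eta> (t (1/2) s1 \<epsilon>) (eb i)) - \<eta> (t (1/2) s1 \<epsilon>) (F (eb i)) =
        (\<Sum>i'\<in>nbrs i s1 \<epsilon>. (of_real (phase i' - phase i) * entry s1 \<epsilon> i' i) *\<^sub>C eb i')"
      unfolding 1 by (simp only: sum_subtractf[symmetric] complex_vector.scale_left_diff_distrib[symmetric]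
          left_diff_distrib[symmetric] of_real_diff)
    moreover have "norm (\<Sum>i'\<in>nbrs i s1 \<epsilon>. (of_real (phase i' - phase i) * entry s1 \<epsilon> i' i) *\<^sub>C eb i') \<le> 4 * (2 * R\<^sup>2 * r ^ fst i)"
    proof (rule sum_nbrs_le)
      fix i' assume i': "i' \<in> nbrs i s1 \<epsilon>"
      then have "i' \<in> idx" using nbrs_idx by blast
      then have "norm ((of_real (phase i' - phase i) * entry s1 \<epsilon> i' i) *\<^sub>C eb i') = \<bar>phase i' - phase i\<bar> * cmod (entry s1 \<epsilon> i' i)"
        by (simp only: norm_scaleC norm_mult norm_of_real ebb.norm_e mult_1_right)
      then show "norm ((of_real (phase i' - phase i) * entry s1 \<epsilon> i' i) *\<^sub>C eb i') \<le> 2 * R\<^sup>2 * r ^ fst i"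
        using commutator_entry_le[OF s1 \<epsilon> i i'] by simp
    qed (use R_r in simp)
    ultimately show "norm (F (\<eta> (t (1/2) s1 \<epsilon>) (eb i)) - \<eta> (t (1/2) s1 \<epsilon>) (F (eb i))) \<le> 4 * (2 * R\<^sup>2) * r ^ fst i"
      by simp
  qed simp
qed

lemma decaying_commutator:
  assumes a: "a \<in> A"
  shows "decaying (\<lambda>v. F (\<eta> a v) - \<eta> a (F v))"
  using q a
proof (induction a rule: coordinate_algebra_generator_induct)
  case counit
  show ?case
    by (rule decayingI[of _ 0]) (simp_all add: eta_counit bounded_clinear_diff_op[OF F F, simplified])
next
  case (add a b)
  have "(\<lambda>v. F (\<eta> (dual_add a b) v) - \<eta> (dual_add a b) (F v)) =
      (\<lambda>v. (F (\<eta> a v) - \<eta> a (F v)) + (F (\<eta> b v) - \<eta> b (F v)))"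
    by (simp add: eta_add[OF add.hyps(1,2)] bounded_clinear_add[OF F] algebra_simps)
  then show ?case using decaying_add[OF add.IH] by simp
next
  case (scale c a)
  have "(\<lambda>v. F (\<eta> (dual_scale c a) v) - \<eta> (dual_scale c a) (F v)) = (\<lambda>v. c *\<^sub>C (F (\<eta> a v) - \<eta> a (F v)))"
    by (simp add: eta_scale[OF scale.hyps(1)] bounded_clinear_scaleC[OF F] scaleC_diff_right)
  then show ?case using decaying_scaleC[OF scale.IH] by simp
next
  case (mult s s0 a)
  let ?b = "\<eta> (t (1/2) s s0)"
  have b: "bounded_clinear ?b" by (rule eta(1)[OF half_in_A[OF mult.hyps(1,2)]])
  \<comment> \<open>[F, b a] = [F, b] a + b [F, a]: the first term needs stability under right
    multiplication, the second only boundedness of b.\<close>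
  have "(\<lambda>v. F (\<eta> (dual_mult (t (1/2) s s0) a) v) - \<eta> (dual_mult (t (1/2) s s0) a) (F v)) =
      (\<lambda>v. (F (?b (\<eta> a v)) - ?b (F (\<eta> a v))) + ?b (F (\<eta> a v) - \<eta> a (F v)))"
    by (simp add: eta_mult[OF half_in_A[OF mult.hyps(1,2)] mult.hyps(3)] bounded_clinear_diff[OF b])
  then show ?case
    using decaying_add[OF decaying_compose_eta[OF mult.hyps(3) decaying_commutator_generator[OF mult.hyps(1,2)]]
        decaying_compose_left[OF b mult.IH]] by simp
qed

end

section \<open>Summation over the eigenbasis and the trace class property\<close>

lemma summable_decay: "(\<lambda>i. r ^ fst i) summable_on idx"
proof (rule nonneg_bdd_above_summable_on)
  have s: "summable (\<lambda>N. real ((N + 1) * (N + 2)) * r ^ N)"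
    using R_r by (intro summable_quadratic_geometric) auto
  define S where "S = 2 * (\<Sum>N. real ((N + 1) * (N + 2)) * r ^ N)"
  \<comment> \<open>A box containing all indices with label N: the weights of spin l + 1/2 include
    those of l - 1/2, so one set serves both signs and its size is quadratic in N.\<close>
  define X where "X N = {N} \<times> (UNIV :: bool set) \<times> weights (J N) \<times> weights (J (Suc N))" for N
  have fX: "finite (X N)" and cX: "card (X N) \<le> 2 * ((N + 1) * (N + 2))" for N
  proof -
    have fin: "finite (weights (J k))" for k by (simp add: weights_def)
    show "finite (X N)" by (simp add: X_def fin del: of_nat_Suc)
    have "card (X N) = 2 * (card (weights (J N)) * card (weights (J (Suc N))))"
      by (simp add: X_def card_cartesian_product del: of_nat_Suc)
    also have "\<dots> \<le> 2 * ((N + 1) * (Suc N + 1))"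
      using mult_le_mono[OF finite_card_weights[of N] finite_card_weights[of "Suc N"]] by (simp del: of_nat_Suc)
    finally show "card (X N) \<le> 2 * ((N + 1) * (N + 2))" by simp
  qed
  show "bdd_above (sum (\<lambda>i. r ^ fst i) ` {F. F \<subseteq> idx \<and> finite F})"
  proof (rule bdd_aboveI2)
    fix F assume F: "F \<in> {F. F \<subseteq> idx \<and> finite F}"
    then have "finite (fst ` F)" by simp
    then obtain K where K: "fst ` F \<subseteq> {..<K}" using finite_nat_iff_bounded by blast
    have sub: "F \<subseteq> (\<Union>N<K. X N)"
    proof
      fix i assume i: "i \<in> F"
      obtain N up n M where ii: "i = (N, up, n, M)" by (cases i)
      have "i \<in> idx" using i F by auto
      then have "n \<in> weights (J N)" "M \<in> weights (J N + 1/2)" using weights_spin by (auto simp: idx_def ii)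
      moreover have "J N + 1/2 = J (Suc N)" by (simp add: field_simps)
      ultimately have "i \<in> X N" by (simp add: X_def ii del: of_nat_Suc)
      moreover have "N < K" using K i by (auto simp: ii)
      ultimately show "i \<in> (\<Union>N<K. X N)" by blast
    qed
    have "(\<Sum>i\<in>F. r ^ fst i) \<le> (\<Sum>i\<in>(\<Union>N<K. X N). r ^ fst i)"
      using sub fX R_r by (intro sum_mono2) auto
    also have "\<dots> = (\<Sum>N<K. \<Sum>i\<in>X N. r ^ fst i)"
      by (rule sum.UNION_disjoint) (use fX in \<open>auto simp: X_def\<close>)
    also have "\<dots> = (\<Sum>N<K. real (card (X N)) * r ^ N)"
    proof (rule sum.cong[OF refl])
      fix N
      have "(\<Sum>i\<in>X N. r ^ fst i) = (\<Sum>i\<in>X N. r ^ N)" by (rule sum.cong[OF refl]) (auto simp: X_def)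
      then show "(\<Sum>i\<in>X N. r ^ fst i) = real (card (X N)) * r ^ N" by simp
    qed
    also have "\<dots> \<le> (\<Sum>N<K. real (2 * ((N + 1) * (N + 2))) * r ^ N)"
    proof (rule sum_mono)
      fix N
      show "real (card (X N)) * r ^ N \<le> real (2 * ((N + 1) * (N + 2))) * r ^ N"
        using R_r cX[of N] by (intro mult_right_mono of_nat_mono) auto
    qed
    also have "\<dots> = 2 * (\<Sum>N<K. real ((N + 1) * (N + 2)) * r ^ N)"
      unfolding sum_distrib_left of_nat_mult[of 2] mult.assoc by simp
    also have "\<dots> \<le> S"
      unfolding S_def using R_r by (intro mult_left_mono sum_le_suminf[OF s]) auto
    finally show "(\<Sum>i\<in>F. r ^ fst i) \<le> S" .
  qed
qed (use R_r in auto)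

lemma decaying_trace_class:
  assumes T: "decaying T" and T': "bounded_clinear T'" "is_adjoint T T'"
  shows "trace_class T"
proof (rule ebb.trace_classI[OF decayingD(1)[OF T] T'])
  obtain C where C: "C \<ge> 0" "\<forall>i\<in>idx. norm (T (eb i)) \<le> C * r ^ fst i" using T by (auto simp: decaying_def)
  show "(\<lambda>i. norm (T (eb i))) summable_on idx"
    by (rule summable_on_comparison_test[OF summable_on_cmult_right[OF summable_decay, of C]]) (use C in auto)
qed

lemma fredholm_module:
  assumes D: "is_dirac_operator q h \<iota> D"
  shows "one_summable_fredholm_module q A \<eta> (bounded_transform D)"
proof -
  define F where "F = bounded_transform D"
  have sa: "selfadjoint_operator D" using D by (simp add: is_dirac_operator_def)
  have F: "bounded_clinear F"
    unfolding F_def by (rule ebb.bounded_transform_diagonal(1)[OF sa eb_eigenvector[OF D]])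
  have F_eb: "F (eb i) = phase i *\<^sub>R eb i" if "i \<in> idx" for i
    unfolding F_def phase_def by (rule ebb.bounded_transform_diagonal(2)[OF sa eb_eigenvector[OF D] that])
  have adj: "is_adjoint F F" by (rule ebb.diagonal_is_adjoint[OF F F_eb])
  have sq: "bounded_clinear (\<lambda>v. F (F v) - v)"
    by (rule bounded_clinear_diff_op[OF bounded_clinear_compose[OF F F] bounded_clinear_id])
  have sq_eb: "F (F (eb i)) - eb i = (- (1 / (1 + (eigenvalue i)\<^sup>2))) *\<^sub>R eb i" if i: "i \<in> idx" for i
  proof -
    have pos: "1 + (eigenvalue i)\<^sup>2 > 0" by (simp add: add_pos_nonneg)
    \<comment> \<open>\<lambda>^2 / (1 + \<lambda>^2) - 1 = -1 / (1 + \<lambda>^2) for the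
      eigenvalue \<lambda> of D.\<close>
    have "(phase i)\<^sup>2 - 1 = - (1 / (1 + (eigenvalue i)\<^sup>2))"
      using pos by (simp add: phase_def power_divide field_simps)
    moreover have "F (F (eb i)) - eb i = ((phase i)\<^sup>2 - 1) *\<^sub>R eb i"
      by (simp add: F_eb[OF i] bounded_clinear_scaleR[OF F] power2_eq_square scaleR_diff_left)
    ultimately show ?thesis by simp
  qed
  have "decaying (\<lambda>v. F (F v) - v)"
  proof (rule decayingI[OF sq, of R])
    fix i assume i: "i \<in> idx"
    obtain N up n M where ii: "i = (N, up, n, M)" by (cases i)
    have "norm (F (F (eb i)) - eb i) = 1 / (1 + (eigenvalue i)\<^sup>2)"
      unfolding sq_eb[OF i] norm_scaleR ebb.norm_e[OF i] by (simp add: add_pos_nonneg)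
    then show "norm (F (F (eb i)) - eb i) \<le> R * r ^ fst i"
      using eigenvalue_decay(1)[of N up n M] by (simp add: ii)
  qed (use R_r in simp)
  then have tc1: "trace_class (\<lambda>v. F (F v) - v)"
    by (rule decaying_trace_class[OF _ sq ebb.diagonal_is_adjoint[OF sq sq_eb]])
  have tc2: "trace_class (\<lambda>v. F (\<eta> a v) - \<eta> a (F v))" if a: "a \<in> A" for a
  proof (rule decaying_trace_class[OF decaying_commutator[OF F F_eb a]])
    \<comment> \<open>\<open>decaying_trace_class\<close> asks for an explicit bounded adjoint; that
      of [F, \<eta> a] is [\<open>?b\<close>, F], as F is self-adjoint.\<close>
    let ?b = "\<eta> (dual_star q a)"
    have b: "bounded_clinear ?b" by (rule eta(1)[OF coordinate_algebra_star[OF q(1) a]])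
    show "bounded_clinear (\<lambda>v. ?b (F v) - F (?b v))"
      by (rule bounded_clinear_diff_op[OF bounded_clinear_compose[OF b F] bounded_clinear_compose[OF F b]])
    show "is_adjoint (\<lambda>v. F (\<eta> a v) - \<eta> a (F v)) (\<lambda>v. ?b (F v) - F (?b v))"
      using adj eta_adjoint[OF a] by (simp add: is_adjoint_def cinner_diff_left cinner_diff_right)
  qed
  show ?thesis
    unfolding one_summable_fredholm_module_def F_def[symmetric]
    using is_star_algebra_coordinate_algebra[OF q] is_star_representation_eta F adj tc1 tc2 by blast
qed

end

theorem mainTheorem2:
  fixes q :: real
    and h :: "uq_functional \<Rightarrow> complex"
    and \<iota> :: "uq_functional \<Rightarrow> real \<Rightarrow> 'h::complex_hilbert_space"
    and D :: "('h \<times> 'h) set"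
  assumes "q > 0" and "q \<noteq> 1"
    and "is_haar_state q h"
    and "is_gns_completion q h \<iota>"
    and "is_dirac_operator q h \<iota> D"
  shows "one_summable_fredholm_module q (coordinate_algebra q) (gns_representation q \<iota>)
           (bounded_transform D)"
proof -
  interpret gns q h \<iota> using assms by unfold_locales
  show ?thesis by (rule fredholm_module[OF assms(5)])
qed

end
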